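(* Let $\Sigma\subset\mathbb R^3$ be a knot or a simple arc (that is, a subset homeomorphic to a circle or to a closed segment), let $U\subset\mathbb R^3$ be a bounded open neighborhood of $\Sigma$, and let $\varepsilon>0$. Then: a) a typical homeomorphism $f\in\mathrm{Homeo}_\varepsilon(\overline U,\partial U)$ satisfies $$\dim P_\Pi(f(\Sigma))=\dim_H P_\Pi(f(\Sigma))=1$$ for any non-zero linear subspace $\Pi\subset\mathbb R^3$; b) a typical isotopy $F=\{f_t\}\in\mathrm{Isot}_\varepsilon(\overline U,\partial U)$ satisfies $$\dim P_\Pi(f_1(\Sigma))=\dim_H P_\Pi(f_1(\Sigma))=1$$ for any non-zero linear subspace $\Pi\subset\mathbb R^3$.
   Context: Notation: $I=[0,1]$; $\overline U$ and $\partial U$ are the closure and boundary of $U$; $\overline U$ carries the Euclidean metric $\rho$; $\dim$ is topological (covering) dimension; $\dim_H$ is Hausdorff dimension; $P_\Pi(M)$ is the orthogonal projection of a set $M$ into a linear subspace $\Pi$. An isotopy of a space $Y$ is a continuous map $F:Y\times I\to Y$ such that each $f_t=F(\cdot,t)$ ($t\in I$) is a homeomorphism of $Y$ onto itself and $f_0=\mathrm{id}$; it is also written $F=\{f_t\}$. $\mathrm{Homeo}_\varepsilon(\overline U,\partial U)$ is the set of all homeomorphisms $f$ of $\overline U$ onto itself with $f|_{\partial U}=\mathrm{id}$ and $\sup_{x\in\overline U}\rho(f(x),x)<\varepsilon$, with the topology of the metric $d(f,g)=\sup_{x\in\overline U}\rho(f(x),g(x))$. $\mathrm{Isot}_\varepsilon(\overline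 U,\partial U)$ is the set of all isotopies $F=\{f_t\}$ of $\overline U$ with $f_t|_{\partial U}=\mathrm{id}$ for all $t\in I$ and $\sup_{x\in\overline U,\,t\in I}\rho(f_t(x),x)<\varepsilon$, with the topology of the metric $D(F,G)=\sup_{x\in\overline U,\,t\in I}\rho(f_t(x),g_t(x))$. These spaces are completely metrizable, hence Baire spaces. Typical: a typical element of a non-empty Baire space $\mathcal X$ has a property if the set of elements of $\mathcal X$ not having the property is of first category in $\mathcal X$ (a countable union of nowhere dense sets). In a) and b) the property required of a typical element is the displayed equality simultaneously for all non-zero $\Pi$. *)

theory Defs
  imports "HOL-Analysis.Analysis"
begin

section \<open>Covering dimension\<close>

text \<open>
  The Cech--Lebesgue definition: \<open>dim X \<le> n\<close> iff every finite open cover has a finite open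
  refinement of order at most \<open>n\<close>, i.e. with no point in more than \<open>n + 1\<close> members.
  The values are \<open>-1\<close> (exactly for the empty space), \<open>0\<close>, \<open>1\<close>, \<dots>, and \<open>\<infinity>\<close>.
\<close>

definition covering_dim_le :: "'a topology \<Rightarrow> int \<Rightarrow> bool" where
  "covering_dim_le X n \<longleftrightarrow>
     (\<forall>\<U>. finite \<U> \<and> (\<forall>A\<in>\<U>. openin X A) \<and> \<Union>\<U> = topspace X \<longrightarrow>
        (\<exists>\<V>. finite \<V> \<and> (\<forall>B\<in>\<V>. openin X B) \<and> \<Union>\<V> = topspace X \<and>
             (\<forall>B\<in>\<V>. \<exists>A\<in>\<U>. B \<subseteq> A) \<and>
             (\<forall>x\<in>topspace X. int (card {B\<in>\<V>. x \<in> B}) \<le> n + 1)))"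

definition covering_dim :: "'a topology \<Rightarrow> ereal" where
  "covering_dim X = Inf {ereal (of_int n) | n. -1 \<le> n \<and> covering_dim_le X n}"


section \<open>Hausdorff dimension\<close>

text \<open>
  The case \<open>s = 0\<close> is separate because \<open>0 powr 0 = 0\<close>, while every nonempty set, singletons
  included, has weight \<open>1\<close> in the zero-dimensional Hausdorff measure.
\<close>

definition hausdorff_weight :: "real \<Rightarrow> 'a::metric_space set \<Rightarrow> ennreal" where
  "hausdorff_weight s E =
     (if E = {} then 0 else if s = 0 then 1 else ennreal (diameter E powr s))"

text \<open>
  Boundedness is required explicitly because \<open>diameter\<close> has no meaningful value on
  unbounded sets. Finite covers are included, as the \<open>E i\<close> may be empty.
\<close>

definition hausdorff_premeasure :: "real \<Rightarrow> real \<Rightarrow> 'a::metric_space set \<Rightarrow> ennreal" where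
  "hausdorff_premeasure s \<delta> A =
     (INF E \<in> {E :: nat \<Rightarrow> 'a set. A \<subseteq> (\<Union>i. E i) \<and> (\<forall>i. bounded (E i) \<and> diameter (E i) \<le> \<delta>)}.
        (\<Sum>i. hausdorff_weight s (E i)))"

definition hausdorff_measure :: "real \<Rightarrow> 'a::metric_space set \<Rightarrow> ennreal" where
  "hausdorff_measure s A = (SUP \<delta>\<in>{0<..}. hausdorff_premeasure s \<delta> A)"

definition hausdorff_dim :: "'a::metric_space set \<Rightarrow> ereal" where
  "hausdorff_dim A = Inf {ereal s | s. 0 \<le> s \<and> hausdorff_measure s A = 0}"


section \<open>Orthogonal projection\<close>

definition orth_proj :: "'a::euclidean_space set \<Rightarrow> 'a \<Rightarrow> 'a" where
  "orth_proj L x = (THE y. y \<in> L \<and> (\<forall>z\<in>L. orthogonal (x - y) z))"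

lemma orth_proj_unique:
  fixes L :: "'a::euclidean_space set"
  assumes L: "subspace L"
  shows "\<exists>!y. y \<in> L \<and> (\<forall>z\<in>L. orthogonal (x - y) z)"
proof -
  obtain y z where y: "y \<in> span L" and z: "\<And>w. w \<in> span L \<Longrightarrow> orthogonal z w" and x: "x = y + z"
    using orthogonal_subspace_decomp_exists by metis
  have sp: "span L = L" using L by (simp add: span_eq_iff)
  show ?thesis
  proof (rule ex1I)
    show "y \<in> L \<and> (\<forall>z\<in>L. orthogonal (x - y) z)" using y z x sp by auto
  next
    fix y' assume y': "y' \<in> L \<and> (\<forall>z\<in>L. orthogonal (x - y') z)"
    have mem: "y' - y \<in> L" using y y' sp L subspace_diff by auto
    have "(x - y) \<bullet> (y' - y) = 0" "(x - y') \<bullet> (y' - y) = 0"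
      using mem y' z x sp by (auto simp: orthogonal_def)
    then have "(y' - y) \<bullet> (y' - y) = 0" by (simp add: inner_diff_left)
    then show "y' = y" by simp
  qed
qed

lemma orth_proj:
  fixes L :: "'a::euclidean_space set"
  assumes "subspace L"
  shows "orth_proj L x \<in> L" and "z \<in> L \<Longrightarrow> orthogonal (x - orth_proj L x) z"
  using theI'[OF orth_proj_unique[OF assms, of x]] by (auto simp: orth_proj_def)


section \<open>First category and typical elements\<close>

definition nowhere_dense_in :: "'a topology \<Rightarrow> 'a set \<Rightarrow> bool" where
  "nowhere_dense_in X S \<longleftrightarrow> S \<subseteq> topspace X \<and> X interior_of (X closure_of S) = {}"

definition first_category_in :: "'a topology \<Rightarrow> 'a set \<Rightarrow> bool" where
  "first_category_in X S \<longleftrightarrow>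
     (\<exists>\<N>. countable \<N> \<and> (\<forall>N\<in>\<N>. nowhere_dense_in X N) \<and> S = \<Union>\<N>)"

definition typical_in :: "'a topology \<Rightarrow> ('a \<Rightarrow> bool) \<Rightarrow> bool" where
  "typical_in X P \<longleftrightarrow> first_category_in X {x \<in> topspace X. \<not> P x}"


section \<open>Spaces of homeomorphisms and isotopies\<close>

text \<open>
  The locale \<^locale>\<open>Metric_space\<close> asks for nonnegativity and symmetry of the distance function on
  the whole type, whereas the supremum formulas below are only meaningful on the space itself.
  Hence the distance is replaced by \<open>0\<close> off \<open>M\<close>; this does not affect the topology.
\<close>

definition dist_on :: "'a set \<Rightarrow> ('a \<Rightarrow> 'a \<Rightarrow> real) \<Rightarrow> 'a \<Rightarrow> 'a \<Rightarrow> real" where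
  "dist_on M d x y = (if x \<in> M \<and> y \<in> M then d x y else 0)"

text \<open>
  Maps on \<open>Y\<close> (on \<open>Y \<times> [0,1]\<close>) are represented by total functions that are \<open>undefined\<close>
  outside the domain; otherwise distinct functions could be at distance \<open>0\<close>.
\<close>

definition isotopy_on :: "'a::metric_space set \<Rightarrow> ('a \<times> real \<Rightarrow> 'a) \<Rightarrow> bool" where
  "isotopy_on Y F \<longleftrightarrow>
     continuous_on (Y \<times> {0..1}) F \<and> F ` (Y \<times> {0..1}) \<subseteq> Y \<and>
     (\<forall>t\<in>{0..1}. \<exists>g. homeomorphism Y Y (\<lambda>x. F (x, t)) g) \<and>
     (\<forall>x\<in>Y. F (x, 0) = x)"

definition Homeo_eps :: "real \<Rightarrow> 'a::metric_space set \<Rightarrow> 'a set \<Rightarrow> ('a \<Rightarrow> 'a) set" where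
  "Homeo_eps \<epsilon> Y B =
     {f \<in> extensional Y. (\<exists>g. homeomorphism Y Y f g) \<and> (\<forall>x\<in>B. f x = x) \<and>
        (SUP x\<in>Y. dist (f x) x) < \<epsilon>}"

definition Homeo_dist :: "real \<Rightarrow> 'a::metric_space set \<Rightarrow> 'a set \<Rightarrow> ('a \<Rightarrow> 'a) \<Rightarrow> ('a \<Rightarrow> 'a) \<Rightarrow> real" where
  "Homeo_dist \<epsilon> Y B = dist_on (Homeo_eps \<epsilon> Y B) (\<lambda>f g. SUP x\<in>Y. dist (f x) (g x))"

definition Homeo_topology :: "real \<Rightarrow> 'a::metric_space set \<Rightarrow> 'a set \<Rightarrow> ('a \<Rightarrow> 'a) topology" where
  "Homeo_topology \<epsilon> Y B = Metric_space.mtopology (Homeo_eps \<epsilon> Y B) (Homeo_dist \<epsilon> Y B)"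

definition Isot_eps :: "real \<Rightarrow> 'a::metric_space set \<Rightarrow> 'a set \<Rightarrow> ('a \<times> real \<Rightarrow> 'a) set" where
  "Isot_eps \<epsilon> Y B =
     {F \<in> extensional (Y \<times> {0..1}). isotopy_on Y F \<and> (\<forall>t\<in>{0..1}. \<forall>x\<in>B. F (x, t) = x) \<and>
        (SUP (x, t)\<in>Y \<times> {0..1}. dist (F (x, t)) x) < \<epsilon>}"

definition Isot_dist ::
    "real \<Rightarrow> 'a::metric_space set \<Rightarrow> 'a set \<Rightarrow> ('a \<times> real \<Rightarrow> 'a) \<Rightarrow> ('a \<times> real \<Rightarrow> 'a) \<Rightarrow> real" where
  "Isot_dist \<epsilon> Y B =
     dist_on (Isot_eps \<epsilon> Y B) (\<lambda>F G. SUP (x, t)\<in>Y \<times> {0..1}. dist (F (x, t)) (G (x, t)))"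

definition Isot_topology :: "real \<Rightarrow> 'a::metric_space set \<Rightarrow> 'a set \<Rightarrow> ('a \<times> real \<Rightarrow> 'a) topology" where
  "Isot_topology \<epsilon> Y B = Metric_space.mtopology (Isot_eps \<epsilon> Y B) (Isot_dist \<epsilon> Y B)"

text \<open>
  On a nonempty bounded set \<open>Y\<close>, in particular on \<open>closure U\<close>, the suprema above are taken over
  nonempty bounded sets, and \<^const>\<open>Homeo_dist\<close> and \<^const>\<open>Isot_dist\<close> are metrics.
\<close>

lemma Metric_space_dist_on_SUP:
  fixes Z :: "'a set" and M :: "('a \<Rightarrow> 'b::metric_space) set"
  assumes "Z \<noteq> {}" "bounded Y" and M: "\<And>f. f \<in> M \<Longrightarrow> f \<in> extensional Z \<and> f ` Z \<subseteq> Y"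
  shows "Metric_space M (dist_on M (\<lambda>f g. SUP z\<in>Z. dist (f z) (g z)))"
proof -
  define e where "e f g = (SUP z\<in>Z. dist (f z) (g z))" for f g :: "'a \<Rightarrow> 'b"
  have le: "dist (f z) (g z) \<le> e f g" if "f \<in> M" "g \<in> M" "z \<in> Z" for f g z
    unfolding e_def
  proof (rule cSUP_upper[OF \<open>z \<in> Z\<close>], rule bdd_aboveI2)
    fix w assume "w \<in> Z"
    then show "dist (f w) (g w) \<le> diameter Y"
      using M[OF that(1)] M[OF that(2)] diameter_bounded_bound[OF \<open>bounded Y\<close>] by blast
  qed
  obtain z0 where z0: "z0 \<in> Z" using assms by blast
  have nonneg: "0 \<le> e f g" if "f \<in> M" "g \<in> M" for f g
    using le[OF that z0] zero_le_dist[of "f z0" "g z0"] by linarith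
  have commute: "e f g = e g f" for f g
    by (simp add: e_def dist_commute)
  have zero: "e f g = 0 \<longleftrightarrow> f = g" if "f \<in> M" "g \<in> M" for f g
  proof
    assume 0: "e f g = 0"
    show "f = g"
    proof (rule extensionalityI[of _ Z])
      show "f z = g z" if "z \<in> Z" for z
        using le[OF \<open>f \<in> M\<close> \<open>g \<in> M\<close> that] 0 by simp
    qed (use M that in auto)
  next
    assume "f = g"
    then show "e f g = 0" using assms(1) by (simp add: e_def)
  qed
  have triangle: "e f h \<le> e f g + e g h" if "f \<in> M" "g \<in> M" "h \<in> M" for f g h
    unfolding e_def[of f h]
  proof (rule cSUP_least[OF assms(1)])
    fix z assume "z \<in> Z"
    then show "dist (f z) (h z) \<le> e f g + e g h"
      using dist_triangle[of "f z" "h z" "g z"] le[of f g z] le[of g h z] that by linarith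
  qed
  have "Metric_space M (dist_on M e)"
    by unfold_locales (auto simp: dist_on_def nonneg zero triangle intro: commute)
  then show ?thesis by (simp add: e_def[abs_def])
qed

lemma Metric_space_Homeo:
  assumes "Y \<noteq> {}" "bounded Y"
  shows "Metric_space (Homeo_eps \<epsilon> Y B) (Homeo_dist \<epsilon> Y B)"
  unfolding Homeo_dist_def
  by (rule Metric_space_dist_on_SUP[OF assms]) (auto simp: Homeo_eps_def homeomorphism_def)

lemma Metric_space_Isot:
  assumes "Y \<noteq> {}" "bounded Y"
  shows "Metric_space (Isot_eps \<epsilon> Y B) (Isot_dist \<epsilon> Y B)"
proof -
  have "Metric_space (Isot_eps \<epsilon> Y B)
          (dist_on (Isot_eps \<epsilon> Y B) (\<lambda>F G. SUP z\<in>Y \<times> {0..1}. dist (F z) (G z)))"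
    using assms(1) by (intro Metric_space_dist_on_SUP[OF _ assms(2)]) (auto simp: Isot_eps_def isotopy_on_def)
  then show ?thesis by (simp add: Isot_dist_def case_prod_unfold)
qed

end

theory Submission
  imports Defs
begin

text \<open>
  The properties ``\<open>f ` K\<close> has small \<open>s\<close>-content'' (for \<open>s > 1\<close>) and ``\<open>f ` K\<close> spans space'' are open, and
  countably many of them imply the conclusion: projections do not increase content, vanishing of
  the \<open>s\<close>-content for all \<open>s > 1\<close> bounds both dimensions by \<open>1\<close>, and a nondegenerate continuum has both
  dimensions at least \<open>1\<close>. The point is density, i.e. that a possibly wild arc \<open>A\<close> can be given small
  \<open>s\<close>-content by a small ambient isotopy.

  All but countably many planes of a given direction meet \<open>A\<close> in a totally disconnected set, since \<open>A\<close>
  becomes totally disconnected after removing a countable set. In such a plane any segment can be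
  replaced by a nearby arc missing \<open>A\<close>, and a planar arc is straightened in space by four small shears
  (Klee's trick). Hence \<open>A\<close> can be pushed off the \<open>1\<close>-skeleton of a fine cubical grid. A set missing the
  \<open>1\<close>-skeleton is then squeezed, one coordinate at a time, into an arbitrarily thin neighbourhood of
  the dual \<open>1\<close>-skeleton, where its \<open>s\<close>-content is small.
\<close>

section \<open>Ambient isotopies supported in an open set\<close>

text \<open>Density must be shown at an arbitrary \<open>f\<close>, where f(K) may be wild, of
  positive volume, and carried to a polygon by no ambient homeomorphism. So the roles are exchanged:
  the curve enters only through a property kept by all homeomorphisms (\<open>thin\<close>), and
  what gets straightened is an arc running along an edge of the grid. That arc is found off the
  curve, and the motion that takes it onto the edge carries the curve off the edge. Every motion is
  composed of shears along one direction, for which bijectivity is monotonicity on lines and the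
  isotopy is linear in time; hence one motion serves both a) and b). Exponents above 1 are forced:
  finitely many segments need about 1/\<tau> balls of radius comparable to \<tau>, so the content
  near them is of order \<tau> to the power s - 1. Exponent 2 is what the covering dimension asks
  for: a set covered by far fewer than \<eta>^2 / r^2 balls of radius r misses the edges of some
  translate of a grid of mesh about \<eta>.\<close>

definition ambient_isotopy :: "'a::euclidean_space set \<Rightarrow> real \<Rightarrow> ('a \<times> real \<Rightarrow> 'a) \<Rightarrow> bool" where
  "ambient_isotopy U \<eta> H \<longleftrightarrow>
     continuous_on (UNIV \<times> {0..1}) H \<and> (\<forall>t\<in>{0..1}. bij (\<lambda>x. H (x, t))) \<and> (\<forall>x. H (x, 0) = x) \<and>
     (\<forall>t\<in>{0..1}. (\<forall>x. x \<notin> U \<longrightarrow> H (x, t) = x) \<and> (\<forall>x. dist (H (x, t)) x \<le> \<eta>))"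

text \<open>Time-one maps, so that motions compose as maps while the isotopy stays available for b).
  Only bijectivity is asked at each time: inverses are needed on the compact set
  \<open>closure U\<close>, where a continuous bijection is a homeomorphism. The bound is a weak
  inequality, which adds up under composition.\<close>

definition push :: "'a::euclidean_space set \<Rightarrow> real \<Rightarrow> ('a \<Rightarrow> 'a) \<Rightarrow> bool" where
  "push U \<eta> h \<longleftrightarrow> (\<exists>H. ambient_isotopy U \<eta> H \<and> h = (\<lambda>x. H (x, 1)))"

lemma ambient_isotopyD:
  assumes "ambient_isotopy U \<eta> H"
  shows "continuous_on (UNIV \<times> {0..1}) H" and "t \<in> {0..1} \<Longrightarrow> bij (\<lambda>x. H (x, t))"
    and "H (x, 0) = x" and "t \<in> {0..1} \<Longrightarrow> x \<notin> U \<Longrightarrow> H (x, t) = x"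
    and "t \<in> {0..1} \<Longrightarrow> dist (H (x, t)) x \<le> \<eta>"
proof -
  note a = assms[unfolded ambient_isotopy_def]
  show "continuous_on (UNIV \<times> {0..1}) H" using a by (rule conjunct1)
  show "H (x, 0) = x" using a[THEN conjunct2, THEN conjunct2, THEN conjunct1] by (rule spec)
  show "bij (\<lambda>x. H (x, t))" if "t \<in> {0..1}" using a[THEN conjunct2, THEN conjunct1] that by (rule bspec)
  have b: "(\<forall>x. x \<notin> U \<longrightarrow> H (x, t) = x) \<and> (\<forall>x. dist (H (x, t)) x \<le> \<eta>)" if "t \<in> {0..1}"
    using a[THEN conjunct2, THEN conjunct2, THEN conjunct2] that by (rule bspec)
  show "H (x, t) = x" if "t \<in> {0..1}" "x \<notin> U" using b[OF that(1), THEN conjunct1] that(2) by blast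
  show "dist (H (x, t)) x \<le> \<eta>" if "t \<in> {0..1}" using b[OF that, THEN conjunct2] by (rule spec)
qed

lemma push_id:
  assumes "0 \<le> \<eta>" shows "push U \<eta> (\<lambda>x. x)"
proof -
  have "continuous_on (UNIV \<times> {0..1}) (fst :: 'a \<times> real \<Rightarrow> 'a)" by (rule continuous_on_fst) (rule continuous_on_id)
  then have "ambient_isotopy U \<eta> fst" using assms by (simp add: ambient_isotopy_def bij_def)
  then show ?thesis unfolding push_def by (intro exI[of _ fst]) simp
qed

lemma push_mono:
  assumes "push U \<eta> h" "\<eta> \<le> \<eta>'" shows "push U \<eta>' h"
proof -
  obtain H where H: "ambient_isotopy U \<eta> H" and h: "h = (\<lambda>x. H (x, 1))"
    using assms(1) by (auto simp: push_def)
  have "ambient_isotopy U \<eta>' H"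
    unfolding ambient_isotopy_def
    using ambient_isotopyD[OF H] order_trans[OF ambient_isotopyD(5)[OF H] assms(2)]
    by (intro conjI ballI allI impI)
  then show ?thesis unfolding push_def h by (intro exI) auto
qed

text \<open>The two isotopies are composed at equal times, so displacements add and the support
  stays in \<open>U\<close>.\<close>

lemma push_compose:
  assumes "push U a h" "push U b k"
  shows "push U (a + b) (k \<circ> h)"
proof -
  obtain H where H: "ambient_isotopy U a H" and h: "h = (\<lambda>x. H (x, 1))"
    using assms(1) by (auto simp: push_def)
  obtain K where K: "ambient_isotopy U b K" and k: "k = (\<lambda>x. K (x, 1))"
    using assms(2) by (auto simp: push_def)
  note H = ambient_isotopyD[OF H] and K = ambient_isotopyD[OF K]
  have "ambient_isotopy U (a + b) (\<lambda>z. K (H z, snd z))"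
    unfolding ambient_isotopy_def
  proof (intro conjI ballI allI impI)
    have "continuous_on (UNIV \<times> {0..1::real}) (\<lambda>z. (H z, snd z))"
      by (intro continuous_on_Pair H(1) continuous_on_snd continuous_on_id)
    then show "continuous_on (UNIV \<times> {0..1}) (\<lambda>z. K (H z, snd z))"
      by (rule continuous_on_compose2[OF K(1)]) auto
  next
    fix t :: real assume t: "t \<in> {0..1}"
    show "bij (\<lambda>x. K (H (x, t), snd (x, t)))"
      using bij_comp[OF H(2)[OF t] K(2)[OF t]] by (simp add: comp_def)
  next
    fix t x assume "t \<in> {0..1::real}"
    then show "dist (K (H (x, t), snd (x, t))) x \<le> a + b"
      using H(5)[of t x] K(5)[of t "H (x, t)"] dist_triangle[of "K (H (x, t), t)" x "H (x, t)"] by simp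
  qed (simp_all add: H K)
  then show ?thesis unfolding push_def h k by (intro exI) (auto simp: comp_def)
qed

lemma push_continuous:
  assumes "push U \<eta> h" shows "continuous_on S h"
proof -
  obtain H where H: "ambient_isotopy U \<eta> H" and h: "h = (\<lambda>x. H (x, 1))"
    using assms by (auto simp: push_def)
  show ?thesis
    unfolding h by (rule continuous_on_compose2[OF ambient_isotopyD(1)[OF H]]) (auto intro!: continuous_on_Pair continuous_on_id)
qed

lemma push_bij: "push U \<eta> h \<Longrightarrow> bij h"
  using ambient_isotopyD(2)[of U \<eta> _ 1] by (auto simp: push_def)

lemma push_dist: "push U \<eta> h \<Longrightarrow> dist (h x) x \<le> \<eta>"
  using ambient_isotopyD(5)[of U \<eta> _ 1] by (auto simp: push_def)

lemma push_off: "push U \<eta> h \<Longrightarrow> x \<notin> U \<Longrightarrow> h x = x"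
  using ambient_isotopyD(4)[of U \<eta> _ 1] by (auto simp: push_def)

text \<open>A point of \<open>U\<close> sent outside would have an image fixed by \<open>h\<close>,
  and injectivity would identify the two.\<close>

lemma push_in:
  assumes "push U \<eta> h" "x \<in> U" shows "h x \<in> U"
proof (rule ccontr)
  assume "h x \<notin> U"
  then have "h (h x) = h x" by (rule push_off[OF assms(1)])
  then have "h x = x" using push_bij[OF assms(1)] by (simp add: bij_def inj_eq)
  with \<open>h x \<notin> U\<close> assms(2) show False by simp
qed

lemma push_image_subset: "push U \<eta> h \<Longrightarrow> A \<subseteq> U \<Longrightarrow> h ` A \<subseteq> U"
  using push_in by blast

text \<open>Points with equal images lie on one line parallel to \<open>e\<close>. On such a line
  the map is strictly increasing by the slope condition, and it is within \<eta> of the identity,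
  hence onto by the intermediate value theorem.\<close>

lemma bij_shear:
  fixes u :: "'a::real_inner \<Rightarrow> real"
  assumes e: "norm e = 1" and cont: "continuous_on UNIV u" and bd: "\<And>x. \<bar>u x\<bar> \<le> \<eta>"
    and mono: "\<And>x t. t > 0 \<Longrightarrow> u (x + t *\<^sub>R e) > u x - t"
  shows "bij (\<lambda>x. x + u x *\<^sub>R e)"
proof -
  have "inj (\<lambda>x. x + u x *\<^sub>R e)"
  proof (rule injI)
    fix x y assume eq: "x + u x *\<^sub>R e = y + u y *\<^sub>R e"
    define s where "s = u x - u y"
    have "s *\<^sub>R e = y - x" using eq by (simp add: s_def algebra_simps)
    then have y: "y = x + s *\<^sub>R e" and x: "x = y + (-s) *\<^sub>R e" by simp_all
    consider "s > 0" | "s < 0" | "s = 0" by linarith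
    then show "x = y"
    proof cases
      case 1
      then have "u y > u x - s" using mono[of s x] unfolding y[symmetric] by simp
      then show ?thesis by (simp add: s_def)
    next
      case 2
      then have "u x > u y - (-s)" using mono[of "-s" y] unfolding x[symmetric] by simp
      then show ?thesis by (simp add: s_def)
    next
      case 3
      then show ?thesis using \<open>s *\<^sub>R e = y - x\<close> by simp
    qed
  qed
  moreover have "\<exists>x. y = x + u x *\<^sub>R e" for y
  proof -
    have nn: "0 \<le> \<eta>" using bd[of 0] by linarith
    have "\<exists>s. -\<eta> \<le> s \<and> s \<le> \<eta> \<and> s + u (y + s *\<^sub>R e) = 0"
    proof (rule IVT')
      show "-\<eta> + u (y + (-\<eta>) *\<^sub>R e) \<le> 0" using bd[of "y + (-\<eta>) *\<^sub>R e"] by linarith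
      show "0 \<le> \<eta> + u (y + \<eta> *\<^sub>R e)" using bd[of "y + \<eta> *\<^sub>R e"] by linarith
      show "continuous_on {-\<eta>..\<eta>} (\<lambda>s. s + u (y + s *\<^sub>R e))"
        by (intro continuous_intros continuous_on_compose2[OF cont]) auto
    qed (use nn in simp)
    then obtain s where "s + u (y + s *\<^sub>R e) = 0" by blast
    then have "y = (y + s *\<^sub>R e) + u (y + s *\<^sub>R e) *\<^sub>R e"
      by (simp add: add.assoc flip: scaleR_add_left)
    then show ?thesis by blast
  qed
  ultimately show ?thesis by (simp add: bij_def surj_def)
qed

text \<open>Points move linearly in time. At time t the shear function is t * u, which still
  decreases more slowly than at unit rate because t \<le> 1.\<close>

lemma push_shear:
  fixes u :: "'a::euclidean_space \<Rightarrow> real"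
  assumes e: "norm e = 1" and cont: "continuous_on UNIV u" and bd: "\<And>x. \<bar>u x\<bar> \<le> \<eta>"
    and off: "\<And>x. x \<notin> U \<Longrightarrow> u x = 0"
    and mono: "\<And>x t. t > 0 \<Longrightarrow> u (x + t *\<^sub>R e) > u x - t"
  shows "push U \<eta> (\<lambda>x. x + u x *\<^sub>R e)"
proof -
  have "ambient_isotopy U \<eta> (\<lambda>z. fst z + (snd z * u (fst z)) *\<^sub>R e)"
    unfolding ambient_isotopy_def
  proof (intro conjI ballI allI impI)
    show "continuous_on (UNIV \<times> {0..1}) (\<lambda>z. fst z + (snd z * u (fst z)) *\<^sub>R e)"
      by (intro continuous_on_add continuous_on_scaleR continuous_on_mult continuous_on_fst continuous_on_snd continuous_on_id
          continuous_on_const continuous_on_compose2[OF cont]) auto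
  next
    fix t :: real assume t: "t \<in> {0..1}"
    have "bij (\<lambda>x. x + (t * u x) *\<^sub>R e)"
    proof (rule bij_shear[OF e])
      show "continuous_on UNIV (\<lambda>x. t * u x)" by (intro continuous_intros cont)
      have "\<bar>t\<bar> * \<bar>u x\<bar> \<le> 1 * \<eta>" for x
        using t bd[of x] by (intro mult_mono) auto
      then show "\<bar>t * u x\<bar> \<le> \<eta>" for x by (simp add: abs_mult)
      show "t * u (x + s *\<^sub>R e) > t * u x - s" if "s > 0" for x s
      proof (cases "t = 0")
        case False
        then have "t * u (x + s *\<^sub>R e) > t * (u x - s)" using mono[OF that, of x] t by simp
        moreover have "t * s \<le> s" using t that by (simp add: mult_left_le_one_le)
        ultimately show ?thesis by (simp add: right_diff_distrib)
      qed (use that in simp)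
    qed
    then show "bij (\<lambda>x. fst (x, t) + (snd (x, t) * u (fst (x, t))) *\<^sub>R e)" by simp
  next
    fix t x assume "t \<in> {0..1::real}"
    then have "\<bar>t\<bar> * \<bar>u x\<bar> \<le> 1 * \<eta>" using bd[of x] by (intro mult_mono) auto
    then show "dist (fst (x, t) + (snd (x, t) * u (fst (x, t))) *\<^sub>R e) x \<le> \<eta>"
      by (simp add: dist_norm e abs_mult)
  qed (simp_all add: off)
  then show ?thesis unfolding push_def by (intro exI) auto
qed

text \<open>Meant for translations damped by a cutoff, whose slope is small. The squeezing map is
  too steep for it and goes through \<open>push_shear\<close> directly.\<close>

lemma push_shear_lipschitz:
  fixes u :: "'a::euclidean_space \<Rightarrow> real"
  assumes e: "norm e = 1" and cont: "continuous_on UNIV u" and bd: "\<And>x. \<bar>u x\<bar> \<le> \<eta>"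
    and off: "\<And>x. x \<notin> U \<Longrightarrow> u x = 0"
    and lip: "\<And>x t. t > 0 \<Longrightarrow> \<bar>u (x + t *\<^sub>R e) - u x\<bar> \<le> t / 2"
  shows "push U \<eta> (\<lambda>x. x + u x *\<^sub>R e)"
proof (rule push_shear[OF e cont bd off])
  show "u (x + t *\<^sub>R e) > u x - t" if "t > 0" for x t
    using lip[OF that, of x] that by linarith
qed

section \<open>Cutoff functions of the distance to a set\<close>

definition cutoff :: "real \<Rightarrow> 'a::metric_space set \<Rightarrow> 'a \<Rightarrow> real" where
  "cutoff R S x = max 0 (min 1 (2 - infdist x S / R))"

lemma cutoff_bounds: "0 \<le> cutoff R S x" "cutoff R S x \<le> 1" "\<bar>cutoff R S x\<bar> \<le> 1"
  by (auto simp: cutoff_def)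

lemma continuous_on_cutoff: "continuous_on T (cutoff R S)"
  unfolding cutoff_def divide_inverse by (intro continuous_intros)

lemma cutoff_eq_1: "R > 0 \<Longrightarrow> infdist x S \<le> R \<Longrightarrow> cutoff R S x = 1"
  by (simp add: cutoff_def divide_le_eq)

lemma cutoff_eq_0: "R > 0 \<Longrightarrow> infdist x S \<ge> 2 * R \<Longrightarrow> cutoff R S x = 0"
  by (simp add: cutoff_def le_divide_eq)

lemma cutoff_lipschitz: 
  assumes "R > 0" shows "\<bar>cutoff R S x - cutoff R S y\<bar> \<le> dist x y / R"
proof -
  have "\<bar>infdist x S - infdist y S\<bar> \<le> dist x y" by (rule infdist_triangle_abs)
  then have "\<bar>infdist x S - infdist y S\<bar> / R \<le> dist x y / R"
    using assms by (simp add: divide_right_mono)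
  moreover have "\<bar>infdist x S - infdist y S\<bar> / R = \<bar>infdist x S / R - infdist y S / R\<bar>"
    using assms by (metis abs_divide abs_of_pos diff_divide_distrib)
  ultimately show ?thesis by (auto simp: cutoff_def)
qed

lemma cutoff_off:
  assumes "R > 0" "\<And>x. infdist x S \<le> 2 * R \<Longrightarrow> x \<in> U" "x \<notin> U"
  shows "cutoff R S x = 0"
proof (rule cutoff_eq_0[OF assms(1)])
  show "2 * R \<le> infdist x S" using assms(2)[of x] assms(3) by (meson linear)
qed

text \<open>A translation by \<open>c\<close> damped over a collar of width \<open>R\<close> has
  slope at most |c| / R; the bound R / 2 yields the slope 1/2 asked for in
  \<open>push_shear_lipschitz\<close>.\<close>

lemma cutoff_mult_lipschitz:
  assumes "R > 0" "\<bar>c\<bar> \<le> R / 2"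
  shows "\<bar>cutoff R S x * c - cutoff R S y * c\<bar> \<le> dist x y / 2"
proof -
  have "\<bar>cutoff R S x * c - cutoff R S y * c\<bar> = \<bar>cutoff R S x - cutoff R S y\<bar> * \<bar>c\<bar>"
    by (simp add: abs_mult flip: left_diff_distrib)
  also have "\<dots> \<le> (dist x y / R) * (R / 2)"
    using cutoff_lipschitz[OF assms(1)] assms by (intro mult_mono) auto
  finally show ?thesis using assms by simp
qed

lemma compact_in_open_infdist:
  fixes A :: "'a::heine_borel set"
  assumes "compact A" "A \<noteq> {}" "open U" "A \<subseteq> U"
  obtains \<rho> where "\<rho> > 0" "\<And>x. infdist x A \<le> \<rho> \<Longrightarrow> x \<in> U"
proof -
  obtain \<rho> where \<rho>: "\<rho> > 0" "(\<Union>x\<in>A. cball x \<rho>) \<subseteq> U"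
    using compact_subset_open_imp_cball_epsilon_subset[OF assms(1,3,4)] by blast
  show ?thesis
  proof (rule that[OF \<rho>(1)])
    fix x assume "infdist x A \<le> \<rho>"
    moreover obtain a where "a \<in> A" "infdist x A = dist x a"
      using infdist_attains_inf[of A x] assms compact_imp_closed by blast
    ultimately show "x \<in> U" using \<rho>(2) by (force simp: dist_commute)
  qed
qed

section \<open>Totally disconnected sets and thin compacta\<close>

definition tot_disc :: "'a::topological_space set \<Rightarrow> bool" where
  "tot_disc S \<longleftrightarrow> (\<forall>C. connected C \<and> C \<subseteq> S \<longrightarrow> (\<exists>a. C \<subseteq> {a}))"

text \<open>The density part uses no more about knots and arcs than this and infinitude. The
  property is kept by injective continuous maps, so it holds for f(K) whatever \<open>f\<close>
  is.\<close>

definition thin :: "'a::metric_space set \<Rightarrow> bool" where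
  "thin A \<longleftrightarrow> compact A \<and> (\<exists>D. countable D \<and> tot_disc (A - D))"

lemma tot_disc_subset: "tot_disc S \<Longrightarrow> T \<subseteq> S \<Longrightarrow> tot_disc T"
  unfolding tot_disc_def by (meson subset_trans)

lemma tot_disc_inj_vimage:
  assumes "tot_disc S" "continuous_on T f" "inj_on f T" "f ` T \<subseteq> S"
  shows "tot_disc T"
  unfolding tot_disc_def
proof (intro allI impI)
  fix C assume C: "connected C \<and> C \<subseteq> T"
  then have "connected (f ` C)" using assms(2) by (meson connected_continuous_image continuous_on_subset)
  then obtain a where a: "f ` C \<subseteq> {a}" using assms(1,4) C unfolding tot_disc_def by (meson image_mono subset_trans)
  show "\<exists>a. C \<subseteq> {a}"
  proof (cases "C = {}")
    case False
    then obtain x where x: "x \<in> C" by blast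
    have "y = x" if "y \<in> C" for y
      using a x that C assms(3) by (metis (no_types, lifting) image_subset_iff inj_onD singletonD subsetD)
    then show ?thesis by blast
  qed simp
qed

lemma thin_image:
  fixes h :: "'a::metric_space \<Rightarrow> 'b::metric_space"
  assumes A: "thin A" and h: "continuous_on A h" "inj_on h A"
  shows "thin (h ` A)"
proof -
  obtain D where cA: "compact A" and D: "countable D" "tot_disc (A - D)"
    using A unfolding thin_def by blast
  obtain g where g: "homeomorphism A (h ` A) h g"
    using homeomorphism_compact[OF cA h(1) _ h(2)] by blast
  have "continuous_on (h ` A) g" "inj_on g (h ` A)" 
    using g by (auto simp: homeomorphism_def inj_on_def)
  moreover have "g ` (h ` A - h ` D) \<subseteq> A - D"
    using g unfolding homeomorphism_def by auto
  ultimately have "tot_disc (h ` A - h ` D)"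
    by (intro tot_disc_inj_vimage[OF D(2)]) (auto intro: continuous_on_subset inj_on_subset)
  then show ?thesis
    unfolding thin_def using cA h(1) D(1) by (blast intro: compact_continuous_image countable_image)
qed

text \<open>The rationals are removed: two points of a connected set would enclose one.\<close>

lemma thin_interval: "thin {0..1::real}"
proof -
  have "\<exists>a. C \<subseteq> {a}" if C: "connected C" "C \<subseteq> {0..1} - \<rat>" for C :: "real set"
  proof (cases "C = {}")
    case False
    then obtain x where x: "x \<in> C" by blast
    have "y = x" if y: "y \<in> C" for y
    proof (rule ccontr)
      assume "y \<noteq> x"
      then have "min x y < max x y" by auto
      then obtain q where q: "q \<in> \<rat>" "min x y < q" "q < max x y" using Rats_dense_in_real by blast
      have "{min x y..max x y} \<subseteq> C" using connected_contains_Icc[OF C(1)] x y by (simp add: min_def max_def)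
      with q C(2) show False by (meson DiffD2 atLeastAtMost_iff less_imp_le subsetD)
    qed
    then show ?thesis by blast
  qed simp
  then show ?thesis unfolding thin_def tot_disc_def using countable_rat by blast
qed

text \<open>Points with rational first coordinate are removed, at most two for each rational. On a
  connected set of remaining points the first coordinate is constant; that leaves at most two
  points, hence at most one.\<close>

lemma thin_circle: "thin (sphere (0::real^2) 1)"
proof -
  let ?S = "sphere (0::real^2) 1"
  have eq: "?S = {x. (x$1)\<^sup>2 + (x$2)\<^sup>2 = 1}"
    by (auto simp: norm_vec_def L2_set_def sum_2)
  define D where "D = {x \<in> ?S. x$1 \<in> \<rat>}"
  have "D \<subseteq> (\<lambda>(q, s). \<chi> i. if i = 1 then q else s * sqrt (1 - q\<^sup>2)) ` (\<rat> \<times> {-1, 1})"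
  proof
    fix x assume x: "x \<in> D"
    then have e: "(x$1)\<^sup>2 + (x$2)\<^sup>2 = 1" "x$1 \<in> \<rat>" by (auto simp: D_def eq)
    then have "sqrt (1 - (x$1)\<^sup>2) = \<bar>x$2\<bar>" by (metis add_diff_cancel_left' real_sqrt_abs)
    then have "x = (\<chi> i. if i = 1 then x$1 else (if x$2 < 0 then -1 else 1) * sqrt (1 - (x$1)\<^sup>2))"
      by (simp add: vec_eq_iff forall_2)
    then have "x = (\<lambda>(q, s). \<chi> i. if i = 1 then q else s * sqrt (1 - q\<^sup>2)) (x$1, if x$2 < 0 then -1 else 1)"
      by simp
    then show "x \<in> (\<lambda>(q, s). \<chi> i. if i = 1 then q else s * sqrt (1 - q\<^sup>2)) ` (\<rat> \<times> {-1, 1})"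
      by (rule image_eqI) (use e(2) in auto)
  qed
  moreover have "countable ((\<rat>::real set) \<times> {-1, 1::real})" using countable_rat by (intro countable_SIGMA) auto
  ultimately have "countable D" by (meson countable_image countable_subset)
  moreover have "tot_disc (?S - D)"
    unfolding tot_disc_def
  proof (intro allI impI)
    fix C assume C: "connected C \<and> C \<subseteq> ?S - D"
    have c1: "connected ((\<lambda>x. x$1) ` C)"
      using C by (intro connected_continuous_image) (auto intro!: continuous_intros)
    have x1: "x$1 = y$1" if "x \<in> C" "y \<in> C" for x y
    proof (rule ccontr)
      assume "x$1 \<noteq> y$1"
      then have "min (x$1) (y$1) < max (x$1) (y$1)" by auto
      then obtain q where q: "q \<in> \<rat>" "min (x$1) (y$1) < q" "q < max (x$1) (y$1)" using Rats_dense_in_real by blast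
      have "{min (x$1) (y$1)..max (x$1) (y$1)} \<subseteq> (\<lambda>x. x$1) ` C"
        using connected_contains_Icc[OF c1] that by (simp add: min_def max_def)
      with q have "q \<in> (\<lambda>x. x$1) ` C" by (meson atLeastAtMost_iff less_imp_le subsetD)
      with q(1) C show False unfolding D_def by auto
    qed
    have x2: "(x$2)\<^sup>2 = 1 - (x$1)\<^sup>2" if "x \<in> C" for x using that C unfolding eq by (auto simp: algebra_simps)
    have xy: "x$1 = y$1 \<and> (x$2 = y$2 \<or> x$2 = - (y$2))" if "x \<in> C" "y \<in> C" for x y
      using x1[OF that] x2[OF that(1)] x2[OF that(2)] by (simp flip: power2_eq_iff)
    show "\<exists>a. C \<subseteq> {a}"
    proof (cases "C = {}")
      case False
      then obtain x where x: "x \<in> C" by blast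
      have "C \<subseteq> {x, \<chi> i. if i = 1 then x$1 else - (x$2)}"
      proof
        fix y assume "y \<in> C"
        from xy[OF this x] show "y \<in> {x, \<chi> i. if i = 1 then x$1 else - (x$2)}"
          by (auto simp: vec_eq_iff forall_2)
      qed
      then have "finite C" by (rule finite_subset) simp
      then show ?thesis using connected_finite_iff_sing[of C] C by auto
    qed simp
  qed
  ultimately show ?thesis unfolding thin_def by (metis compact_sphere)
qed

lemma thin_homeomorphic:
  assumes "thin S" "K homeomorphic S" shows "thin K"
proof -
  obtain f g where "homeomorphism S K f g" using assms(2) homeomorphic_sym unfolding homeomorphic_def by blast
  then have "continuous_on S f" "inj_on f S" "f ` S = K"
    by (auto simp: homeomorphism_def intro: inj_on_inverseI) 
  then show ?thesis using thin_image[OF assms(1), of f] by simp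
qed

text \<open>A plane avoids the exceptional countable set unless its level is attained on that
  set.\<close>

lemma thin_slices:
  fixes A :: "'a::real_inner set"
  assumes "thin A"
  obtains Z where "countable Z" "\<And>c. c \<notin> Z \<Longrightarrow> tot_disc (A \<inter> {x. x \<bullet> e = c})"
proof -
  obtain D where D: "countable D" "tot_disc (A - D)" using assms unfolding thin_def by blast
  show ?thesis
  proof (rule that[of "(\<lambda>x. x \<bullet> e) ` D"])
    show "tot_disc (A \<inter> {x. x \<bullet> e = c})" if "c \<notin> (\<lambda>x. x \<bullet> e) ` D" for c
      using that by (intro tot_disc_subset[OF D(2)]) auto
  qed (use D(1) in simp)
qed

section \<open>Arcs avoiding a closed totally disconnected set\<close>

lemma connected_open_disc_diff_tot_disc:
  fixes E :: "'a::euclidean_space set"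
  assumes dim: "2 \<le> DIM('a)" and E: "closed E" "tot_disc E" and "0 < r"
  shows "connected (ball m r - E)"
proof -
  obtain f g where fg: "homeomorphism (ball m r) (UNIV::'a set) f g"
    using homeomorphic_ball_UNIV[OF \<open>0 < r\<close>] unfolding homeomorphic_def by blast
  then have f: "continuous_on (ball m r) f" and g: "continuous_on UNIV g" and im: "g ` UNIV = ball m r"
    and gf: "\<And>x. x \<in> ball m r \<Longrightarrow> g (f x) = x" and fg': "\<And>y. f (g y) = y" by (auto simp: homeomorphism_def)
  define S where "S = g -` E"
  have "closed S" unfolding S_def using continuous_closed_vimage[OF E(1), of g] g by (auto simp: continuous_on_eq_continuous_at)
  have "tot_disc S" 
  proof (rule tot_disc_inj_vimage[OF E(2)])
    show "inj_on g S" using fg' by (metis inj_onI)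
  qed (auto simp: S_def intro: continuous_on_subset[OF g])
  \<comment> \<open>The ball has been replaced by the whole space in order to apply the separation
    theorem: if a closed set separates the space, one of its components does. Here the components
    are points, which do not separate in dimension at least 2.\<close>
  have "connected (- S)"
  proof (rule ccontr)
    assume "\<not> connected (- S)"
    then obtain C where C: "C \<in> components S" "\<not> connected (- C)"
      using separation_by_component_closed \<open>closed S\<close> by blast
    obtain a where "C \<subseteq> {a}" using \<open>tot_disc S\<close> C(1) unfolding tot_disc_def
      by (meson in_components_connected in_components_subset)
    moreover have "C \<noteq> {}" using C(1) in_components_nonempty by blast
    ultimately have "C = {a}" by blast
    then show False using C(2) connected_punctured_universe[OF dim, of a] by (simp add: Compl_eq_Diff_UNIV)
  qed
  then have "connected (g ` (- S))" using g by (meson connected_continuous_image continuous_on_subset subset_UNIV)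
  moreover have "g ` (- S) = ball m r - E"
  proof
    show "ball m r - E \<subseteq> g ` (- S)"
    proof
      fix x assume x: "x \<in> ball m r - E"
      then have "g (f x) = x" using gf by simp
      with x show "x \<in> g ` (- S)" unfolding S_def by (metis Compl_iff DiffD2 imageI vimageE)
    qed
  qed (use im in \<open>auto simp: S_def\<close>)
  ultimately show ?thesis by simp
qed

text \<open>The points \<open>p\<close> and \<open>q\<close> are antipodal on the bounding sphere.
  Inside, removing \<open>E\<close> leaves an open connected set, and its points are joined to
  \<open>p\<close> and \<open>q\<close> along radii, whose outer ends avoid the closed set
  \<open>E\<close>. Finally a path between distinct points contains an arc.\<close>

lemma arc_in_disc:
  fixes E :: "'a::euclidean_space set"
  assumes dim: "2 \<le> DIM('a)" and E: "closed E" "tot_disc E" and pq: "p \<noteq> q" "p \<notin> E" "q \<notin> E"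
  obtains \<gamma> where "arc \<gamma>" "pathstart \<gamma> = p" "pathfinish \<gamma> = q"
    "path_image \<gamma> \<subseteq> insert p (insert q (ball (midpoint p q) (dist p q / 2) - E))"
proof -
  let ?m = "midpoint p q" and ?r = "dist p q / 2"
  define W where "W = ball ?m ?r - E"
  have r: "0 < ?r" using pq by simp
  have "open W" unfolding W_def using E(1) by auto
  have "path_connected W" unfolding W_def
    using connected_open_disc_diff_tot_disc[OF dim E r] \<open>open W\<close> W_def connected_open_path_connected by metis
  have acc: "\<exists>w\<in>W. path_component (insert x W) x w"
    if x: "x \<notin> E" "dist ?m x = ?r" for x
  proof -
    obtain s where s: "s > 0" "ball x s \<subseteq> - E" using E(1) x(1) by (metis Compl_iff open_Compl openE)
    \<comment> \<open>The step goes at most to the centre and is shorter than \<open>s\<close>, so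
      it stays in the ball around \<open>x\<close> that is free of \<open>E\<close>.\<close>
    define t where "t = min 1 (s / 2 / ?r)"
    have t: "0 < t" "t \<le> 1" "t * ?r < s"
    proof -
      show "0 < t" "t \<le> 1" using s r by (auto simp: t_def)
      have "t * ?r \<le> (s / 2 / ?r) * ?r" using r by (intro mult_right_mono) (auto simp: t_def)
      then show "t * ?r < s" using s r by simp
    qed
    define w where "w = x + t *\<^sub>R (?m - x)"
    have seg: "x + c *\<^sub>R (?m - x) \<in> W" if c: "0 < c" "c \<le> t" for c
    proof -
      have "?m - (x + c *\<^sub>R (?m - x)) = (1 - c) *\<^sub>R (?m - x)" by (simp add: algebra_simps)
      then have "dist ?m (x + c *\<^sub>R (?m - x)) = (1 - c) * ?r"
        using c t x(2) by (simp add: dist_norm)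
      also have "\<dots> < ?r" using c r by simp
      finally have 1: "x + c *\<^sub>R (?m - x) \<in> ball ?m ?r" by simp
      have "dist x (x + c *\<^sub>R (?m - x)) = c * ?r" using c x(2) by (simp add: dist_norm)
      also have "\<dots> \<le> t * ?r" using c r by (intro mult_right_mono) auto
      also have "\<dots> < s" by (rule t)
      finally have "x + c *\<^sub>R (?m - x) \<in> ball x s" by simp
      with s(2) 1 show ?thesis unfolding W_def by blast
    qed
    have "path_image (linepath x w) \<subseteq> insert x W"
    proof
      fix y assume "y \<in> path_image (linepath x w)"
      then obtain u where u: "0 \<le> u" "u \<le> 1" "y = (1 - u) *\<^sub>R x + u *\<^sub>R w"
        by (auto simp: path_image_linepath closed_segment_def)
      have y: "y = x + (u * t) *\<^sub>R (?m - x)" unfolding u(3) w_def by (simp add: algebra_simps)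
      show "y \<in> insert x W"
      proof (cases "u = 0")
        case False
        then have "0 < u * t" "u * t \<le> t" using u t by (auto simp: mult_left_le_one_le)
        from seg[OF this] y show ?thesis by simp
      qed (use y in simp)
    qed
    then have "path_component (insert x W) x w"
      unfolding path_component_def by (intro exI[of _ "linepath x w"]) auto
    moreover have "w \<in> W" unfolding w_def using seg[of t] t by simp
    ultimately show ?thesis by blast
  qed
  obtain wp where wp: "wp \<in> W" "path_component (insert p W) p wp"
    using acc[of p] pq by (auto simp: dist_midpoint)
  obtain wq where wq: "wq \<in> W" "path_component (insert q W) q wq"
    using acc[of q] pq by (auto simp: dist_midpoint)
  let ?V = "insert p (insert q W)"
  have "path_component ?V p wp" "path_component ?V q wq"
    using wp(2) wq(2) by (auto intro: path_component_of_subset)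
  moreover have "path_component ?V wp wq"
    using \<open>path_connected W\<close> wp(1) wq(1) path_component_of_subset[of W ?V]
    unfolding path_connected_component by blast
  ultimately have "path_component ?V p q"
    by (meson path_component_sym path_component_trans)
  then obtain g where g: "path g" "path_image g \<subseteq> ?V" "pathstart g = p" "pathfinish g = q"
    unfolding path_component_def by blast
  obtain h where "arc h" "path_image h \<subseteq> path_image g" "pathstart h = p" "pathfinish h = q"
    using path_contains_arc[OF g(1,3,4) pq(1)] by blast
  then show ?thesis using that g(2) unfolding W_def by blast
qed

text \<open>An open segment is connected and has more than one point.\<close>

lemma line_meets_complement_tot_disc:
  fixes E :: "'a::real_normed_vector set"
  assumes E: "tot_disc E" and v: "v \<noteq> 0" and uw: "u < w"
  obtains t where "u < t" "t < w" "a + t *\<^sub>R v \<notin> E"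
proof -
  let ?l = "\<lambda>t. a + t *\<^sub>R v"
  have "\<not> ?l ` {u<..<w} \<subseteq> E"
  proof
    assume "?l ` {u<..<w} \<subseteq> E"
    moreover have "connected (?l ` {u<..<w})"
      by (intro connected_continuous_image continuous_intros) auto
    ultimately obtain z where z: "?l ` {u<..<w} \<subseteq> {z}" using E unfolding tot_disc_def by blast
    define s where "s = (2 * u + w) / 3"
    define t where "t = (u + 2 * w) / 3"
    have st: "s \<in> {u<..<w}" "t \<in> {u<..<w}" "s \<noteq> t" using uw by (auto simp: s_def t_def)
    then have "?l s = ?l t" using z by (metis (no_types, lifting) image_subset_iff singletonD)
    then show False using st(3) v by simp
  qed
  then show ?thesis using that unfolding image_subset_iff by force
qed

lemma closed_segment_line:
  fixes a v :: "'a::real_vector"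
  assumes "\<alpha> \<le> \<beta>"
  shows "closed_segment (a + \<alpha> *\<^sub>R v) (a + \<beta> *\<^sub>R v) = (\<lambda>t. a + t *\<^sub>R v) ` {\<alpha>..\<beta>}"
proof
  show "closed_segment (a + \<alpha> *\<^sub>R v) (a + \<beta> *\<^sub>R v) \<subseteq> (\<lambda>t. a + t *\<^sub>R v) ` {\<alpha>..\<beta>}"
  proof
    fix x assume "x \<in> closed_segment (a + \<alpha> *\<^sub>R v) (a + \<beta> *\<^sub>R v)"
    then obtain u where u: "0 \<le> u" "u \<le> 1" "x = (1 - u) *\<^sub>R (a + \<alpha> *\<^sub>R v) + u *\<^sub>R (a + \<beta> *\<^sub>R v)"
      by (auto simp: closed_segment_def)
    have "x = a + (\<alpha> + u * (\<beta> - \<alpha>)) *\<^sub>R v" unfolding u(3) by (simp add: algebra_simps)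
    moreover have "u * (\<beta> - \<alpha>) \<le> \<beta> - \<alpha>" "0 \<le> u * (\<beta> - \<alpha>)"
      using u assms by (auto simp: mult_left_le_one_le)
    ultimately show "x \<in> (\<lambda>t. a + t *\<^sub>R v) ` {\<alpha>..\<beta>}" by auto
  qed
  show "(\<lambda>t. a + t *\<^sub>R v) ` {\<alpha>..\<beta>} \<subseteq> closed_segment (a + \<alpha> *\<^sub>R v) (a + \<beta> *\<^sub>R v)"
  proof (rule image_subsetI)
    fix t assume t: "t \<in> {\<alpha>..\<beta>}"
    show "a + t *\<^sub>R v \<in> closed_segment (a + \<alpha> *\<^sub>R v) (a + \<beta> *\<^sub>R v)"
    proof (cases "\<alpha> = \<beta>")
      case False
      define u where "u = (t - \<alpha>) / (\<beta> - \<alpha>)"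
      have u: "0 \<le> u" "u \<le> 1" "t = \<alpha> + u * (\<beta> - \<alpha>)" using t False by (auto simp: u_def field_simps)
      have "a + t *\<^sub>R v = (1 - u) *\<^sub>R (a + \<alpha> *\<^sub>R v) + u *\<^sub>R (a + \<beta> *\<^sub>R v)"
        unfolding u(3) by (simp add: algebra_simps)
      with u show ?thesis unfolding closed_segment_def by blast
    qed (use t in auto)
  qed
qed

text \<open>
  The arc is a chain of arcs inside open discs with collinear diameters; these discs are disjoint,
  so consecutive pieces meet only in their common end point.
\<close>

lemma arc_along_segment:
  fixes E :: "'a::euclidean_space set" and a v :: 'a
  assumes dim: "2 \<le> DIM('a)" and E: "closed E" "tot_disc E" and v: "norm v = 1" and r: "0 < r"
  defines "l \<equiv> \<lambda>t. a + t *\<^sub>R v"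
  assumes "\<alpha> < \<beta>" "l \<alpha> \<notin> E" "l \<beta> \<notin> E"
  shows "\<exists>\<gamma> \<sigma>. arc \<gamma> \<and> arc \<sigma> \<and> pathstart \<gamma> = l \<alpha> \<and> pathfinish \<gamma> = l \<beta> \<and>
    pathstart \<sigma> = l \<alpha> \<and> pathfinish \<sigma> = l \<beta> \<and> path_image \<sigma> = closed_segment (l \<alpha>) (l \<beta>) \<and>
    path_image \<gamma> \<subseteq> insert (l \<alpha>) (insert (l \<beta>) {y. \<alpha> < (y - a) \<bullet> v \<and> (y - a) \<bullet> v < \<beta>}) - E \<and>
    (\<forall>t\<in>{0..1}. dist (\<gamma> t) (\<sigma> t) \<le> r)" (is "?P \<alpha> \<beta>")
proof -
  have vv: "v \<bullet> v = 1" using v by (simp add: norm_eq_1)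
  have lv: "(l t - a) \<bullet> v = t" for t by (simp add: l_def vv)
  have l_dist: "dist (l s) (l t) = \<bar>s - t\<bar>" for s t
    by (simp add: l_def dist_norm v flip: scaleR_left_diff_distrib)
  have l_eq: "l s = l t \<longleftrightarrow> s = t" for s t using v by (auto simp: l_def)
  have l_mid: "midpoint (l s) (l t) = l ((s + t) / 2)" for s t
  proof -
    have "((s + t) / 2) *\<^sub>R v + ((s + t) / 2) *\<^sub>R v = s *\<^sub>R v + t *\<^sub>R v"
      by (simp flip: scaleR_add_left)
    then have "l s + l t = 2 *\<^sub>R l ((s + t) / 2)"
      by (simp add: l_def scaleR_2)
    then show ?thesis by (simp add: midpoint_def)
  qed
  have l_seg: "l t \<in> closed_segment (l s) (l u)" if "s \<le> t" "t \<le> u" for s t u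
    using that closed_segment_line[of s u a v] by (auto simp: l_def)
  \<comment> \<open>A piece shorter than \<open>r\<close>: both curves lie in the closed disc having
    the segment as diameter, so they are \<open>r\<close>-close in any parametrisation.\<close>
  have base: "?P \<alpha> \<beta>" if ab: "\<alpha> < \<beta>" "\<beta> - \<alpha> < r" "l \<alpha> \<notin> E" "l \<beta> \<notin> E" for \<alpha> \<beta>
  proof -
    let ?B = "ball (midpoint (l \<alpha>) (l \<beta>)) (dist (l \<alpha>) (l \<beta>) / 2)"
    have "l \<alpha> \<noteq> l \<beta>" using ab by (simp add: l_eq)
    then obtain \<gamma> where \<gamma>: "arc \<gamma>" "pathstart \<gamma> = l \<alpha>" "pathfinish \<gamma> = l \<beta>"
      "path_image \<gamma> \<subseteq> insert (l \<alpha>) (insert (l \<beta>) (?B - E))"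
      using arc_in_disc[OF dim E _ ab(3,4)] by metis
    let ?C = "cball (midpoint (l \<alpha>) (l \<beta>)) (dist (l \<alpha>) (l \<beta>) / 2)"
    have "l \<alpha> \<in> ?C" "l \<beta> \<in> ?C" by (auto simp: dist_midpoint)
    then have C: "path_image \<gamma> \<subseteq> ?C" "path_image (linepath (l \<alpha>) (l \<beta>)) \<subseteq> ?C"
      using \<gamma>(4) by (auto simp: closed_segment_subset)
    have "dist (\<gamma> t) (linepath (l \<alpha>) (l \<beta>) t) \<le> r" if t: "t \<in> {0..1}" for t
    proof -
      have "\<gamma> t \<in> ?C" "linepath (l \<alpha>) (l \<beta>) t \<in> ?C"
        using C t unfolding path_image_def by blast+
      then have "dist (\<gamma> t) (linepath (l \<alpha>) (l \<beta>) t) \<le> dist (l \<alpha>) (l \<beta>)"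
        using dist_triangle[of "\<gamma> t" "linepath (l \<alpha>) (l \<beta>) t" "midpoint (l \<alpha>) (l \<beta>)"]
        by (simp add: dist_commute)
      also have "\<dots> \<le> r" using \<open>\<beta> - \<alpha> < r\<close> \<open>\<alpha> < \<beta>\<close> by (simp add: l_dist)
      finally show ?thesis .
    qed
    moreover have "?B \<subseteq> {y. \<alpha> < (y - a) \<bullet> v \<and> (y - a) \<bullet> v < \<beta>}"
    proof
      fix y assume "y \<in> ?B"
      then have d: "dist (l ((\<alpha> + \<beta>) / 2)) y < (\<beta> - \<alpha>) / 2" using \<open>\<alpha> < \<beta>\<close> by (simp add: l_mid l_dist)
      have "\<bar>(y - l ((\<alpha> + \<beta>) / 2)) \<bullet> v\<bar> \<le> dist (l ((\<alpha> + \<beta>) / 2)) y"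
        using Cauchy_Schwarz_ineq2[of "y - l ((\<alpha> + \<beta>) / 2)" v] by (simp add: v dist_norm norm_minus_commute)
      moreover have "(y - l ((\<alpha> + \<beta>) / 2)) \<bullet> v = (y - a) \<bullet> v - (\<alpha> + \<beta>) / 2"
        using lv[of "(\<alpha> + \<beta>) / 2"] unfolding inner_diff_left by linarith
      ultimately have "\<bar>(y - a) \<bullet> v - (\<alpha> + \<beta>) / 2\<bar> < (\<beta> - \<alpha>) / 2" using d by simp
      then show "y \<in> {y. \<alpha> < (y - a) \<bullet> v \<and> (y - a) \<bullet> v < \<beta>}" by (auto simp: abs_if field_simps split: if_splits)
    qed
    ultimately show ?thesis
      using \<gamma> \<open>l \<alpha> \<noteq> l \<beta>\<close> ab(3,4)
      by (intro exI[of _ \<gamma>] exI[of _ "linepath (l \<alpha>) (l \<beta>)"]) auto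
  qed
  \<comment> \<open>In place of the chain of discs the induction only records that
    \<open>\<gamma>\<close> stays in the open slab between its end points; slabs over adjacent
    intervals are disjoint.\<close>
  have "?P \<alpha> \<beta>" if "\<alpha> < \<beta>" "\<beta> - \<alpha> < real (Suc n) * r" "l \<alpha> \<notin> E" "l \<beta> \<notin> E" for n \<alpha> \<beta>
    using that
  proof (induction n arbitrary: \<beta>)
    case 0
    then show ?case using base by simp
  next
    case (Suc n)
    \<comment> \<open>The cut must leave a last piece shorter than \<open>r\<close> and a first
      piece covered by the induction hypothesis. Together with \<alpha> < \<beta>' < \<beta> this
      describes a nonempty open interval, in which a cut point outside \<open>E\<close>
      exists.\<close>
    define u where "u = max (\<beta> - r) \<alpha>"
    define w where "w = min (\<alpha> + real (Suc n) * r) \<beta>"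
    have "0 < real (Suc n) * r" using r by simp
    then have "u < w" using Suc.prems(1,2) r by (auto simp: u_def w_def algebra_simps)
    moreover have "v \<noteq> 0" using v by auto
    ultimately obtain \<beta>' where \<beta>': "u < \<beta>'" "\<beta>' < w" "l \<beta>' \<notin> E"
      using line_meets_complement_tot_disc[OF E(2)] unfolding l_def by metis
    then have b: "\<alpha> < \<beta>'" "\<beta>' < \<beta>" "\<beta> - \<beta>' < r" "\<beta>' - \<alpha> < real (Suc n) * r"
      by (simp_all add: u_def w_def)
    obtain \<gamma>1 \<sigma>1 where 1: "arc \<gamma>1" "arc \<sigma>1" "pathstart \<gamma>1 = l \<alpha>" "pathfinish \<gamma>1 = l \<beta>'"
      "pathstart \<sigma>1 = l \<alpha>" "pathfinish \<sigma>1 = l \<beta>'" "path_image \<sigma>1 = closed_segment (l \<alpha>) (l \<beta>')"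
      "path_image \<gamma>1 \<subseteq> insert (l \<alpha>) (insert (l \<beta>') {y. \<alpha> < (y - a) \<bullet> v \<and> (y - a) \<bullet> v < \<beta>'}) - E"
      "\<And>t. t\<in>{0..1} \<Longrightarrow> dist (\<gamma>1 t) (\<sigma>1 t) \<le> r"
      using Suc.IH[OF b(1,4) Suc.prems(3) \<beta>'(3)] by blast
    obtain \<gamma>2 \<sigma>2 where 2: "arc \<gamma>2" "arc \<sigma>2" "pathstart \<gamma>2 = l \<beta>'" "pathfinish \<gamma>2 = l \<beta>"
      "pathstart \<sigma>2 = l \<beta>'" "pathfinish \<sigma>2 = l \<beta>" "path_image \<sigma>2 = closed_segment (l \<beta>') (l \<beta>)"
      "path_image \<gamma>2 \<subseteq> insert (l \<beta>') (insert (l \<beta>) {y. \<beta>' < (y - a) \<bullet> v \<and> (y - a) \<bullet> v < \<beta>}) - E"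
      "\<And>t. t\<in>{0..1} \<Longrightarrow> dist (\<gamma>2 t) (\<sigma>2 t) \<le> r"
      using base[OF b(2,3) \<beta>'(3) Suc.prems(4)] by blast
    have mem: "l \<beta>' \<in> closed_segment (l \<alpha>) (l \<beta>)" using b by (intro l_seg) auto
    have y1: "y = l \<beta>' \<or> (y - a) \<bullet> v < \<beta>'" if "y \<in> path_image \<gamma>1" for y
      using that 1(8) lv[of \<alpha>] b(1) by auto
    have y2: "y = l \<beta>' \<or> \<beta>' < (y - a) \<bullet> v" if "y \<in> path_image \<gamma>2" for y
      using that 2(8) lv[of \<beta>] b(2) by auto
    have y1': "y = l \<alpha> \<or> \<alpha> < (y - a) \<bullet> v \<and> (y - a) \<bullet> v < \<beta>" "y \<notin> E" if "y \<in> path_image \<gamma>1" for y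
      using that 1(8) lv[of \<beta>'] b(1,2) by auto
    have y2': "y = l \<beta> \<or> \<alpha> < (y - a) \<bullet> v \<and> (y - a) \<bullet> v < \<beta>" "y \<notin> E" if "y \<in> path_image \<gamma>2" for y
      using that 2(8) lv[of \<beta>'] b(1,2) by auto
    show ?case
    proof (intro exI conjI)
      show "arc (\<gamma>1 +++ \<gamma>2)"
      proof (rule arc_join[OF 1(1) 2(1)])
        show "path_image \<gamma>1 \<inter> path_image \<gamma>2 \<subseteq> {pathstart \<gamma>2}"
          using y1 y2 2(3) by fastforce
      qed (simp add: 1 2)
      show "arc (\<sigma>1 +++ \<sigma>2)"
        by (rule arc_join[OF 1(2) 2(2)]) (simp_all add: 1 2 Int_closed_segment mem)
      show "path_image (\<sigma>1 +++ \<sigma>2) = closed_segment (l \<alpha>) (l \<beta>)"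
        using 1 2 Un_closed_segment[OF mem] by (simp add: path_image_join)
      show "path_image (\<gamma>1 +++ \<gamma>2) \<subseteq> insert (l \<alpha>) (insert (l \<beta>) {y. \<alpha> < (y - a) \<bullet> v \<and> (y - a) \<bullet> v < \<beta>}) - E"
        using y1' y2' 1(4) 2(3) by (auto simp: path_image_join)
      \<comment> \<open>Both joins switch pieces at parameter 1/2, so closeness at equal parameters
        is inherited.\<close>
      show "\<forall>t\<in>{0..1}. dist ((\<gamma>1 +++ \<gamma>2) t) ((\<sigma>1 +++ \<sigma>2) t) \<le> r"
        using 1(9) 2(9) by (simp add: joinpaths_def)
    qed (simp_all add: 1 2)
  qed
  moreover obtain n where "\<beta> - \<alpha> < real (Suc n) * r"
  proof -
    obtain n where "(\<beta> - \<alpha>) / r < real n" using reals_Archimedean2 by blast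
    then have "\<beta> - \<alpha> < real n * r" using r by (simp add: divide_less_eq)
    also have "\<dots> \<le> real (Suc n) * r" using r by (intro mult_right_mono) auto
    finally show ?thesis by (rule that)
  qed
  ultimately show ?thesis using assms by blast
qed

section \<open>Unknotting planar arcs in space\<close>

text \<open>The inverse of an arc is continuous on the compact image and extends to the whole space
  by Tietze, with values in the unit interval.\<close>

lemma arc_parameter:
  fixes \<gamma> :: "real \<Rightarrow> 'a::euclidean_space"
  assumes "arc \<gamma>"
  obtains z :: "'a \<Rightarrow> real" where "continuous_on UNIV z" "\<And>x. 0 \<le> z x \<and> z x \<le> 1" "\<And>t. t \<in> {0..1} \<Longrightarrow> z (\<gamma> t) = t"
proof -
  have "continuous_on {0..1} \<gamma>" "inj_on \<gamma> {0..1}" using assms by (auto simp: arc_def path_def)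
  then obtain k where k: "homeomorphism {0..1} (path_image \<gamma>) \<gamma> k"
    using homeomorphism_compact[of "{0..1}" \<gamma>] by (auto simp: path_image_def)
  have "closedin (top_of_set UNIV) (path_image \<gamma>)"
    using closed_arc_image[OF assms] by simp
  moreover have "k x \<in> cbox 0 1" if "x \<in> path_image \<gamma>" for x
    using k that by (auto simp: homeomorphism_def)
  ultimately obtain z where z: "continuous_on UNIV z" "\<And>x. x \<in> path_image \<gamma> \<Longrightarrow> z x = k x" "\<And>x. z x \<in> cbox 0 1"
    using Tietze_closed_interval_1[of "path_image \<gamma>" k UNIV 0 1] k by (auto simp: homeomorphism_def)
  show ?thesis
  proof (rule that[OF z(1)])
    show "0 \<le> z x \<and> z x \<le> 1" for x using z(3)[of x] by simp
    show "z (\<gamma> t) = t" if "t \<in> {0..1}" for t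
      using z(2)[of "\<gamma> t"] k that by (auto simp: homeomorphism_def path_image_def)
  qed
qed

lemma infdist_add_le:
  fixes x :: "'a::real_normed_vector"
  assumes "infdist x S \<le> a" "\<bar>c\<bar> \<le> b" "norm e = 1"
  shows "infdist (x + c *\<^sub>R e) S \<le> a + b"
  using infdist_triangle[of "x + c *\<^sub>R e" S x] assms by (simp add: dist_norm)

text \<open>
  Klee's trick: lift the arc \<open>\<gamma>\<close> out of its plane so that the height becomes a parameter on it, translate
  each horizontal slice by the displacement from \<open>\<gamma>\<close> to \<open>\<sigma>\<close> at that height (one shear per coordinate),
  and lower the lifted copy of \<open>\<sigma>\<close> again.
\<close>

lemma push_arc_to_arc:
  fixes e f g :: "'a::euclidean_space"
  assumes nrm: "norm e = 1" "norm f = 1" "norm g = 1"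
    and orth: "e \<bullet> f = 0" "e \<bullet> g = 0" "f \<bullet> g = 0"
    and basis: "\<And>x. x = (x \<bullet> e) *\<^sub>R e + (x \<bullet> f) *\<^sub>R f + (x \<bullet> g) *\<^sub>R g"
    and arcs: "arc \<gamma>" "arc \<sigma>" and ends: "\<gamma> 0 = \<sigma> 0" "\<gamma> 1 = \<sigma> 1"
    and plane: "\<And>t. t \<in> {0..1} \<Longrightarrow> \<gamma> t \<bullet> e = c" "\<And>t. t \<in> {0..1} \<Longrightarrow> \<sigma> t \<bullet> e = c"
    and r: "0 < r" and close: "\<And>t. t \<in> {0..1} \<Longrightarrow> dist (\<gamma> t) (\<sigma> t) \<le> r"
    and U: "\<And>x. infdist x (path_image \<sigma>) \<le> 8 * r \<Longrightarrow> x \<in> U"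
  obtains h where "push U (4 * r) h" "\<And>t. t \<in> {0..1} \<Longrightarrow> h (\<gamma> t) = \<sigma> t"
proof -
  define \<Lambda> where "\<Lambda> = path_image \<sigma>"
  \<comment> \<open>The arc being moved stays within 4 * r of \<Lambda>, where
    \<open>\<kappa>\<close> is 1; \<open>\<kappa>\<close> vanishes beyond 8 * r, in particular off
    \<open>U\<close>. Shifts by at most \<open>r\<close> then have a slope below 1/2.\<close>
  define \<kappa> where "\<kappa> = cutoff (4 * r) \<Lambda>"
  \<comment> \<open>Through this projection to the plane the undamped lift becomes constant along
    \<open>e\<close>, as a shear in that direction requires.\<close>
  define pr where "pr x = x - (x \<bullet> e - c) *\<^sub>R e" for x
  \<comment> \<open>Recovers the parameter from the height, taking r * t to t; the clamping makes it
    defined and continuous at all heights.\<close>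
  define cl where "cl s = max 0 (min 1 (s / r))" for s :: real
  have ee: "e \<bullet> e = 1" "f \<bullet> f = 1" "g \<bullet> g = 1" using nrm by (simp_all add: norm_eq_1)
  have orth': "f \<bullet> e = 0" "g \<bullet> e = 0" "g \<bullet> f = 0" using orth by (simp_all add: inner_commute)
  have pr_e: "pr (x + s *\<^sub>R e) = pr x" for x s
    by (simp add: pr_def inner_add_left ee algebra_simps)
  have cont_pr: "continuous_on UNIV pr" unfolding pr_def by (intro continuous_intros)
  have cont_\<kappa>: "continuous_on UNIV \<kappa>" unfolding \<kappa>_def by (rule continuous_on_cutoff)
  have \<kappa>_lip: "\<bar>\<kappa> x * k - \<kappa> y * k\<bar> \<le> dist x y / 2" if "\<bar>k\<bar> \<le> r" for x y k
    unfolding \<kappa>_def using r that by (intro cutoff_mult_lipschitz) auto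
  have \<kappa>_le: "\<bar>\<kappa> x * k\<bar> \<le> r" if "\<bar>k\<bar> \<le> r" for x k
  proof -
    have "\<bar>\<kappa> x\<bar> * \<bar>k\<bar> \<le> 1 * r" using that cutoff_bounds(3) unfolding \<kappa>_def by (intro mult_mono) auto
    then show ?thesis by (simp add: abs_mult)
  qed
  have \<kappa>_off: "\<kappa> x = 0" if "x \<notin> U" for x
    unfolding \<kappa>_def using r U that by (intro cutoff_off[where U = U]) (auto simp: \<Lambda>_def)
  have \<kappa>_1: "\<kappa> x = 1" if "infdist x \<Lambda> \<le> 4 * r" for x
    unfolding \<kappa>_def using r that by (intro cutoff_eq_1) auto
  have shear: "push U r (\<lambda>x. x + (\<kappa> x * k x) *\<^sub>R d)"
    if "norm d = 1" "continuous_on UNIV k" "\<And>x. \<bar>k x\<bar> \<le> r" "\<And>x t. k (x + t *\<^sub>R d) = k x" for d k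
  proof (rule push_shear_lipschitz[OF that(1)])
    show "continuous_on UNIV (\<lambda>x. \<kappa> x * k x)" by (intro continuous_on_mult cont_\<kappa> that)
    show "\<bar>\<kappa> (x + t *\<^sub>R d) * k (x + t *\<^sub>R d) - \<kappa> x * k x\<bar> \<le> t / 2" if "t > 0" for x t
      using \<kappa>_lip[OF \<open>\<And>x. \<bar>k x\<bar> \<le> r\<close>, of "x + t *\<^sub>R d" x x] that \<open>norm d = 1\<close>
      by (simp add: \<open>\<And>x t. k (x + t *\<^sub>R d) = k x\<close> dist_norm)
  qed (use \<kappa>_le that \<kappa>_off in auto)
  obtain z where z: "continuous_on UNIV z" "\<And>x. 0 \<le> z x \<and> z x \<le> 1" "\<And>t. t \<in> {0..1} \<Longrightarrow> z (\<gamma> t) = t"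
    using arc_parameter[OF arcs(1)] by blast
  obtain z' where z': "continuous_on UNIV z'" "\<And>x. 0 \<le> z' x \<and> z' x \<le> 1" "\<And>t. t \<in> {0..1} \<Longrightarrow> z' (\<sigma> t) = t"
    using arc_parameter[OF arcs(2)] by blast
  define h1 where "h1 x = x + (\<kappa> x * (r * z (pr x))) *\<^sub>R e" for x
  define k where "k d s = (\<sigma> (cl s) - \<gamma> (cl s)) \<bullet> d" for d s
  define h2 where "h2 x = x + (\<kappa> x * k f (x \<bullet> e - c)) *\<^sub>R f" for x
  define h3 where "h3 x = x + (\<kappa> x * k g (x \<bullet> e - c)) *\<^sub>R g" for x
  define h4 where "h4 x = x + (\<kappa> x * (- r * z' (pr x))) *\<^sub>R e" for x
  have cl: "cl s \<in> {0..1}" for s by (auto simp: cl_def)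
  have k_le: "\<bar>k d s\<bar> \<le> r" if "norm d = 1" for d s
    using Cauchy_Schwarz_ineq2[of "\<sigma> (cl s) - \<gamma> (cl s)" d] close[OF cl, of s] that
    by (simp add: k_def dist_norm norm_minus_commute)
  have cont_k: "continuous_on UNIV (\<lambda>x. k d (x \<bullet> e - c))" for d
  proof -
    have cc: "continuous_on UNIV (\<lambda>x::'a. cl (x \<bullet> e - c))"
      unfolding cl_def divide_inverse by (intro continuous_intros)
    have c: "continuous_on {0..1} \<sigma>" "continuous_on {0..1} \<gamma>" using arcs by (auto simp: arc_def path_def)
    show ?thesis unfolding k_def
      by (intro continuous_on_inner continuous_on_diff continuous_on_const
          continuous_on_compose2[OF c(1) cc] continuous_on_compose2[OF c(2) cc]) (use cl in auto)
  qed
  have p1: "push U r h1" unfolding h1_def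
    by (rule shear) (use z r nrm in \<open>auto simp: pr_e abs_mult mult_left_le
      intro!: continuous_on_mult continuous_on_const continuous_on_compose2[OF z(1) cont_pr]\<close>)
  have p4: "push U r h4" unfolding h4_def
    by (rule shear) (use z' r nrm in \<open>auto simp: pr_e abs_mult mult_left_le
      intro!: continuous_on_mult continuous_on_const continuous_on_minus continuous_on_compose2[OF z'(1) cont_pr]\<close>)
  have p2: "push U r h2" unfolding h2_def
    by (rule shear) (use nrm in \<open>auto simp: cont_k k_le inner_add_left orth'\<close>)
  have p3: "push U r h3" unfolding h3_def
    by (rule shear) (use nrm in \<open>auto simp: cont_k k_le inner_add_left orth'\<close>)
  have "push U (r + r + r + r) (h4 \<circ> (h3 \<circ> (h2 \<circ> h1)))"
    by (intro push_compose p1 p2 p3 p4)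
  moreover have "h4 (h3 (h2 (h1 (\<gamma> t)))) = \<sigma> t" if t: "t \<in> {0..1}" for t
  proof -
    have \<sigma>\<Lambda>: "\<sigma> t \<in> \<Lambda>" using t by (auto simp: \<Lambda>_def path_image_def)
    \<comment> \<open>Before the four moves the distance to \<Lambda> is at most r, 2 * r, 3 * r and
      r, so \<open>\<kappa>\<close> equals 1 throughout.\<close>
    have d0: "infdist (\<gamma> t) \<Lambda> \<le> r" using close[OF t] infdist_le[OF \<sigma>\<Lambda>, of "\<gamma> t"] by linarith
    have prt: "pr (\<gamma> t) = \<gamma> t" "pr (\<sigma> t) = \<sigma> t" using plane t by (auto simp: pr_def)
    have tr: "\<bar>r * t\<bar> \<le> r" using t r by (simp add: abs_mult mult_left_le)
    define x1 where "x1 = \<gamma> t + (r * t) *\<^sub>R e"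
    have h1: "h1 (\<gamma> t) = x1"
      unfolding h1_def x1_def using d0 r t z(3)[OF t] by (simp add: \<kappa>_1 prt)
    have d1: "infdist x1 \<Lambda> \<le> r + r" unfolding x1_def by (rule infdist_add_le[OF d0 tr nrm(1)])
    define af where "af = (\<sigma> t - \<gamma> t) \<bullet> f"
    define ag where "ag = (\<sigma> t - \<gamma> t) \<bullet> g"
    have clt: "cl (r * t) = t" using r t by (simp add: cl_def)
    have x1e: "x1 \<bullet> e - c = r * t" unfolding x1_def using plane(1)[OF t] by (simp add: inner_add_left ee)
    have af: "\<bar>af\<bar> \<le> r" using k_le[OF nrm(2), of "r * t"] by (simp add: k_def clt af_def)
    have ag: "\<bar>ag\<bar> \<le> r" using k_le[OF nrm(3), of "r * t"] by (simp add: k_def clt ag_def)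
    define x2 where "x2 = x1 + af *\<^sub>R f"
    have h2: "h2 x1 = x2" unfolding h2_def x2_def x1e using d1 r by (simp add: \<kappa>_1 k_def clt af_def)
    have d2: "infdist x2 \<Lambda> \<le> r + r + r" unfolding x2_def by (rule infdist_add_le[OF d1 af nrm(2)])
    have x2e: "x2 \<bullet> e - c = r * t" unfolding x2_def using x1e by (simp add: inner_add_left orth')
    define x3 where "x3 = x2 + ag *\<^sub>R g"
    have h3: "h3 x2 = x3" unfolding h3_def x3_def x2e using d2 r by (simp add: \<kappa>_1 k_def clt ag_def)
    have "\<sigma> t - \<gamma> t = af *\<^sub>R f + ag *\<^sub>R g"
    proof -
      have "(\<sigma> t - \<gamma> t) \<bullet> e = 0" using plane[OF t] by (simp add: inner_diff_left)
      with basis[of "\<sigma> t - \<gamma> t"] show ?thesis by (simp only: af_def ag_def scaleR_zero_left add_0)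
    qed
    then have x3: "x3 = \<sigma> t + (r * t) *\<^sub>R e" unfolding x3_def x2_def x1_def by (simp add: algebra_simps)
    have "infdist x3 \<Lambda> \<le> 0 + r" unfolding x3 by (rule infdist_add_le[OF _ tr nrm(1)]) (simp add: \<sigma>\<Lambda>)
    then have "h4 x3 = \<sigma> t"
      unfolding h4_def using r z'(3)[OF t] by (simp add: \<kappa>_1 x3 pr_e prt algebra_simps)
    then show ?thesis by (simp add: h1 h2 h3)
  qed
  ultimately show ?thesis by (intro that[of "h4 \<circ> (h3 \<circ> (h2 \<circ> h1))"]) auto
qed

text \<open>After a small translation the plane through the segment orthogonal to \<open>e\<close>
  meets the set in a totally disconnected slice. In this plane an arc along a slightly longer
  segment misses the set; a push taking the arc onto that segment takes the set off it, by
  injectivity.\<close>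

lemma push_off_segment:
  fixes e f g p :: "'a::euclidean_space"
  assumes nrm: "norm e = 1" "norm f = 1" "norm g = 1"
    and orth: "e \<bullet> f = 0" "e \<bullet> g = 0" "f \<bullet> g = 0"
    and basis: "\<And>x. x = (x \<bullet> e) *\<^sub>R e + (x \<bullet> f) *\<^sub>R f + (x \<bullet> g) *\<^sub>R g"
    and A: "thin A" "A \<noteq> {}" "A \<subseteq> U" and U: "open U"
    and L: "0 \<le> L" and seg: "closed_segment p (p + L *\<^sub>R f) \<subseteq> U" and \<eta>: "0 < \<eta>"
  obtains h where "push U \<eta> h" "h ` A \<inter> closed_segment p (p + L *\<^sub>R f) = {}"
proof -
  define S where "S = closed_segment p (p + L *\<^sub>R f)"
  have S_line: "S = (\<lambda>t. p + t *\<^sub>R f) ` {0..L}" using closed_segment_line[OF L, of p f] by (simp add: S_def)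
  define c where "c = p \<bullet> e"
  have ee: "e \<bullet> e = 1" "f \<bullet> f = 1" "g \<bullet> g = 1" using nrm by (simp_all add: norm_eq_1)
  have orth': "f \<bullet> e = 0" "g \<bullet> e = 0" "g \<bullet> f = 0" using orth by (simp_all add: inner_commute)
  have cA: "compact A" using A(1) by (simp add: thin_def)
  obtain \<rho>A where \<rho>A: "\<rho>A > 0" "\<And>x. infdist x A \<le> \<rho>A \<Longrightarrow> x \<in> U"
    using compact_in_open_infdist[OF cA A(2) U A(3)] by blast
  obtain \<rho> where \<rho>: "\<rho> > 0" "\<And>x. infdist x S \<le> \<rho> \<Longrightarrow> x \<in> U"
    using compact_in_open_infdist[of S U] U seg by (auto simp: S_def)
  obtain Z where Z: "countable Z" "\<And>c. c \<notin> Z \<Longrightarrow> tot_disc (A \<inter> {x. x \<bullet> e = c})"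
    using thin_slices[OF A(1), of e] by blast
  \<comment> \<open>Half of the budget \<eta>; the other bound makes the slope admissible for the
    cutoff of radius \<rho>A / 2.\<close>
  define v0 where "v0 = min (\<eta> / 2) (\<rho>A / 4)"
  have "v0 > 0" using \<eta> \<rho>A by (simp add: v0_def)
  \<comment> \<open>Only countably many levels are bad, so some level \<open>b\<close> just below
    \<open>c\<close> is good; translating by \<open>v\<close> brings its slice to level
    \<open>c\<close>.\<close>
  have "uncountable {c - v0 <..< c}" using \<open>v0 > 0\<close> by (simp add: uncountable_open_interval)
  then obtain b where b: "b \<in> {c - v0 <..< c}" "b \<notin> Z" using Z(1) by (meson countable_subset subsetI)
  define v where "v = c - b"
  have v: "0 < v" "v < v0" "c - v \<notin> Z" using b by (auto simp: v_def)
  define h0 where "h0 x = x + (cutoff (\<rho>A / 2) A x * v) *\<^sub>R e" for x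
  have "push U v h0" unfolding h0_def
  proof (rule push_shear_lipschitz[OF nrm(1)])
    show "continuous_on UNIV (\<lambda>x. cutoff (\<rho>A / 2) A x * v)"
      by (intro continuous_on_mult continuous_on_cutoff continuous_on_const)
    show "\<bar>cutoff (\<rho>A / 2) A x * v\<bar> \<le> v" for x
      using v(1) cutoff_bounds[of "\<rho>A/2" A x] by (simp add: abs_mult mult_left_le_one_le)
    show "cutoff (\<rho>A / 2) A x * v = 0" if "x \<notin> U" for x
      using cutoff_off[of "\<rho>A/2" A U x] \<rho>A that by simp
    show "\<bar>cutoff (\<rho>A / 2) A (x + t *\<^sub>R e) * v - cutoff (\<rho>A / 2) A x * v\<bar> \<le> t / 2" if "t > 0" for x t
      using cutoff_mult_lipschitz[of "\<rho>A/2" v A "x + t *\<^sub>R e" x] that \<rho>A(1) v nrm(1)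
      by (simp add: v0_def dist_norm)
  qed
  then have p0: "push U (\<eta> / 2) h0" using v(2) by (elim push_mono) (simp add: v0_def)
  have h0A: "h0 a = a + v *\<^sub>R e" if "a \<in> A" for a
    using that \<rho>A(1) by (simp add: h0_def cutoff_eq_1)
  define A2 where "A2 = h0 ` A"
  have "compact A2" unfolding A2_def using cA push_continuous[OF p0] by (intro compact_continuous_image)
  have td: "tot_disc (A2 \<inter> {x. x \<bullet> e = c})"
  proof (rule tot_disc_inj_vimage[OF Z(2)[OF v(3)], of _ "\<lambda>x. x - v *\<^sub>R e"])
    show "(\<lambda>x. x - v *\<^sub>R e) ` (A2 \<inter> {x. x \<bullet> e = c}) \<subseteq> A \<inter> {x. x \<bullet> e = c - v}"
      by (auto simp: A2_def h0A inner_add_left ee)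
  qed (auto intro!: continuous_intros inj_onI)
  \<comment> \<open>An isometric copy of the complex plane, which gives the planar construction a
    two-dimensional space to work in.\<close>
  define J where "J z = c *\<^sub>R e + Re z *\<^sub>R f + Im z *\<^sub>R g" for z
  have J_dist: "dist (J z) (J w) = dist z w" for z w
  proof -
    have "J z - J w = Re (z - w) *\<^sub>R f + Im (z - w) *\<^sub>R g"
      by (simp add: J_def algebra_simps)
    then have "(norm (J z - J w))\<^sup>2 = (Re (z - w))\<^sup>2 + (Im (z - w))\<^sup>2"
      unfolding power2_norm_eq_inner
      by (simp add: inner_add_left inner_add_right orth orth' ee power2_eq_square)
    also have "\<dots> = (norm (z - w))\<^sup>2" by (simp add: cmod_power2)
    finally show ?thesis unfolding dist_norm by (rule power2_eq_imp_eq) auto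
  qed
  have J_e: "J z \<bullet> e = c" for z by (simp add: J_def inner_add_left ee orth')
  have J_cont: "continuous_on T J" for T unfolding J_def by (intro continuous_intros)
  have J_inj: "inj_on J T" for T using J_dist by (metis dist_eq_0_iff inj_onI)
  define E where "E = J -` A2"
  have "closed E" unfolding E_def using compact_imp_closed[OF \<open>compact A2\<close>] J_cont[of UNIV]
    by (intro continuous_closed_vimage) (auto simp: continuous_on_eq_continuous_at)
  have "tot_disc E"
    by (rule tot_disc_inj_vimage[OF td J_cont J_inj]) (auto simp: E_def J_e)
  define a where "a = Complex (p \<bullet> f) (p \<bullet> g)"
  have J_line: "J (a + t *\<^sub>R 1) = p + t *\<^sub>R f" for t
    using basis[of p] by (simp add: J_def a_def c_def algebra_simps)
  \<comment> \<open>Four shears of size \<open>r\<close> cost at most \<eta> / 2, and the 8 * r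
    neighbourhood of the lengthened segment lies within 9 * r \<le> \<rho> of
    \<open>S\<close>.\<close>
  define r where "r = min (\<eta> / 8) (\<rho> / 16)"
  have r: "0 < r" using \<eta> \<rho> by (simp add: r_def)
  \<comment> \<open>The end points of the segment may themselves lie on the set, and then no arc
    between them avoids it. Hence the segment is lengthened at both ends by less than
    \<open>r\<close>, to end points outside \<open>E\<close>.\<close>
  obtain \<alpha> where \<alpha>: "- r < \<alpha>" "\<alpha> < 0" "a + \<alpha> *\<^sub>R 1 \<notin> E"
    using line_meets_complement_tot_disc[OF \<open>tot_disc E\<close>, of 1 "-r" 0 a] r by auto
  obtain \<beta> where \<beta>: "L < \<beta>" "\<beta> < L + r" "a + \<beta> *\<^sub>R 1 \<notin> E"
    using line_meets_complement_tot_disc[OF \<open>tot_disc E\<close>, of 1 L "L + r" a] r by auto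
  have "\<alpha> < \<beta>" using \<alpha> \<beta> L by linarith
  obtain \<gamma> \<sigma> where arcs: "arc \<gamma>" "arc \<sigma>" "pathstart \<gamma> = a + \<alpha> *\<^sub>R 1" "pathfinish \<gamma> = a + \<beta> *\<^sub>R 1"
    "pathstart \<sigma> = a + \<alpha> *\<^sub>R 1" "pathfinish \<sigma> = a + \<beta> *\<^sub>R 1"
    "path_image \<sigma> = closed_segment (a + \<alpha> *\<^sub>R 1) (a + \<beta> *\<^sub>R 1)"
    "path_image \<gamma> \<inter> E = {}" and close: "\<And>t. t \<in> {0..1} \<Longrightarrow> dist (\<gamma> t) (\<sigma> t) \<le> r"
    using arc_along_segment[OF _ \<open>closed E\<close> \<open>tot_disc E\<close> _ r \<open>\<alpha> < \<beta>\<close>, of 1 a] \<alpha>(3) \<beta>(3) by fastforce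
  have J_arc: "arc (J \<circ> k)" if "arc k" for k
    using that J_inj comp_inj_on[of k "{0..1}" J] continuous_on_compose[OF _ J_cont, of "{0..1}" k]
    by (auto simp: arc_def path_def)
  have img: "p + t *\<^sub>R f \<in> path_image (J \<circ> \<sigma>)" if t: "\<alpha> \<le> t" "t \<le> \<beta>" for t
  proof -
    have "a + t *\<^sub>R 1 \<in> path_image \<sigma>"
      unfolding arcs(7) using t closed_segment_line[of \<alpha> \<beta> a 1] by auto
    then show ?thesis unfolding path_image_compose using J_line by (metis imageI)
  qed
  have img': "infdist y S \<le> r" if y: "y \<in> path_image (J \<circ> \<sigma>)" for y
  proof -
    obtain w where w: "w \<in> closed_segment (a + \<alpha> *\<^sub>R 1) (a + \<beta> *\<^sub>R 1)" "y = J w"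
      using y arcs(7) unfolding path_image_compose by blast
    obtain t where "w = a + t *\<^sub>R 1" and "\<alpha> \<le> t" "t \<le> \<beta>"
      using w(1) closed_segment_line[of \<alpha> \<beta> a 1] \<open>\<alpha> < \<beta>\<close> by auto
    then have yt: "y = p + t *\<^sub>R f" using w(2) J_line by simp
    define t' where "t' = max 0 (min L t)"
    have "\<bar>t - t'\<bar> \<le> r" "0 \<le> t'" "t' \<le> L" using \<open>\<alpha> \<le> t\<close> \<open>t \<le> \<beta>\<close> \<alpha> \<beta> L r by (auto simp: t'_def)
    have "p + t' *\<^sub>R f \<in> S"
      unfolding S_line using \<open>0 \<le> t'\<close> \<open>t' \<le> L\<close> by auto
    from infdist_le[OF this, of y] show ?thesis
      using \<open>\<bar>t - t'\<bar> \<le> r\<close> nrm(2) by (simp add: yt dist_norm flip: scaleR_left_diff_distrib)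
  qed
  have U': "x \<in> U" if "infdist x (path_image (J \<circ> \<sigma>)) \<le> 8 * r" for x
  proof -
    have "arc (J \<circ> \<sigma>)" using J_arc arcs by blast
    then have "closed (path_image (J \<circ> \<sigma>))" "path_image (J \<circ> \<sigma>) \<noteq> {}"
      by (simp_all add: closed_arc_image)
    then obtain y where y: "y \<in> path_image (J \<circ> \<sigma>)" "infdist x (path_image (J \<circ> \<sigma>)) = dist x y"
      using infdist_attains_inf by blast
    have "infdist x S \<le> infdist y S + dist x y" by (rule infdist_triangle)
    also have "\<dots> \<le> r + 8 * r" using img'[OF y(1)] y(2) that by simp
    also have "\<dots> \<le> \<rho>" using \<rho>(1) by (simp add: r_def)
    finally show ?thesis by (rule \<rho>(2))
  qed
  obtain h1 where h1: "push U (4 * r) h1" "\<And>t. t \<in> {0..1} \<Longrightarrow> h1 ((J \<circ> \<gamma>) t) = (J \<circ> \<sigma>) t"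
  proof (rule push_arc_to_arc[OF nrm orth basis J_arc[OF arcs(1)] J_arc[OF arcs(2)] _ _ _ _ r _ U'])
    show "(J \<circ> \<gamma>) 0 = (J \<circ> \<sigma>) 0" "(J \<circ> \<gamma>) 1 = (J \<circ> \<sigma>) 1"
      using arcs(3-6) by (simp_all add: pathstart_def pathfinish_def)
    show "dist ((J \<circ> \<gamma>) t) ((J \<circ> \<sigma>) t) \<le> r" if "t \<in> {0..1}" for t
      using close[OF that] by (simp add: J_dist)
  qed (simp_all add: J_e)
  have "push U (\<eta> / 2 + 4 * r) (h1 \<circ> h0)" by (rule push_compose[OF p0 h1(1)])
  then have "push U \<eta> (h1 \<circ> h0)" by (rule push_mono) (simp add: r_def)
  moreover have "h1 x \<notin> S" if "x \<in> A2" for x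
  proof
    assume "h1 x \<in> S"
    then obtain t where "h1 x = p + t *\<^sub>R f" "0 \<le> t" "t \<le> L" unfolding S_line image_iff by force
    then have "h1 x \<in> path_image (J \<circ> \<sigma>)" using img \<alpha> \<beta> by simp
    then obtain t where t: "t \<in> {0..1}" "h1 x = (J \<circ> \<sigma>) t" by (auto simp: path_image_def)
    then have "h1 x = h1 ((J \<circ> \<gamma>) t)" using h1(2) by simp
    then have "x = J (\<gamma> t)" using push_bij[OF h1(1)] by (simp add: bij_def inj_eq)
    then have "\<gamma> t \<in> E" using that by (simp add: E_def)
    then show False using arcs(8) t(1) unfolding path_image_def by blast
  qed
  then have "(h1 \<circ> h0) ` A \<inter> S = {}" unfolding A2_def comp_def by blast
  ultimately show ?thesis using that unfolding S_def by blast
qed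

section \<open>Pushing off the grid\<close>

lemma thin_push: "thin A \<Longrightarrow> push U \<eta> h \<Longrightarrow> thin (h ` A)"
  using thin_image push_continuous push_bij by (metis bij_is_inj inj_on_subset subset_UNIV)

text \<open>Each further push is at most half the distance from the current image to the pieces
  already missed, so nothing gained is lost.\<close>

lemma push_off_Union:
  fixes \<S> :: "'a::euclidean_space set set"
  assumes "finite \<S>" and "\<And>S. S \<in> \<S> \<Longrightarrow> compact S"
    and off: "\<And>S A \<eta>. S \<in> \<S> \<Longrightarrow> thin A \<Longrightarrow> A \<noteq> {} \<Longrightarrow> A \<subseteq> U \<Longrightarrow> 0 < \<eta> \<Longrightarrow> \<exists>h. push U \<eta> h \<and> h ` A \<inter> S = {}"
    and A: "thin A" "A \<noteq> {}" "A \<subseteq> U" and "0 < \<eta>"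
  shows "\<exists>h. push U \<eta> h \<and> h ` A \<inter> \<Union>\<S> = {}"
  using assms(1,2) off \<open>0 < \<eta>\<close>
proof (induction \<S> arbitrary: \<eta> rule: finite_induct)
  case empty
  then show ?case using push_id[of \<eta> U] by (intro exI[of _ "\<lambda>x. x"]) auto
next
  case (insert S \<S>)
  then obtain h where h: "push U (\<eta> / 2) h" "h ` A \<inter> \<Union>\<S> = {}"
    by (metis (no_types, lifting) half_gt_zero insertCI)
  have "compact (h ` A)" using A(1) push_continuous[OF h(1)] unfolding thin_def by (blast intro: compact_continuous_image)
  moreover have "closed (\<Union>\<S>)" using insert by (intro closed_Union) (auto intro: compact_imp_closed)
  ultimately obtain d where d: "d > 0" "\<And>x y. x \<in> h ` A \<Longrightarrow> y \<in> \<Union>\<S> \<Longrightarrow> d \<le> dist x y"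
    using separate_compact_closed[of "h ` A" "\<Union>\<S>"] h(2) by metis
  have "0 < min (\<eta> / 2) (d / 2)" using d(1) insert by auto
  then obtain k where k: "push U (min (\<eta> / 2) (d / 2)) k" "k ` h ` A \<inter> S = {}"
    using insert.prems(2)[of S "h ` A"] thin_push[OF A(1) h(1)] push_image_subset[OF h(1) A(3)] A(2) by blast
  have "push U \<eta> (k \<circ> h)" by (rule push_mono[OF push_compose[OF h(1) k(1)]]) auto
  have "k (h a) \<notin> \<Union>\<S>" if "a \<in> A" for a
  proof
    assume "k (h a) \<in> \<Union>\<S>"
    then have "d \<le> dist (h a) (k (h a))" using d(2) that by blast
    moreover have "dist (k (h a)) (h a) \<le> d / 2" using push_dist[OF k(1), of "h a"] by simp
    ultimately show False using d(1) by (simp add: dist_commute)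
  qed
  then have "(k \<circ> h) ` A \<inter> \<Union>(insert S \<S>) = {}" using k(2) unfolding comp_def by blast
  with \<open>push U \<eta> (k \<circ> h)\<close> show ?case by blast
qed

lemma third_index_3: 
  fixes i j :: 3 assumes "i \<noteq> j"
  obtains l where "l \<noteq> i" "l \<noteq> j" "\<And>m. m = i \<or> m = j \<or> m = l"
proof -
  consider "i = 1" "j = 2" | "i = 2" "j = 1" | "i = 1" "j = 3" | "i = 3" "j = 1" | "i = 2" "j = 3" | "i = 3" "j = 2"
    using assms exhaust_3[of i] exhaust_3[of j] by blast
  then show ?thesis
  proof cases
    case 1 show ?thesis by (rule that[of 3]) (use 1 exhaust_3 in auto)
  next
    case 2 show ?thesis by (rule that[of 3]) (use 2 exhaust_3 in auto)
  next
    case 3 show ?thesis by (rule that[of 2]) (use 3 exhaust_3 in auto)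
  next
    case 4 show ?thesis by (rule that[of 2]) (use 4 exhaust_3 in auto)
  next
    case 5 show ?thesis by (rule that[of 1]) (use 5 exhaust_3 in auto)
  next
    case 6 show ?thesis by (rule that[of 1]) (use 6 exhaust_3 in auto)
  qed
qed

lemma push_off_axis_segment:
  fixes p :: "real ^ 3"
  assumes A: "thin A" "A \<noteq> {}" "A \<subseteq> U" and U: "open U"
    and L: "0 \<le> L" and seg: "closed_segment p (p + L *\<^sub>R axis j 1) \<subseteq> U" and \<eta>: "0 < \<eta>"
  shows "\<exists>h. push U \<eta> h \<and> h ` A \<inter> closed_segment p (p + L *\<^sub>R axis j 1) = {}"
proof -
  obtain i :: 3 where "i \<noteq> j" by (metis one_neq_zero)
  then obtain l where l: "l \<noteq> i" "l \<noteq> j" "\<And>m. m = i \<or> m = j \<or> m = l" using third_index_3 by blast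
  have "x = (x \<bullet> axis i 1) *\<^sub>R axis i 1 + (x \<bullet> axis j 1) *\<^sub>R axis j 1 + (x \<bullet> axis l 1) *\<^sub>R axis l 1" for x :: "real ^ 3"
    unfolding vec_eq_iff
  proof
    fix m show "x $ m = ((x \<bullet> axis i 1) *\<^sub>R axis i 1 + (x \<bullet> axis j 1) *\<^sub>R axis j 1 + (x \<bullet> axis l 1) *\<^sub>R axis l 1) $ m"
      using l(3)[of m] l(1,2) \<open>i \<noteq> j\<close> by (auto simp: inner_axis) (simp_all add: axis_def)
  qed
  note basis = this
  have orth: "axis i 1 \<bullet> axis j (1::real) = 0" "axis i 1 \<bullet> axis l (1::real) = 0" "axis j 1 \<bullet> axis l (1::real) = 0"
    using l(1,2) \<open>i \<noteq> j\<close> by (simp_all add: inner_axis_axis)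
  have nrm: "norm (axis m (1::real)) = 1" for m :: 3 by simp
  show ?thesis
  proof (rule push_off_segment[of "axis i 1" "axis j 1" "axis l 1" A U L p \<eta>])
    fix h assume "push U \<eta> h" "h ` A \<inter> closed_segment p (p + L *\<^sub>R axis j 1) = {}"
    then show ?thesis by blast
  qed (rule nrm orth basis A U L seg \<eta>)+
qed

lemma dist_axis_line: "dist (x + s *\<^sub>R axis i 1 :: real ^ 'n::finite) x = \<bar>s\<bar>"
  by (simp add: dist_norm)

text \<open>A point is on the 1-skeleton when for some \<open>l\<close> all coordinates other than
  \<open>l\<close> are multiples of \<eta>; the conclusion excludes this for each
  \<open>l\<close>.\<close>

lemma push_off_grid:
  fixes A :: "(real ^ 3) set"
  assumes A: "thin A" "A \<noteq> {}" "A \<subseteq> U" and U: "open U" and \<delta>: "0 < \<delta>" "\<delta> \<le> \<eta>"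
    and room: "\<And>x. infdist x A \<le> 3 * \<eta> \<Longrightarrow> x \<in> U"
  obtains h where "push U \<delta> h" "\<And>x l. x \<in> h ` A \<Longrightarrow> \<exists>i. i \<noteq> l \<and> x $ i / \<eta> \<notin> \<int>"
proof -
  have \<eta>: "0 < \<eta>" using \<delta> by simp
  have "bounded A" using A(1) unfolding thin_def by (auto intro: compact_imp_bounded)
  then obtain R where R: "\<And>x. x \<in> A \<Longrightarrow> norm x \<le> R" unfolding bounded_iff by blast
  define K where "K = \<lceil>(R + \<eta>) / \<eta>\<rceil> + 1"
  define P where "P = (\<lambda>k :: 3 \<Rightarrow> int. (\<chi> i. of_int (k i) * \<eta>) :: real ^ 3) ` (UNIV \<rightarrow>\<^sub>E {-K..K})"
  define s where "s p j = closed_segment p (p + \<eta> *\<^sub>R axis j 1)" for p :: "real ^ 3" and j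
  \<comment> \<open>Pushes are supported in \<open>U\<close>, so only edges inside \<open>U\<close>
    can be cleared. This is enough: an edge met by the image stays within 2 * \<eta> of the original
    set and therefore lies in \<open>U\<close>.\<close>
  define \<S> where "\<S> = {S \<in> (\<lambda>(p, j). s p j) ` (P \<times> UNIV). S \<subseteq> U}"
  have "finite P" unfolding P_def by (intro finite_imageI finite_PiE) auto
  then have "finite \<S>" unfolding \<S>_def by simp
  then have "\<exists>h. push U \<delta> h \<and> h ` A \<inter> \<Union>\<S> = {}"
  proof (rule push_off_Union)
    fix S assume "S \<in> \<S>"
    then have "S \<subseteq> U" "S \<in> (\<lambda>(p, j). s p j) ` (P \<times> UNIV)" by (simp_all add: \<S>_def)
    then obtain p j where S: "S = closed_segment p (p + \<eta> *\<^sub>R axis j 1)" "S \<subseteq> U"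
      by (auto simp: s_def)
    show "compact S" unfolding S(1) by (rule compact_segment)
    show "\<exists>h. push U \<epsilon> h \<and> h ` A' \<inter> S = {}"
      if "thin A'" "A' \<noteq> {}" "A' \<subseteq> U" "0 < \<epsilon>" for A' \<epsilon>
      unfolding S(1) by (rule push_off_axis_segment) (use that U \<eta> S in simp_all)
  qed (use A \<delta> in simp_all)
  then obtain h where h: "push U \<delta> h" "h ` A \<inter> \<Union>\<S> = {}" by blast
  show ?thesis
  proof (rule that[OF h(1)])
    fix x l assume x: "x \<in> h ` A"
    then obtain a where a: "a \<in> A" "x = h a" by blast
    have xa: "dist x a \<le> \<eta>" using push_dist[OF h(1), of a] \<delta> a by simp
    show "\<exists>i. i \<noteq> l \<and> x $ i / \<eta> \<notin> \<int>"
    proof (rule ccontr)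
      assume "\<not> ?thesis"
      then have int: "x $ i / \<eta> \<in> \<int>" if "i \<noteq> l" for i using that by blast
      define k where "k i = \<lfloor>x $ i / \<eta>\<rfloor>" for i
      define p :: "real ^ 3" where "p = (\<chi> i. of_int (k i) * \<eta>)"
      have "k i \<in> {-K..K}" for i
      proof -
        have "\<bar>x $ i\<bar> \<le> norm x" by (rule component_le_norm_cart)
        also have "\<dots> \<le> R + \<eta>" using norm_triangle_ineq2[of x a] xa R[OF a(1)] by (simp add: dist_norm)
        finally have "\<bar>x $ i / \<eta>\<bar> \<le> (R + \<eta>) / \<eta>" using \<eta> by (simp add: abs_divide divide_right_mono)
        then have "x $ i / \<eta> \<le> (R + \<eta>) / \<eta>" "- ((R + \<eta>) / \<eta>) \<le> x $ i / \<eta>" by (simp_all only: abs_le_iff) linarith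
        then show ?thesis unfolding k_def K_def atLeastAtMost_iff by linarith
      qed
      then have "p \<in> P" unfolding P_def p_def by (intro image_eqI[of _ _ k]) auto
      define u where "u = x $ l - of_int (k l) * \<eta>"
      have kl: "of_int (k l) \<le> x $ l / \<eta>" "x $ l / \<eta> < of_int (k l) + 1" unfolding k_def by linarith+
      then have u: "0 \<le> u" "u \<le> \<eta>" using \<eta> by (simp_all add: u_def field_simps)
      have x_eq: "x = p + u *\<^sub>R axis l 1"
        unfolding vec_eq_iff
      proof
        fix i show "x $ i = (p + u *\<^sub>R axis l 1) $ i"
        proof (cases "i = l")
          case False
          then have "of_int (k i) = x $ i / \<eta>" using int[OF False] unfolding k_def by (metis Ints_cases floor_of_int)
          then show ?thesis using False \<eta> by (simp add: p_def axis_def)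
        qed (simp add: p_def u_def axis_def)
      qed
      then have "x \<in> s p l" unfolding s_def using closed_segment_line[of 0 \<eta> p "axis l 1"] u \<eta> by auto
      moreover have "s p l \<subseteq> U"
      proof
        fix y assume "y \<in> s p l"
        then obtain t where t: "0 \<le> t" "t \<le> \<eta>" "y = p + t *\<^sub>R axis l 1"
          unfolding s_def using closed_segment_line[of 0 \<eta> p "axis l 1"] \<eta> by auto
        have "y = x + (t - u) *\<^sub>R axis l 1" unfolding x_eq t(3) by (simp add: algebra_simps)
        then have "dist y x \<le> \<eta>" using t u by (simp add: dist_axis_line)
        then have "dist y a \<le> 2 * \<eta>" using dist_triangle[of y a x] xa by linarith
        then have "infdist y A \<le> 3 * \<eta>" using infdist_le[OF a(1), of y] \<eta> by linarith
        then show "y \<in> U" by (rule room)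
      qed
      ultimately have "x \<in> \<Union>\<S>" using \<open>p \<in> P\<close> unfolding \<S>_def by blast
      then show False using h(2) x by blast
    qed
  qed
qed

text \<open>For fixed \<open>l\<close> the distances to the integers, summed over the other two
  coordinates, form a continuous positive function on a compact set, so one of the two summands is
  uniformly bounded below.\<close>

lemma compact_grid_gap:
  fixes A :: "(real ^ 3) set"
  assumes "compact A" and miss: "\<And>x l. x \<in> A \<Longrightarrow> \<exists>i. i \<noteq> l \<and> x $ i / \<eta> \<notin> \<int>"
  obtains \<kappa> where "0 < \<kappa>" "\<And>x. x \<in> A \<Longrightarrow> \<exists>l. \<forall>i. i \<noteq> l \<longrightarrow> \<kappa> \<le> infdist (x $ i / \<eta>) \<int>"
proof -
  have "\<exists>\<kappa>>0. \<forall>x\<in>A. \<exists>i. i \<noteq> l \<and> \<kappa> \<le> infdist (x $ i / \<eta>) \<int>" for l :: 3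
  proof (cases "A = {}")
    case False
    define F where "F x = (\<Sum>i\<in>-{l}. infdist (x $ i / \<eta>) \<int>)" for x :: "real ^ 3"
    have "continuous_on A F" unfolding F_def divide_inverse by (intro continuous_intros)
    then obtain a where a: "a \<in> A" "\<And>x. x \<in> A \<Longrightarrow> F a \<le> F x"
      using continuous_attains_inf[OF assms(1) False] by blast
    obtain i where i: "i \<noteq> l" "a $ i / \<eta> \<notin> \<int>" using miss[OF a(1)] by blast
    have "(\<int>::real set) \<noteq> {}" using Ints_0 by blast
    then have "0 < infdist (a $ i / \<eta>) \<int>" using i(2) infdist_pos_not_in_closed by (metis closed_Ints)
    also have "\<dots> \<le> F a" unfolding F_def using i(1) by (intro member_le_sum) (auto simp: infdist_nonneg)
    finally have "0 < F a" .
    \<comment> \<open>Two summands below a third of the minimum would add up to less than the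
      minimum.\<close>
    have "\<exists>i. i \<noteq> l \<and> F a / 3 \<le> infdist (x $ i / \<eta>) \<int>" if "x \<in> A" for x
    proof (rule ccontr)
      assume "\<not> ?thesis"
      then have "F x \<le> (\<Sum>i\<in>-{l}. F a / 3)" unfolding F_def by (intro sum_mono) force
      also have "\<dots> = 2 * (F a / 3)" by (simp add: Compl_eq_Diff_UNIV card_Diff_singleton)
      finally show False using a(2)[OF that] \<open>0 < F a\<close> by simp
    qed
    then show ?thesis using \<open>0 < F a\<close> by (intro exI[of _ "F a / 3"]) auto
  qed (auto intro: zero_less_one)
  then obtain \<kappa> where \<kappa>: "\<And>l. 0 < \<kappa> l" "\<And>l x. x \<in> A \<Longrightarrow> \<exists>i. i \<noteq> l \<and> \<kappa> l \<le> infdist (x $ i / \<eta>) \<int>" by metis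
  show ?thesis
  proof (rule that[of "Min (range \<kappa>)"])
    show "0 < Min (range \<kappa>)" using \<kappa>(1) by (auto simp: Min_gr_iff)
    fix x assume x: "x \<in> A"
    have le: "Min (range \<kappa>) \<le> \<kappa> l" for l by simp
    \<comment> \<open>Using the bound for index 1 and then for index \<open>i\<close> gives two
      distinct coordinates away from the integers; the remaining index is the exceptional
      \<open>l\<close>.\<close>
    obtain i where i: "Min (range \<kappa>) \<le> infdist (x $ i / \<eta>) \<int>" using \<kappa>(2)[OF x, of 1] le order_trans by blast
    obtain j where j: "j \<noteq> i" "Min (range \<kappa>) \<le> infdist (x $ j / \<eta>) \<int>" using \<kappa>(2)[OF x, of i] le order_trans by blast
    obtain l where "\<And>m. m = i \<or> m = j \<or> m = l" using third_index_3[of i j] j(1) by metis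
    then show "\<exists>l. \<forall>i. i \<noteq> l \<longrightarrow> Min (range \<kappa>) \<le> infdist (x $ i / \<eta>) \<int>" using i j by metis
  qed
qed

section \<open>Squeezing towards the dual grid\<close>

text \<open>
  In each cell of length \<open>\<eta>\<close>, rescaled to \<open>[-1, 1]\<close>, squeezing is the map \<open>z \<mapsto> z ^ N\<close>: for odd \<open>N\<close> it is a
  homeomorphism fixing the end points, and for large \<open>N\<close> it contracts compact parts of the open cell
  to the centre.
\<close>

definition cell_centre :: "real \<Rightarrow> real \<Rightarrow> real" where
  "cell_centre \<eta> t = (of_int \<lfloor>t / \<eta>\<rfloor> + 1/2) * \<eta>"

definition squeeze :: "real \<Rightarrow> nat \<Rightarrow> real \<Rightarrow> real" where
  "squeeze \<eta> N t = cell_centre \<eta> t + \<eta> / 2 * ((t - cell_centre \<eta> t) / (\<eta> / 2)) ^ N"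

text \<open>The displacement \<open>squeeze \<eta> N t - t\<close> on the k-th cell, extended by 0:
  clamping to [-1, 1] makes it continuous and, for odd \<open>N\<close>, zero outside the cell. The
  floor in \<open>squeeze\<close> hides this continuity.\<close>

definition bump_shift :: "real \<Rightarrow> nat \<Rightarrow> int \<Rightarrow> real \<Rightarrow> real" where
  "bump_shift \<eta> N k t =
     (let z = max (-1) (min 1 ((t - (of_int k + 1/2) * \<eta>) / (\<eta> / 2))) in \<eta> / 2 * (z ^ N - z))"

lemma bump_shift_cell:
  assumes "0 < \<eta>" "k = \<lfloor>t / \<eta>\<rfloor>"
  shows "t + bump_shift \<eta> N k t = squeeze \<eta> N t"
proof -
  have "of_int k \<le> t / \<eta>" "t / \<eta> < of_int k + 1" unfolding assms(2) by linarith+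
  then have "of_int k * \<eta> \<le> t" "t < (of_int k + 1) * \<eta>" using assms(1) by (simp_all add: field_simps)
  then have z: "-1 \<le> (t - (of_int k + 1/2) * \<eta>) / (\<eta> / 2)" "(t - (of_int k + 1/2) * \<eta>) / (\<eta> / 2) \<le> 1"
    using assms(1) by (simp_all add: field_simps)
  have c: "cell_centre \<eta> t = (of_int k + 1/2) * \<eta>" by (simp add: cell_centre_def assms(2))
  have "\<eta> / 2 * ((t - cell_centre \<eta> t) / (\<eta> / 2)) = t - cell_centre \<eta> t" using assms(1) by simp
  then show ?thesis
    unfolding bump_shift_def squeeze_def Let_def c right_diff_distrib using z by (simp add: min_absorb2 max_absorb2)
qed

lemma bump_shift_other:
  assumes "0 < \<eta>" "k \<noteq> \<lfloor>t / \<eta>\<rfloor>" "odd N"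
  shows "bump_shift \<eta> N k t = 0"
proof -
  define z where "z = (t - (of_int k + 1/2) * \<eta>) / (\<eta> / 2)"
  have z: "z = 2 * (t / \<eta>) - 2 * of_int k - 1" using assms(1) by (simp add: z_def field_simps)
  have "t / \<eta> < of_int k \<or> of_int k + 1 \<le> t / \<eta>" using assms(2) by linarith
  then have "z \<le> -1 \<or> 1 \<le> z" unfolding z by linarith
  then have "max (-1) (min 1 z) = -1 \<or> max (-1) (min 1 z) = 1" by auto
  then show ?thesis using assms(3) unfolding bump_shift_def z_def[symmetric] Let_def by auto
qed

lemma abs_bump_shift_le:
  assumes "0 < \<eta>" shows "\<bar>bump_shift \<eta> N k t\<bar> \<le> \<eta>"
proof -
  define z where "z = max (-1) (min 1 ((t - (of_int k + 1/2) * \<eta>) / (\<eta> / 2)))"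
  have z: "\<bar>z\<bar> \<le> 1" by (auto simp: z_def)
  then have "\<bar>z ^ N\<bar> \<le> 1" by (simp add: power_abs power_le_one)
  with z have "\<bar>z ^ N - z\<bar> \<le> 2" by linarith
  then have "\<eta> / 2 * \<bar>z ^ N - z\<bar> \<le> \<eta> / 2 * 2" using assms by (intro mult_left_mono) auto
  then show ?thesis using assms unfolding bump_shift_def z_def[symmetric] Let_def by (simp add: abs_mult)
qed

lemma continuous_on_bump_shift: "continuous_on S (bump_shift \<eta> N k)"
  unfolding bump_shift_def Let_def divide_inverse by (intro continuous_intros)

text \<open>Odd powers preserve the interval [-1, 1). Staying inside the half-open cell keeps points
  of different cells in order.\<close>

lemma squeeze_in_cell:
  assumes "0 < \<eta>" "odd N"
  shows "of_int \<lfloor>t / \<eta>\<rfloor> * \<eta> \<le> squeeze \<eta> N t" "squeeze \<eta> N t < (of_int \<lfloor>t / \<eta>\<rfloor> + 1) * \<eta>"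
proof -
  define z where "z = (t - cell_centre \<eta> t) / (\<eta> / 2)"
  have z: "z = 2 * (t / \<eta>) - 2 * of_int \<lfloor>t / \<eta>\<rfloor> - 1" using assms(1) by (simp add: z_def cell_centre_def field_simps)
  have "of_int \<lfloor>t / \<eta>\<rfloor> \<le> t / \<eta>" "t / \<eta> < of_int \<lfloor>t / \<eta>\<rfloor> + 1" by linarith+
  then have "-1 \<le> z" "z < 1" unfolding z by linarith+
  have "(-1) ^ N \<le> z ^ N" using \<open>-1 \<le> z\<close> by (rule power_mono_odd[OF assms(2)])
  then have 1: "-1 \<le> z ^ N" using assms(2) by simp
  have 2: "z ^ N < 1"
  proof (cases "0 \<le> z")
    case True then show ?thesis using \<open>z < 1\<close> assms(2) by (simp add: power_less_one_iff odd_pos)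
  next
    case False
    then have "z ^ N < 0" using assms(2) by (simp add: power_less_zero_eq)
    then show ?thesis by linarith
  qed
  have "squeeze \<eta> N t = of_int \<lfloor>t / \<eta>\<rfloor> * \<eta> + \<eta> / 2 * (1 + z ^ N)"
    unfolding squeeze_def z_def[symmetric] by (simp add: cell_centre_def algebra_simps)
  moreover have "0 \<le> \<eta> / 2 * (1 + z ^ N)" using 1 assms by simp
  moreover have "\<eta> / 2 * (1 + z ^ N) < \<eta> / 2 * 2" using 2 assms by (intro mult_strict_left_mono) auto
  ultimately show "of_int \<lfloor>t / \<eta>\<rfloor> * \<eta> \<le> squeeze \<eta> N t" "squeeze \<eta> N t < (of_int \<lfloor>t / \<eta>\<rfloor> + 1) * \<eta>"
    by (auto simp: algebra_simps)
qed

lemma squeeze_strict_mono_cell: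
  assumes "0 < \<eta>" "odd N" "s < t" "\<lfloor>s / \<eta>\<rfloor> = \<lfloor>t / \<eta>\<rfloor>"
  shows "squeeze \<eta> N s < squeeze \<eta> N t"
proof -
  have c: "cell_centre \<eta> s = cell_centre \<eta> t" using assms(4) by (simp add: cell_centre_def)
  have "(s - cell_centre \<eta> t) / (\<eta> / 2) < (t - cell_centre \<eta> t) / (\<eta> / 2)"
    using assms(1,3) by (intro divide_strict_right_mono) auto
  then have "((s - cell_centre \<eta> t) / (\<eta> / 2)) ^ N < ((t - cell_centre \<eta> t) / (\<eta> / 2)) ^ N"
    using power_mono_odd[OF assms(2)] odd_real_root_power_cancel[OF assms(2)] by (metis less_le)
  then show ?thesis using assms(1) unfolding squeeze_def c by simp
qed

text \<open>Distance \<kappa> from the integers means |z| \<le> 1 - 2 * \<kappa> in the rescaled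
  cell.\<close>

lemma squeeze_near_centre:
  assumes "0 < \<eta>" "\<kappa> \<le> infdist (t / \<eta>) \<int>"
  shows "\<bar>squeeze \<eta> N t - cell_centre \<eta> t\<bar> \<le> \<eta> / 2 * (1 - 2 * \<kappa>) ^ N"
proof -
  define z where "z = (t - cell_centre \<eta> t) / (\<eta> / 2)"
  have z: "z = 2 * (t / \<eta>) - 2 * of_int \<lfloor>t / \<eta>\<rfloor> - 1" using assms(1) by (simp add: z_def cell_centre_def field_simps)
  have "infdist (t / \<eta>) \<int> \<le> dist (t / \<eta>) (of_int \<lfloor>t / \<eta>\<rfloor>)" "infdist (t / \<eta>) \<int> \<le> dist (t / \<eta>) (of_int (\<lfloor>t / \<eta>\<rfloor> + 1))"
    by (rule infdist_le[OF Ints_of_int])+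
  then have "\<kappa> \<le> t / \<eta> - of_int \<lfloor>t / \<eta>\<rfloor>" "\<kappa> \<le> of_int \<lfloor>t / \<eta>\<rfloor> + 1 - t / \<eta>"
    using assms(2) unfolding dist_real_def of_int_add of_int_1 by linarith+
  then have "\<bar>z\<bar> \<le> 1 - 2 * \<kappa>" unfolding z by linarith
  then have "\<bar>z\<bar> ^ N \<le> (1 - 2 * \<kappa>) ^ N" by (intro power_mono) auto
  then have "\<eta> / 2 * \<bar>z\<bar> ^ N \<le> \<eta> / 2 * (1 - 2 * \<kappa>) ^ N" using assms(1) by (intro mult_left_mono) auto
  then show ?thesis unfolding squeeze_def z_def[symmetric] using assms(1) by (simp add: abs_mult power_abs)
qed

text \<open>
  The cutoff is evaluated at the midpoint of the cell, hence constant along the squeezed coordinate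
  within a cell, so it does not affect monotonicity; its jumps between cells are harmless because
  the end points of the cells do not move.
\<close>

lemma push_squeeze_coordinate:
  fixes A :: "(real ^ 'n::finite) set"
  assumes A: "bounded A" "A \<noteq> {}" and \<eta>: "0 < \<eta>" and N: "odd N"
    and room: "\<And>x. infdist x A \<le> 10 * \<eta> \<Longrightarrow> x \<in> U"
  obtains h where "push U \<eta> h" 
    "\<And>x. infdist x A \<le> 3 * \<eta> \<Longrightarrow> h x = x + (squeeze \<eta> N (x $ i) - x $ i) *\<^sub>R axis i 1"
proof -
  define \<theta> where "\<theta> = cutoff (4 * \<eta>) A"
  define e :: "real ^ 'n" where "e = axis i 1"
  define mid where "mid k x = x + ((of_int k + 1/2) * \<eta> - x $ i) *\<^sub>R e" for k :: int and x
  have ei: "e $ i = 1" by (simp add: e_def)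
  have ne: "norm e = 1" by (simp add: e_def)
  have mid_i: "mid k x $ i = (of_int k + 1/2) * \<eta>" for k x by (simp add: mid_def ei)
  have mid_shift: "mid k (x + t *\<^sub>R e) = mid k x" for k x t by (simp add: mid_def ei algebra_simps)
  have \<theta>01: "0 \<le> \<theta> x" "\<theta> x \<le> 1" for x by (simp_all add: \<theta>_def cutoff_bounds)
  have fl: "of_int \<lfloor>t / \<eta>\<rfloor> * \<eta> \<le> t" "t < (of_int \<lfloor>t / \<eta>\<rfloor> + 1) * \<eta>" for t
  proof -
    have 1: "of_int \<lfloor>t / \<eta>\<rfloor> \<le> t / \<eta>" and 2: "t / \<eta> < of_int \<lfloor>t / \<eta>\<rfloor> + 1" by linarith+
    show "of_int \<lfloor>t / \<eta>\<rfloor> * \<eta> \<le> t" using 1 unfolding pos_le_divide_eq[OF \<eta>] .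
    show "t < (of_int \<lfloor>t / \<eta>\<rfloor> + 1) * \<eta>" using 2 unfolding pos_divide_less_eq[OF \<eta>] .
  qed
  have mid_near: "dist (mid \<lfloor>x $ i / \<eta>\<rfloor> x) x \<le> \<eta>" for x
  proof -
    have "dist (mid \<lfloor>x $ i / \<eta>\<rfloor> x) x = \<bar>(of_int \<lfloor>x $ i / \<eta>\<rfloor> + 1/2) * \<eta> - x $ i\<bar>"
      by (simp add: mid_def dist_norm ne)
    then show ?thesis using fl[of "x $ i"] \<eta> by (simp add: algebra_simps abs_le_iff)
  qed
  obtain R where R: "\<And>x. x \<in> A \<Longrightarrow> norm x \<le> R" using A(1) unfolding bounded_iff by blast
  \<comment> \<open>The cutoff at the midpoint of the k-th cell is nonzero only if this midpoint is
    within 8 * \<eta> of \<open>A\<close>. That leaves finitely many k, so \<open>u\<close> below is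
    a finite sum of continuous functions.\<close>
  define K where "K = \<lceil>(R + 9 * \<eta>) / \<eta>\<rceil> + 1"
  have K: "k \<in> {-K..K}" if nz: "\<theta> (mid k x) \<noteq> 0" for k x
  proof -
    have "infdist (mid k x) A < 2 * (4 * \<eta>)"
      using nz cutoff_eq_0[of "4 * \<eta>" "mid k x" A] \<eta> unfolding \<theta>_def by (meson mult_pos_pos not_le zero_less_numeral)
    then obtain a where a: "a \<in> A" "dist (mid k x) a < 2 * (4 * \<eta>)"
      using A(2) by (auto simp: infdist_notempty cINF_less_iff)
    have "\<bar>mid k x $ i\<bar> \<le> norm (mid k x)" by (rule component_le_norm_cart)
    also have "\<dots> \<le> R + 8 * \<eta>" using norm_triangle_ineq2[of "mid k x" a] a(2) R[OF a(1)] by (simp add: dist_norm)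
    finally have "\<bar>(of_int k + 1/2) * \<eta>\<bar> \<le> R + 8 * \<eta>" by (simp add: mid_i)
    then have "\<bar>of_int k + 1/2\<bar> * \<eta> \<le> R + 8 * \<eta>" using \<eta> by (simp add: abs_mult)
    then have "\<bar>of_int k + 1/2\<bar> \<le> (R + 8 * \<eta>) / \<eta>" using \<eta> by (simp add: pos_le_divide_eq)
    also have "\<dots> = (R + 9 * \<eta>) / \<eta> - 1" using \<eta> by (simp add: field_simps)
    finally have "\<bar>of_int k + 1/2\<bar> \<le> of_int K - (2::real)" unfolding K_def by linarith
    then have "of_int k \<le> (of_int K :: real)" "of_int (-K) \<le> (of_int k :: real)" by (simp_all add: abs_le_iff)
    then show ?thesis by (simp only: of_int_le_iff atLeastAtMost_iff)
  qed
  define u where "u x = (\<Sum>k\<in>{-K..K}. \<theta> (mid k x) * bump_shift \<eta> N k (x $ i))" for x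
  have u_single: "u x = \<theta> (mid \<lfloor>x $ i / \<eta>\<rfloor> x) * bump_shift \<eta> N \<lfloor>x $ i / \<eta>\<rfloor> (x $ i)" for x
  proof -
    let ?k = "\<lfloor>x $ i / \<eta>\<rfloor>"
    have "u x = (\<Sum>k\<in>{-K..K}. if k = ?k then \<theta> (mid k x) * bump_shift \<eta> N k (x $ i) else 0)"
      unfolding u_def by (intro sum.cong refl) (auto simp: bump_shift_other[OF \<eta> _ N])
    also have "\<dots> = (if ?k \<in> {-K..K} then \<theta> (mid ?k x) * bump_shift \<eta> N ?k (x $ i) else 0)"
      by (subst sum.delta) auto
    finally show ?thesis using K[of ?k x] by auto
  qed
  \<comment> \<open>The new coordinate is a convex combination of the old and the squeezed one, with
    a weight that is fixed along the line inside a cell. So it stays in the cell and is strictly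
    monotone there.\<close>
  have u_conv: "x $ i + u x = (1 - \<theta> (mid \<lfloor>x $ i / \<eta>\<rfloor> x)) * x $ i + \<theta> (mid \<lfloor>x $ i / \<eta>\<rfloor> x) * squeeze \<eta> N (x $ i)" for x
    unfolding u_single bump_shift_cell[OF \<eta> refl, of "x $ i" N, symmetric] by (simp add: algebra_simps)
  have cell: "of_int \<lfloor>x $ i / \<eta>\<rfloor> * \<eta> \<le> x $ i + u x" "x $ i + u x < (of_int \<lfloor>x $ i / \<eta>\<rfloor> + 1) * \<eta>" for x
  proof -
    let ?c = "\<theta> (mid \<lfloor>x $ i / \<eta>\<rfloor> x)"
    show "x $ i + u x < (of_int \<lfloor>x $ i / \<eta>\<rfloor> + 1) * \<eta>"
      unfolding u_conv using fl(2) squeeze_in_cell(2)[OF \<eta> N] \<theta>01 by (intro convex_bound_lt) auto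
    have "- (of_int \<lfloor>x $ i / \<eta>\<rfloor> * \<eta>) \<ge> (1 - ?c) * (- (x $ i)) + ?c * (- squeeze \<eta> N (x $ i))"
      using fl(1) squeeze_in_cell(1)[OF \<eta> N] \<theta>01 by (intro convex_bound_le) auto
    then show "of_int \<lfloor>x $ i / \<eta>\<rfloor> * \<eta> \<le> x $ i + u x" unfolding u_conv by simp
  qed
  have "push U \<eta> (\<lambda>x. x + u x *\<^sub>R e)"
  proof (rule push_shear[OF ne])
    show "continuous_on UNIV u"
      unfolding u_def \<theta>_def mid_def
      by (intro continuous_intros continuous_on_compose2[OF continuous_on_cutoff[of UNIV]]
           continuous_on_compose2[OF continuous_on_bump_shift[of UNIV]]) auto
    show "\<bar>u x\<bar> \<le> \<eta>" for x
    proof -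
      have "\<bar>u x\<bar> \<le> 1 * \<eta>" unfolding u_single abs_mult
        using \<theta>01 abs_bump_shift_le[OF \<eta>] by (intro mult_mono) auto
      then show ?thesis by simp
    qed
    \<comment> \<open>Such a point is more than 10 * \<eta> from \<open>A\<close>, its midpoint more
      than 9 * \<eta>, beyond the support radius 8 * \<eta> of the cutoff.\<close>
    show "u x = 0" if "x \<notin> U" for x
    proof -
      have "infdist x A > 10 * \<eta>" using room[of x] that by force
      moreover have "infdist x A \<le> infdist (mid \<lfloor>x $ i / \<eta>\<rfloor> x) A + dist x (mid \<lfloor>x $ i / \<eta>\<rfloor> x)" by (rule infdist_triangle)
      ultimately have "2 * (4 * \<eta>) \<le> infdist (mid \<lfloor>x $ i / \<eta>\<rfloor> x) A" using mid_near[of x] \<eta> by (simp add: dist_commute)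
      then show ?thesis unfolding u_single \<theta>_def using cutoff_eq_0[of "4 * \<eta>" "mid \<lfloor>x $ i / \<eta>\<rfloor> x" A] \<eta> by simp
    qed
    show "u (x + t *\<^sub>R e) > u x - t" if t: "t > 0" for x t
    proof -
      let ?y = "x + t *\<^sub>R e" and ?k = "\<lfloor>x $ i / \<eta>\<rfloor>"
      have yi: "?y $ i = x $ i + t" by (simp add: ei)
      have lt: "x $ i < ?y $ i" using t yi by simp
      have "x $ i + u x < ?y $ i + u ?y"
      proof (cases "?k = \<lfloor>?y $ i / \<eta>\<rfloor>")
        case True
        have th: "\<theta> (mid \<lfloor>?y $ i / \<eta>\<rfloor> ?y) = \<theta> (mid ?k x)" unfolding True[symmetric] mid_shift ..
        have sq: "squeeze \<eta> N (x $ i) < squeeze \<eta> N (?y $ i)" by (rule squeeze_strict_mono_cell[OF \<eta> N lt True])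
        show ?thesis
        proof (cases "\<theta> (mid ?k x) = 0")
          case False
          then have "\<theta> (mid ?k x) * squeeze \<eta> N (x $ i) < \<theta> (mid ?k x) * squeeze \<eta> N (?y $ i)"
            using sq \<theta>01 by (simp add: less_le)
          moreover have "(1 - \<theta> (mid ?k x)) * x $ i \<le> (1 - \<theta> (mid ?k x)) * ?y $ i"
            using lt \<theta>01 by (intro mult_left_mono) auto
          ultimately show ?thesis unfolding u_conv th by linarith
        next
          case True
          then show ?thesis unfolding u_conv th using lt by simp
        qed
      next
        case False
        moreover have "?k \<le> \<lfloor>?y $ i / \<eta>\<rfloor>" using lt \<eta> by (intro floor_mono divide_right_mono) auto
        ultimately have "?k + 1 \<le> \<lfloor>?y $ i / \<eta>\<rfloor>" by simp
        then have "of_int (?k + 1) \<le> (of_int \<lfloor>?y $ i / \<eta>\<rfloor> :: real)" by (simp only: of_int_le_iff)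
        then have "(of_int ?k + 1) * \<eta> \<le> of_int \<lfloor>?y $ i / \<eta>\<rfloor> * \<eta>" using \<eta> by (intro mult_right_mono) auto
        then show ?thesis using cell(2)[of x] cell(1)[of ?y] by linarith
      qed
      then show ?thesis using yi by linarith
    qed
  qed
  moreover have "x + u x *\<^sub>R e = x + (squeeze \<eta> N (x $ i) - x $ i) *\<^sub>R axis i 1" if "infdist x A \<le> 3 * \<eta>" for x
  proof -
    have "infdist (mid \<lfloor>x $ i / \<eta>\<rfloor> x) A \<le> 4 * \<eta>"
      using infdist_triangle[of "mid \<lfloor>x $ i / \<eta>\<rfloor> x" A x] mid_near[of x] that by linarith
    then have "\<theta> (mid \<lfloor>x $ i / \<eta>\<rfloor> x) = 1" unfolding \<theta>_def using \<eta> by (intro cutoff_eq_1) auto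
    then show ?thesis using u_conv[of x] by (simp add: e_def)
  qed
  ultimately show ?thesis by (rule that)
qed

text \<open>Each move changes one coordinate only. The earlier moves displace a point of
  \<open>A\<close> by up to 2 * \<eta>, which is why the formula for one coordinate has to hold on a
  whole neighbourhood of \<open>A\<close>.\<close>

lemma push_squeeze:
  fixes A :: "(real ^ 3) set"
  assumes A: "bounded A" "A \<noteq> {}" and \<eta>: "0 < \<eta>" and N: "odd N"
    and room: "\<And>x. infdist x A \<le> 10 * \<eta> \<Longrightarrow> x \<in> U"
  obtains h where "push U (3 * \<eta>) h" "\<And>x i. x \<in> A \<Longrightarrow> h x $ i = squeeze \<eta> N (x $ i)"
proof -
  have "\<exists>h. push U \<eta> h \<and> (\<forall>x. infdist x A \<le> 3 * \<eta> \<longrightarrow> h x = x + (squeeze \<eta> N (x $ i) - x $ i) *\<^sub>R axis i 1)" for i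
    using push_squeeze_coordinate[OF A \<eta> N room, of i] by blast
  then obtain h where h: "\<And>i. push U \<eta> (h i)"
    "\<And>i x. infdist x A \<le> 3 * \<eta> \<Longrightarrow> h i x = x + (squeeze \<eta> N (x $ i) - x $ i) *\<^sub>R axis i 1" by metis
  have near: "infdist (h i x) A \<le> infdist x A + \<eta>" for i x
    using infdist_triangle[of "h i x" A x] push_dist[OF h(1), of i x] by linarith
  have "push U (\<eta> + \<eta> + \<eta>) (h 3 \<circ> (h 2 \<circ> h 1))" by (intro push_compose h)
  then have "push U (3 * \<eta>) (h 3 \<circ> (h 2 \<circ> h 1))" by simp
  moreover have "(h 3 \<circ> (h 2 \<circ> h 1)) x $ i = squeeze \<eta> N (x $ i)" if "x \<in> A" for x i
  proof -
    define y where "y = h 1 x"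
    define z where "z = h 2 y"
    have dx: "infdist x A = 0" using that by simp
    have dy: "infdist y A \<le> \<eta>" using near[of 1 x] dx by (simp add: y_def)
    have dz: "infdist z A \<le> 2 * \<eta>" using near[of 2 y] dy by (simp add: z_def)
    have y: "y = x + (squeeze \<eta> N (x $ 1) - x $ 1) *\<^sub>R axis 1 1" unfolding y_def by (rule h(2)) (use dx \<eta> in simp)
    have z: "z = y + (squeeze \<eta> N (y $ 2) - y $ 2) *\<^sub>R axis 2 1" unfolding z_def by (rule h(2)) (use dy \<eta> in simp)
    have w: "h 3 z = z + (squeeze \<eta> N (z $ 3) - z $ 3) *\<^sub>R axis 3 1" by (rule h(2)) (use dz \<eta> in simp)
    have yc: "y $ 1 = squeeze \<eta> N (x $ 1)" "y $ 2 = x $ 2" "y $ 3 = x $ 3" unfolding y by (simp_all add: axis_def)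
    have zc: "z $ 1 = squeeze \<eta> N (x $ 1)" "z $ 2 = squeeze \<eta> N (x $ 2)" "z $ 3 = x $ 3" unfolding z by (simp_all add: axis_def yc)
    have "h 3 z $ 1 = squeeze \<eta> N (x $ 1)" "h 3 z $ 2 = squeeze \<eta> N (x $ 2)" "h 3 z $ 3 = squeeze \<eta> N (x $ 3)"
      unfolding w by (simp_all add: axis_def zc)
    then have "h 3 z $ i = squeeze \<eta> N (x $ i)" using exhaust_3[of i] by auto
    then show ?thesis by (simp add: z_def y_def)
  qed
  ultimately show ?thesis by (rule that)
qed

text \<open>A finite form of small Hausdorff content with a common radius. Finitely many open balls
  make it stable under small displacements; the common radius allows balls to be counted against a
  grid when the covering dimension is bounded.\<close>

definition small_content :: "real \<Rightarrow> real \<Rightarrow> 'a::metric_space set \<Rightarrow> bool" where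
  "small_content s \<epsilon> A \<longleftrightarrow>
     (\<exists>C r. finite C \<and> 0 < r \<and> r < \<epsilon> \<and> A \<subseteq> (\<Union>c\<in>C. ball c r) \<and> real (card C) * r powr s < \<epsilon>)"

lemma finite_vectors_with_coordinates:
  assumes "finite (S :: 'b set)" shows "finite {a :: 'b ^ 'n::finite. \<forall>i. a $ i \<in> S}"
proof (rule finite_subset)
  show "finite (vec_lambda ` (UNIV \<rightarrow>\<^sub>E S) :: ('b ^ 'n) set)"
    using assms by (intro finite_imageI finite_PiE) auto
  show "{a :: 'b ^ 'n. \<forall>i. a $ i \<in> S} \<subseteq> vec_lambda ` (UNIV \<rightarrow>\<^sub>E S)"
  proof
    fix a :: "'b ^ 'n" assume "a \<in> {a. \<forall>i. a $ i \<in> S}"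
    then show "a \<in> vec_lambda ` (UNIV \<rightarrow>\<^sub>E S)"
      by (intro image_eqI[of _ _ "vec_nth a"]) (auto simp: vec_eq_iff)
  qed
qed

text \<open>Finitely many dual lines matter inside a bounded region. Their \<tau>-neighbourhoods
  need at most M / \<tau> balls of radius 4 * \<tau>, with \<open>M\<close> independent of \<tau>,
  so the content is of order \<tau> to the power s - 1.\<close>

lemma small_content_near_dual_lines:
  assumes \<mu>: "0 < \<mu>" and s: "1 < s" and \<epsilon>: "0 < \<epsilon>"
  obtains \<tau> where "0 < \<tau>"
    "\<And>B :: (real ^ 3) set. (\<And>x. x \<in> B \<Longrightarrow> norm x \<le> R \<and> (\<exists>l. \<forall>i. i \<noteq> l \<longrightarrow> (\<exists>k::int. \<bar>x $ i - (of_int k + 1/2) * \<mu>\<bar> \<le> \<tau>)))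
       \<Longrightarrow> small_content s \<epsilon> B"
proof -
  define R' where "R' = max R 0"
  define K where "K = \<lceil>(R' + 1) / \<mu>\<rceil> + 1"
  \<comment> \<open>A dual line is recorded by a lattice point one of whose coordinates is to be
    overwritten; counting all lattice points in range is generous but finite.\<close>
  define F where "F = {a :: real ^ 3. \<forall>i. a $ i \<in> (\<lambda>k. (of_int k + 1/2) * \<mu>) ` {-K..K}}"
  have finF: "finite F" unfolding F_def by (intro finite_vectors_with_coordinates) auto
  define M where "M = 3 * real (card F) * (2 * R' + 5)"
  have M: "0 \<le> M" by (simp add: M_def R'_def)
  \<comment> \<open>The radius of the balls. The last bound solves y powr (s - 1) = \<epsilon> / (4
    * M + 1), where the summand 1 covers M = 0.\<close>
  define y where "y = min (min 1 (\<epsilon> / 2)) ((\<epsilon> / (4 * M + 1)) powr (1 / (s - 1)))"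
  have y: "0 < y" "y \<le> 1" "y < \<epsilon>" using \<epsilon> M by (auto simp: y_def)
  have "y powr (s - 1) \<le> ((\<epsilon> / (4 * M + 1)) powr (1 / (s - 1))) powr (s - 1)"
    using y(1) s by (intro powr_mono2) (auto simp: y_def)
  also have "\<dots> = \<epsilon> / (4 * M + 1)" using s \<epsilon> M by (simp add: powr_powr)
  finally have "4 * M * y powr (s - 1) \<le> 4 * M * (\<epsilon> / (4 * M + 1))" using M by (intro mult_left_mono) auto
  also have "\<dots> < \<epsilon>" using \<epsilon> M by (simp add: field_simps)
  finally have yM: "4 * M * y powr (s - 1) < \<epsilon>" .
  \<comment> \<open>Three coordinate errors of at most \<tau> add up to a distance of at most 3 *
    \<tau> < y.\<close>
  define \<tau> where "\<tau> = y / 4"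
  have \<tau>: "0 < \<tau>" "\<tau> \<le> 1" using y by (auto simp: \<tau>_def)
  define n0 where "n0 = \<lceil>R' / \<tau>\<rceil> + 1"
  define C where "C = (\<lambda>(l, a, n). (\<chi> i. if i = l then of_int n * \<tau> else a $ i) :: real ^ 3) ` (UNIV \<times> F \<times> {-n0..n0})"
  have finC: "finite C" unfolding C_def using finF by auto
  have n0: "0 \<le> n0" unfolding n0_def using \<tau> by (simp add: R'_def) (smt (verit) divide_nonneg_pos zero_le_ceiling)
  have "card C \<le> card ((UNIV :: 3 set) \<times> F \<times> {-n0..n0})" unfolding C_def using finF by (intro card_image_le) auto
  also have "\<dots> = 3 * (card F * nat (2 * n0 + 1))" by (simp add: card_cartesian_product)
  finally have "real (card C) \<le> 3 * (real (card F) * real_of_int (2 * n0 + 1))" using n0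
    by (metis (mono_tags, lifting) of_nat_le_iff of_nat_mult of_nat_numeral of_nat_nat add_nonneg_nonneg mult_nonneg_nonneg zero_le_numeral zero_le_one)
  also have "real_of_int (2 * n0 + 1) \<le> (2 * R' + 5) / \<tau>"
  proof -
    have "real_of_int n0 \<le> R' / \<tau> + 2" unfolding n0_def by linarith
    then have "real_of_int (2 * n0 + 1) \<le> 2 * (R' / \<tau>) + 5" by simp
    also have "5 \<le> 5 / \<tau>" using \<tau> by (simp add: pos_le_divide_eq)
    finally show ?thesis by (simp add: add_divide_distrib)
  qed
  finally have "real (card C) \<le> M / \<tau>" by (simp add: M_def mult_left_mono)
  then have "real (card C) * y powr s \<le> M / \<tau> * y powr s" by (intro mult_right_mono) auto
  also have "\<dots> = 4 * M * y powr (s - 1)" using y(1) by (simp add: \<tau>_def powr_diff)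
  finally have card: "real (card C) * y powr s < \<epsilon>" using yM by simp
  show ?thesis
  proof (rule that[OF \<tau>(1)])
    fix B :: "(real ^ 3) set"
    assume B: "\<And>x. x \<in> B \<Longrightarrow> norm x \<le> R \<and> (\<exists>l. \<forall>i. i \<noteq> l \<longrightarrow> (\<exists>k::int. \<bar>x $ i - (of_int k + 1/2) * \<mu>\<bar> \<le> \<tau>))"
    have "B \<subseteq> (\<Union>c\<in>C. ball c y)"
    proof
      fix x assume "x \<in> B"
      then obtain l k where nx: "norm x \<le> R" and k: "\<And>i. i \<noteq> l \<Longrightarrow> \<bar>x $ i - (of_int (k i) + 1/2) * \<mu>\<bar> \<le> \<tau>"
        using B by metis
      have xi: "\<bar>x $ i\<bar> \<le> R'" for i using component_le_norm_cart[of x i] nx by (simp add: R'_def)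
      \<comment> \<open>Coordinate \<open>l\<close> of the lattice point is overwritten in
        \<open>c\<close>, so any value in range serves there.\<close>
      define k' where "k' i = (if i = l then 0 else k i)" for i
      define a :: "real ^ 3" where "a = (\<chi> i. (of_int (k' i) + 1/2) * \<mu>)"
      define n where "n = \<lfloor>x $ l / \<tau>\<rfloor>"
      have R0: "0 \<le> (R' + 1) / \<mu>" using \<mu> by (simp add: R'_def)
      have "k' i \<in> {-K..K}" for i
      proof (cases "i = l")
        case True
        then show ?thesis using R0 by (simp add: k'_def K_def) linarith
      next
        case False
        have "\<bar>(of_int (k i) + 1/2) * \<mu>\<bar> \<le> R' + 1" using k[OF False] xi[of i] \<tau> by linarith
        then have "\<bar>of_int (k i) + 1/2\<bar> \<le> (R' + 1) / \<mu>" using \<mu> by (simp add: abs_mult pos_le_divide_eq)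
        then have "\<bar>of_int (k i)\<bar> \<le> (R' + 1) / \<mu> + 1" by linarith
        also have "\<dots> \<le> of_int K" unfolding K_def by linarith
        finally have "\<bar>k i\<bar> \<le> K" by linarith
        then show ?thesis using False by (simp add: k'_def abs_le_iff)
      qed
      then have "a \<in> F" unfolding F_def a_def by auto
      have "x $ l / \<tau> \<le> R' / \<tau>" "(- R') / \<tau> \<le> x $ l / \<tau>"
        using xi[of l] \<tau> by (intro divide_right_mono; linarith)+
      then have "n \<in> {-n0..n0}" unfolding n_def n0_def atLeastAtMost_iff minus_divide_left[symmetric] by linarith
      define c :: "real ^ 3" where "c = (\<chi> i. if i = l then of_int n * \<tau> else a $ i)"
      have "c \<in> C" unfolding C_def c_def using \<open>a \<in> F\<close> \<open>n \<in> {-n0..n0}\<close>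
        by (intro image_eqI[of _ _ "(l, a, n)"]) auto
      have "\<bar>(c - x) $ i\<bar> \<le> \<tau>" for i
      proof (cases "i = l")
        case True
        have "of_int n \<le> x $ l / \<tau>" "x $ l / \<tau> < of_int n + 1" unfolding n_def by linarith+
        then have "of_int n * \<tau> \<le> x $ l" "x $ l < (of_int n + 1) * \<tau>"
          unfolding pos_le_divide_eq[OF \<tau>(1)] pos_divide_less_eq[OF \<tau>(1)] .
        then have "\<bar>of_int n * \<tau> - x $ l\<bar> \<le> \<tau>" unfolding distrib_right by linarith
        then show ?thesis using True by (simp add: c_def)
      next
        case False
        then show ?thesis using k[OF False] by (simp add: c_def a_def k'_def abs_minus_commute)
      qed
      then have "(\<Sum>i\<in>UNIV. \<bar>(c - x) $ i\<bar>) \<le> (\<Sum>i\<in>(UNIV::3 set). \<tau>)" by (intro sum_mono)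
      then have "norm (c - x) \<le> 3 * \<tau>" using norm_le_l1_cart[of "c - x"] by simp
      also have "\<dots> < y" using y by (simp add: \<tau>_def)
      finally show "x \<in> (\<Union>c\<in>C. ball c y)" using \<open>c \<in> C\<close> by (auto simp: dist_norm)
    qed
    then show "small_content s \<epsilon> B" unfolding small_content_def using finC y card by blast
  qed
qed

text \<open>The order of choices matters: the mesh \<mu> determines the dual lines and thereby
  \<tau>, pushing off the grid determines the gap \<kappa>, and only then is the exponent
  \<open>N\<close> chosen.\<close>

lemma push_to_small_content:
  fixes A :: "(real ^ 3) set"
  assumes A: "thin A" "A \<noteq> {}" "A \<subseteq> U" and U: "open U" "bounded U" and s: "1 < s" and \<epsilon>: "0 < \<epsilon>" and \<eta>: "0 < \<eta>"
  obtains h where "push U \<eta> h" "small_content s \<epsilon> (h ` A)"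
proof -
  have cA: "compact A" using A(1) by (simp add: thin_def)
  obtain \<rho> where \<rho>: "\<rho> > 0" "\<And>x. infdist x A \<le> \<rho> \<Longrightarrow> x \<in> U"
    using compact_in_open_infdist[OF cA A(2) U(1) A(3)] by blast
  \<comment> \<open>Moves of \<mu> and 3 * \<mu> must fit into \<eta>. Squeezing needs room 10 *
    \<mu> around the pushed set, hence 11 * \<mu> around \<open>A\<close>.\<close>
  define \<mu> where "\<mu> = min (\<eta> / 8) (\<rho> / 14)"
  have \<mu>: "0 < \<mu>" "4 * \<mu> \<le> \<eta>" "11 * \<mu> \<le> \<rho>" using \<eta> \<rho>(1) by (auto simp: \<mu>_def)
  have r3: "x \<in> U" if "infdist x A \<le> 3 * \<mu>" for x using that \<mu> by (intro \<rho>(2)) linarith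
  obtain h where h: "push U \<mu> h" "\<And>x l. x \<in> h ` A \<Longrightarrow> \<exists>i. i \<noteq> l \<and> x $ i / \<mu> \<notin> \<int>"
    using push_off_grid[OF A U(1) \<mu>(1) order_refl r3] by blast
  let ?B = "h ` A"
  have cB: "compact ?B" using cA push_continuous[OF h(1)] by (intro compact_continuous_image)
  obtain \<kappa>0 where \<kappa>0: "0 < \<kappa>0" "\<And>x. x \<in> ?B \<Longrightarrow> \<exists>l. \<forall>i. i \<noteq> l \<longrightarrow> \<kappa>0 \<le> infdist (x $ i / \<mu>) \<int>"
    using compact_grid_gap[OF cB h(2)] by blast
  \<comment> \<open>The cap 1/4 keeps 1 - 2 * \<kappa> nonnegative, so that its powers
    decrease.\<close>
  define \<kappa> where "\<kappa> = min \<kappa>0 (1/4)"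
  have \<kappa>: "0 < \<kappa>" "\<kappa> \<le> 1/4" "\<kappa> \<le> \<kappa>0" using \<kappa>0(1) by (auto simp: \<kappa>_def)
  obtain R where R: "\<And>x. x \<in> U \<Longrightarrow> norm x \<le> R" using U(2) unfolding bounded_iff by blast
  obtain \<tau> where \<tau>: "0 < \<tau>" "\<And>B :: (real ^ 3) set. (\<And>x. x \<in> B \<Longrightarrow> norm x \<le> R \<and>
      (\<exists>l. \<forall>i. i \<noteq> l \<longrightarrow> (\<exists>k::int. \<bar>x $ i - (of_int k + 1/2) * \<mu>\<bar> \<le> \<tau>))) \<Longrightarrow> small_content s \<epsilon> B"
    using small_content_near_dual_lines[OF \<mu>(1) s \<epsilon>] by blast
  have q: "0 \<le> 1 - 2 * \<kappa>" "1 - 2 * \<kappa> < 1" using \<kappa> by auto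
  obtain n where n: "(1 - 2 * \<kappa>) ^ n < \<tau> / (\<mu> / 2)"
    using real_arch_pow_inv[OF _ q(2), of "\<tau> / (\<mu> / 2)"] \<tau>(1) \<mu>(1) by auto
  define N where "N = 2 * n + 1"
  have "(1 - 2 * \<kappa>) ^ N \<le> (1 - 2 * \<kappa>) ^ n" using q by (intro power_decreasing) (auto simp: N_def)
  then have "(1 - 2 * \<kappa>) ^ N \<le> \<tau> / (\<mu> / 2)" using n by linarith
  then have N\<tau>: "\<mu> / 2 * (1 - 2 * \<kappa>) ^ N \<le> \<tau>" using \<mu>(1) by (simp add: pos_le_divide_eq mult.commute)
  have "odd N" by (simp add: N_def)
  have r10: "x \<in> U" if "infdist x ?B \<le> 10 * \<mu>" for x
  proof -
    obtain b where b: "b \<in> ?B" "infdist x ?B = dist x b"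
      using infdist_attains_inf[of ?B x] cB compact_imp_closed A(2) by blast
    then obtain a where a: "a \<in> A" "b = h a" by blast
    have "infdist x A \<le> dist x a" using a(1) by (rule infdist_le)
    also have "\<dots> \<le> dist x b + dist b a" by (rule dist_triangle)
    also have "\<dots> \<le> 11 * \<mu>" using that b(2) push_dist[OF h(1), of a] unfolding a(2) by linarith
    also have "\<dots> \<le> \<rho>" by (rule \<mu>(3))
    finally show ?thesis by (rule \<rho>(2))
  qed
  obtain g where g: "push U (3 * \<mu>) g" "\<And>x i. x \<in> ?B \<Longrightarrow> g x $ i = squeeze \<mu> N (x $ i)"
    using push_squeeze[OF compact_imp_bounded[OF cB] _ \<mu>(1) \<open>odd N\<close> r10] A(2) by blast
  have "push U \<eta> (g \<circ> h)" by (rule push_mono[OF push_compose[OF h(1) g(1)]]) (use \<mu> in simp)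
  moreover have "small_content s \<epsilon> ((g \<circ> h) ` A)"
  proof (rule \<tau>(2))
    fix y assume y: "y \<in> (g \<circ> h) ` A"
    then obtain x where x: "x \<in> ?B" "y = g x" by auto
    have "y \<in> U" using x push_image_subset[OF h(1) A(3)] push_in[OF g(1)] by blast
    obtain l where l: "\<And>i. i \<noteq> l \<Longrightarrow> \<kappa>0 \<le> infdist (x $ i / \<mu>) \<int>" using \<kappa>0(2)[OF x(1)] by blast
    have "\<exists>k::int. \<bar>y $ i - (of_int k + 1/2) * \<mu>\<bar> \<le> \<tau>" if "i \<noteq> l" for i
    proof
      have "\<kappa> \<le> infdist (x $ i / \<mu>) \<int>" using l[OF that] \<kappa> by linarith
      from squeeze_near_centre[OF \<mu>(1) this, of N] N\<tau>
      show "\<bar>y $ i - (of_int \<lfloor>x $ i / \<mu>\<rfloor> + 1/2) * \<mu>\<bar> \<le> \<tau>"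
        unfolding cell_centre_def x(2) g(2)[OF x(1)] by linarith
    qed
    then show "norm y \<le> R \<and> (\<exists>l. \<forall>i. i \<noteq> l \<longrightarrow> (\<exists>k::int. \<bar>y $ i - (of_int k + 1/2) * \<mu>\<bar> \<le> \<tau>))"
      using R[OF \<open>y \<in> U\<close>] by blast
  qed
  ultimately show ?thesis by (rule that)
qed

section \<open>Hausdorff and covering dimension\<close>

lemma small_content_mono: "small_content s \<epsilon> A \<Longrightarrow> s \<le> s' \<Longrightarrow> \<epsilon> \<le> \<epsilon>' \<Longrightarrow> \<epsilon> \<le> 1 \<Longrightarrow> small_content s' \<epsilon>' A"
proof -
  assume a: "small_content s \<epsilon> A" "s \<le> s'" "\<epsilon> \<le> \<epsilon>'" "\<epsilon> \<le> 1"
  then obtain C r where C: "finite C" "0 < r" "r < \<epsilon>" "A \<subseteq> (\<Union>c\<in>C. ball c r)" "real (card C) * r powr s < \<epsilon>"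
    unfolding small_content_def by blast
  have "r powr s' \<le> r powr s" using C a by (intro powr_mono') auto
  then have "real (card C) * r powr s' \<le> real (card C) * r powr s" by (intro mult_left_mono) auto
  with C a(3) show ?thesis unfolding small_content_def by (intro exI[of _ C] exI[of _ r]) auto
qed

lemma hausdorff_measure_eq_0:
  fixes X :: "'a::euclidean_space set"
  assumes sc: "\<And>n::nat. small_content (1 + 1 / Suc n) (1 / Suc n) X" and s: "1 < s"
  shows "hausdorff_measure s X = 0"
proof -
  have pre: "hausdorff_premeasure s \<delta> X \<le> ennreal e" if \<delta>: "0 < \<delta>" and e: "0 < e" for \<delta> e
  proof -
    \<comment> \<open>A ball of radius r has diameter 2 * r, which costs the factor 2 powr s; the
      bound s - 1 brings the exponent 1 + 1 / Suc n below s.\<close>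
    define \<epsilon> where "\<epsilon> = min (min (\<delta> / 2) (e / 2 powr s)) (s - 1)"
    have "0 < \<epsilon>" using \<delta> e s by (simp add: \<epsilon>_def)
    then obtain n where n: "1 / Suc n < \<epsilon>" using nat_approx_posE by blast
    have "small_content s \<epsilon> X"
      by (rule small_content_mono[OF sc[of n]]) (use n in \<open>auto simp: \<epsilon>_def\<close>)
    then obtain C r where C: "finite C" "0 < r" "r < \<epsilon>" "X \<subseteq> (\<Union>c\<in>C. ball c r)" "real (card C) * r powr s < \<epsilon>"
      unfolding small_content_def by blast
    obtain cs where cs: "set cs = C" "distinct cs" using finite_distinct_list[OF C(1)] by blast
    have len: "length cs = card C" using distinct_card[OF cs(2)] cs(1) by simp
    define E where "E i = (if i < length cs then ball (cs ! i) r else {})" for i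
    have "X \<subseteq> (\<Union>i. E i)"
    proof
      fix x assume "x \<in> X"
      then obtain c where "c \<in> C" "x \<in> ball c r" using C(4) by blast
      then obtain i where "i < length cs" "cs ! i = c" using cs(1) by (metis in_set_conv_nth)
      then show "x \<in> (\<Union>i. E i)" using \<open>x \<in> ball c r\<close> by (intro UN_I[of i]) (auto simp: E_def)
    qed
    moreover have "bounded (E i) \<and> diameter (E i) \<le> \<delta>" for i
      using C(2,3) \<delta> by (auto simp: E_def \<epsilon>_def diameter_ball)
    ultimately have "hausdorff_premeasure s \<delta> X \<le> (\<Sum>i. hausdorff_weight s (E i))"
      unfolding hausdorff_premeasure_def by (intro INF_lower) auto
    also have "\<dots> = (\<Sum>i<length cs. hausdorff_weight s (E i))"
      by (intro suminf_finite) (auto simp: E_def hausdorff_weight_def)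
    also have "\<dots> = (\<Sum>i<length cs. ennreal ((2 * r) powr s))"
      using C(2) s by (intro sum.cong refl) (auto simp: E_def hausdorff_weight_def diameter_ball)
    also have "\<dots> = ennreal (real (card C) * (2 * r) powr s)"
      by (simp add: len ennreal_of_nat_eq_real_of_nat ennreal_mult)
    also have "\<dots> \<le> ennreal e"
    proof (rule ennreal_leI)
      have "real (card C) * (2 * r) powr s = 2 powr s * (real (card C) * r powr s)"
        using C(2) by (simp add: powr_mult)
      also have "\<dots> \<le> 2 powr s * (e / 2 powr s)" using C(5) by (intro mult_left_mono) (auto simp: \<epsilon>_def)
      finally show "real (card C) * (2 * r) powr s \<le> e" by simp
    qed
    finally show ?thesis .
  qed
  have "hausdorff_premeasure s \<delta> X \<le> 0" if "0 < \<delta>" for \<delta>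
  proof (rule ennreal_le_epsilon)
    fix e :: real assume "0 < e"
    from pre[OF that this] show "hausdorff_premeasure s \<delta> X \<le> 0 + ennreal e" by simp
  qed
  then show ?thesis unfolding hausdorff_measure_def by (intro antisym SUP_least) auto
qed

lemma ereal_le_of_forall_gt:
  assumes "\<And>s::real. c < s \<Longrightarrow> x \<le> ereal s" shows "x \<le> ereal c"
proof (rule ccontr)
  assume "\<not> ?thesis"
  then obtain s where "ereal c < ereal s" "ereal s < x" using ereal_dense2[of "ereal c" x] by force
  then show False using assms[of s] by auto
qed

lemma hausdorff_dim_le_1:
  fixes X :: "'a::euclidean_space set"
  assumes "\<And>n::nat. small_content (1 + 1 / Suc n) (1 / Suc n) X"
  shows "hausdorff_dim X \<le> 1"
proof -
  have "hausdorff_dim X \<le> ereal s" if "1 < s" for s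
    unfolding hausdorff_dim_def using hausdorff_measure_eq_0[OF assms that] that by (intro Inf_lower) auto
  from ereal_le_of_forall_gt[OF this] show ?thesis by (simp add: one_ereal_def)
qed

text \<open>The distance from \<open>a\<close> is 1-Lipschitz and its values on \<open>X\<close>
  fill [0, d]. So a cover of \<open>X\<close> yields intervals of total length at least d, whereas
  for s < 1 and diameters at most 1 every weight dominates the diameter.\<close>

lemma hausdorff_dim_ge_1:
  fixes X :: "'a::euclidean_space set"
  assumes X: "connected X" "a \<in> X" "b \<in> X" "a \<noteq> b"
  shows "1 \<le> hausdorff_dim X"
proof -
  have "1 \<le> s" if s: "0 \<le> s" "hausdorff_measure s X = 0" for s
  proof (rule ccontr)
    assume "\<not> 1 \<le> s"
    define d where "d = dist a b"
    have d: "0 < d" using X by (simp add: d_def)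
    have "hausdorff_premeasure s 1 X \<le> hausdorff_measure s X"
      unfolding hausdorff_measure_def by (intro SUP_upper) auto
    then have "hausdorff_premeasure s 1 X < ennreal d" using s d by simp
    then obtain E :: "nat \<Rightarrow> 'a set" where E: "X \<subseteq> (\<Union>i. E i)" "\<And>i. bounded (E i)" "\<And>i. diameter (E i) \<le> 1"
      "(\<Sum>i. hausdorff_weight s (E i)) < ennreal d"
      unfolding hausdorff_premeasure_def INF_less_iff by auto
    have w: "ennreal (diameter (E i)) \<le> hausdorff_weight s (E i)" for i
    proof -
      have "diameter (E i) \<le> diameter (E i) powr s" if "s \<noteq> 0"
      proof (cases "diameter (E i) = 0")
        case False
        then have "0 < diameter (E i)" using diameter_ge_0[OF E(2), of i] by simp
        then have "diameter (E i) powr 1 \<le> diameter (E i) powr s"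
          using E(3)[of i] \<open>\<not> 1 \<le> s\<close> by (intro powr_mono') auto
        then show ?thesis using \<open>0 < diameter (E i)\<close> by simp
      qed simp
      then show ?thesis using E(3)[of i]
        by (auto simp: hausdorff_weight_def intro!: ennreal_leI)
    qed
    define I where "I i = (if E i = {} then {} else cbox (Inf (dist a ` E i)) (Sup (dist a ` E i)))" for i
    have bdd: "bounded (dist a ` E i)" for i
    proof -
      obtain M where "\<forall>y\<in>E i. dist a y \<le> M" using E(2)[of i] bounded_any_center[of "E i" a] by blast
      then show ?thesis by (intro boundedI[of _ M]) auto
    qed
    have cov: "dist a ` X \<subseteq> (\<Union>i. I i)"
    proof
      fix t assume "t \<in> dist a ` X"
      then obtain x i where x: "t = dist a x" "x \<in> E i" using E(1) by blast
      then have "t \<in> dist a ` E i" by blast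
      then have "t \<in> I i" using bdd[of i] x(2) unfolding I_def
        by (auto intro: cInf_lower cSup_upper bounded_imp_bdd_above bounded_imp_bdd_below)
      then show "t \<in> (\<Union>i. I i)" by blast
    qed
    have "{0..d} \<subseteq> dist a ` X"
    proof -
      have "connected (dist a ` X)" using X(1) by (intro connected_continuous_image continuous_intros)
      moreover have "0 \<in> dist a ` X" "d \<in> dist a ` X" using X by (auto simp: d_def image_iff)
      ultimately show ?thesis by (rule connected_contains_Icc)
    qed
    then have sub: "{0..d} \<subseteq> (\<Union>i. I i)" using cov by (rule order_trans)
    have mI: "I i \<in> sets lborel" for i by (simp add: I_def)
    have eI: "emeasure lborel (I i) \<le> ennreal (diameter (E i))" for i
    proof (cases "E i = {}")
      case False
      have ne: "dist a ` E i \<noteq> {}" using False by blast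
      have "Sup (dist a ` E i) - Inf (dist a ` E i) \<le> diameter (E i)"
      proof -
        have "Sup (dist a ` E i) \<le> Inf (dist a ` E i) + diameter (E i)"
        proof (rule cSup_least[OF ne])
          fix t assume "t \<in> dist a ` E i"
          then obtain x where x: "x \<in> E i" "t = dist a x" by blast
          have "t - diameter (E i) \<le> Inf (dist a ` E i)"
          proof (rule cInf_greatest[OF ne])
            fix u assume "u \<in> dist a ` E i"
            then obtain y where y: "y \<in> E i" "u = dist a y" by blast
            have "dist x y \<le> diameter (E i)" using diameter_bounded_bound[OF E(2) x(1) y(1)] .
            then show "t - diameter (E i) \<le> u" using dist_triangle[of a x y] x(2) y(2) by (simp add: dist_commute)
          qed
          then show "t \<le> Inf (dist a ` E i) + diameter (E i)" by simp
        qed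
        then show ?thesis by simp
      qed
      moreover have "Inf (dist a ` E i) \<le> Sup (dist a ` E i)"
        using ne bdd[of i] by (intro cInf_le_cSup bounded_imp_bdd_above bounded_imp_bdd_below)
      ultimately show ?thesis using False by (simp add: I_def ennreal_leI)
    qed (simp add: I_def)
    have "ennreal d = emeasure lborel {0..d}" using d by simp
    also have "\<dots> \<le> emeasure lborel (\<Union>i. I i)" using sub mI by (intro emeasure_mono sets.countable_UN) auto
    also have "\<dots> \<le> (\<Sum>i. emeasure lborel (I i))" using mI by (intro emeasure_subadditive_countably) auto
    also have "\<dots> \<le> (\<Sum>i. hausdorff_weight s (E i))"
      using order_trans[OF eI w] by (intro suminf_le summableI) auto
    also have "\<dots> < ennreal d" by (rule E(4))
    finally show False by simp
  qed
  then show ?thesis unfolding hausdorff_dim_def by (intro Inf_greatest) (auto simp: one_ereal_def)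
qed

section \<open>Bounds for the covering dimension\<close>

lemma covering_dim_ge_1:
  fixes X :: "'a::t1_space set"
  assumes X: "connected X" "a \<in> X" "b \<in> X" "a \<noteq> b"
  shows "1 \<le> covering_dim (top_of_set X)"
proof -
  have "1 \<le> n" if n: "-1 \<le> n" "covering_dim_le (top_of_set X) n" for n
  proof (rule ccontr)
    assume "\<not> 1 \<le> n"
    \<comment> \<open>For n \<le> 0 the members of a refinement are pairwise disjoint open sets.
      Connectedness makes the one containing \<open>a\<close> all of \<open>X\<close>, but no member
      of this cover contains \<open>X\<close>.\<close>
    let ?\<U> = "{X - {a}, X - {b}}"
    have "finite ?\<U> \<and> (\<forall>A\<in>?\<U>. openin (top_of_set X) A) \<and> \<Union>?\<U> = topspace (top_of_set X)"
      using X by (auto intro: openin_delete)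
    from n(2)[unfolded covering_dim_le_def, THEN spec, THEN mp, OF this]
    obtain \<V> where "finite \<V> \<and> (\<forall>B\<in>\<V>. openin (top_of_set X) B) \<and> \<Union>\<V> = topspace (top_of_set X) \<and>
        (\<forall>B\<in>\<V>. \<exists>A\<in>?\<U>. B \<subseteq> A) \<and> (\<forall>x\<in>topspace (top_of_set X). int (card {B\<in>\<V>. x \<in> B}) \<le> n + 1)"
      by (rule exE)
    then have \<V>: "finite \<V>" "\<And>B. B \<in> \<V> \<Longrightarrow> openin (top_of_set X) B" "\<Union>\<V> = X"
      "\<And>B. B \<in> \<V> \<Longrightarrow> \<exists>A\<in>?\<U>. B \<subseteq> A" "\<And>x. x \<in> X \<Longrightarrow> int (card {B \<in> \<V>. x \<in> B}) \<le> n + 1"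
      by simp_all
    obtain B where B: "B \<in> \<V>" "a \<in> B" using \<V>(3) X(2) by blast
    let ?W = "\<Union>(\<V> - {B})"
    have disj: "B \<inter> ?W = {}"
    proof (rule ccontr)
      assume "B \<inter> ?W \<noteq> {}"
      then obtain x B' where x: "x \<in> B" "x \<in> B'" "B' \<in> \<V>" "B' \<noteq> B" by blast
      have "x \<in> X" using x \<V>(3) by blast
      have "{B, B'} \<subseteq> {B \<in> \<V>. x \<in> B}" using x B by blast
      then have "card {B, B'} \<le> card {B \<in> \<V>. x \<in> B}" using \<V>(1) by (intro card_mono) auto
      then show False using \<V>(5)[OF \<open>x \<in> X\<close>] \<open>\<not> 1 \<le> n\<close> x(4) by simp
    qed
    have "openin (top_of_set X) ?W" using \<V>(2) by (intro openin_Union) blast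
    moreover have "X \<subseteq> B \<union> ?W" using \<V>(3) by blast
    ultimately have "?W = {}" 
      using X(1) \<V>(2)[OF B(1)] disj B(2) unfolding connected_openin by blast
    then have "B = X" using \<V>(3) B(1) by blast
    then show False using \<V>(4)[OF B(1)] X(2,3) by auto
  qed
  then show ?thesis unfolding covering_dim_def by (intro Inf_greatest) (auto simp: one_ereal_def)
qed

text \<open>Here \<open>a\<close> encodes a translate of a grid modulo its period and
  \<open>q p\<close> the position of a ball; they are to differ in at least two coordinates. For
  each ball and each \<open>l\<close> at most \<open>M\<close> translates agree with it in both
  other coordinates, so 3 * card C * M < M^3 leaves one over.\<close>

lemma residues_avoiding_two_coordinates:
  fixes q :: "'c \<Rightarrow> 3 \<Rightarrow> int"
  assumes C: "finite C" and M: "3 * card C < M ^ 2"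
  obtains a :: "3 \<Rightarrow> int" where "\<And>p l. p \<in> C \<Longrightarrow> \<exists>i. i \<noteq> l \<and> q p i mod int M \<noteq> a i" "\<And>i. a i mod int M = a i"
proof -
  have M0: "0 < M" using M by (cases M) auto
  define P where "P = ((UNIV :: 3 set) \<rightarrow>\<^sub>E {0..<int M})"
  define bad where "bad = (\<lambda>(p, l). {a \<in> P. \<forall>i. i \<noteq> l \<longrightarrow> q p i mod int M = a i})"
  have cP: "card P = M ^ 3" "finite P" unfolding P_def by (simp_all add: card_PiE finite_PiE)
  have cb: "card (bad z) \<le> M" for z
  proof -
    obtain p l where z: "z = (p, l)" by (cases z)
    have "inj_on (\<lambda>a. a l) (bad z)"
    proof (rule inj_onI)
      fix a b assume ab: "a \<in> bad z" "b \<in> bad z" "a l = b l"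
      show "a = b"
      proof
        fix i show "a i = b i" using ab by (cases "i = l") (auto simp: bad_def z)
      qed
    qed
    moreover have "(\<lambda>a. a l) ` bad z \<subseteq> {0..<int M}" by (auto simp: bad_def z P_def PiE_iff)
    ultimately have "card (bad z) \<le> card {0..<int M}" by (intro card_inj_on_le) auto
    then show ?thesis by simp
  qed
  have fin: "finite (C \<times> (UNIV :: 3 set))" using C by simp
  have "card (\<Union>z\<in>C \<times> (UNIV::3 set). bad z) \<le> (\<Sum>z\<in>C \<times> (UNIV :: 3 set). card (bad z))"
    using fin by (rule card_UN_le)
  also have "\<dots> \<le> (\<Sum>z\<in>C \<times> (UNIV :: 3 set). M)" using cb by (intro sum_mono)
  also have "\<dots> = 3 * card C * M" by (simp add: card_cartesian_product)
  also have "\<dots> < M ^ 2 * M" using M M0 by (intro mult_strict_right_mono) auto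
  also have "\<dots> = card P" by (simp add: cP power3_eq_cube power2_eq_square)
  finally have "\<not> P \<subseteq> (\<Union>z\<in>C \<times> (UNIV::3 set). bad z)"
    using card_mono[of "\<Union>z\<in>C \<times> (UNIV::3 set). bad z" P] fin cP(2)
    by (metis (no_types, lifting) bad_def case_prod_unfold finite_UN finite_subset mem_Collect_eq not_le subsetI)
  then obtain a where a: "a \<in> P" "a \<notin> (\<Union>z\<in>C \<times> (UNIV::3 set). bad z)" by blast
  show ?thesis
  proof (rule that[of a])
    fix p l assume "p \<in> C"
    then have "a \<notin> bad (p, l)" using a(2) by blast
    then show "\<exists>i. i \<noteq> l \<and> q p i mod int M \<noteq> a i" using a(1) unfolding bad_def by auto
  next
    show "a i mod int M = a i" for i using a(1) by (auto simp: P_def PiE_iff)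
  qed
qed

text \<open>
  Pigeonhole: with \<open>\<eta> = 4rM\<close>, each ball of the cover excludes at most \<open>3M\<close> of the \<open>M\<^sup>3\<close> translates of the
  grid by multiples of \<open>4r\<close>.
\<close>

lemma exists_translated_grid:
  fixes X :: "(real ^ 3) set"
  assumes \<eta>0: "0 < \<eta>0" and sc: "small_content 2 (min (\<eta>0 / 8) (\<eta>0\<^sup>2 / 192)) X"
  obtains c :: "real ^ 3" and r \<eta> where "0 < r" "4 * r \<le> \<eta>" "\<eta> \<le> \<eta>0"
    "\<And>x. x \<in> X \<Longrightarrow> \<exists>l. \<forall>i. i \<noteq> l \<longrightarrow> (\<forall>k::int. r \<le> \<bar>x $ i - (c $ i + of_int k * \<eta>)\<bar>)"
proof -
  obtain C r where C: "finite C" "0 < r" "r < \<eta>0 / 8" "X \<subseteq> (\<Union>p\<in>C. ball p r)" "real (card C) * r powr 2 < \<eta>0\<^sup>2 / 192"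
    using sc unfolding small_content_def by auto
  \<comment> \<open>The mesh measured in steps of 4 * r. The bound \<eta>0 / 8 on r gives t > 2, so
    its integer part exceeds t / 2; and 192 = 3 * 64 turns the content bound into 3 * card C < (t /
    2)^2.\<close>
  define t where "t = \<eta>0 / (4 * r)"
  have pos: "2 < t" using C(2,3) by (simp add: t_def pos_less_divide_eq)
  define M where "M = nat \<lfloor>t\<rfloor>"
  have "of_int \<lfloor>t\<rfloor> = real M" using pos by (simp add: M_def)
  then have M: "real M \<le> t" "t < real M + 1" by linarith+
  have "t / 2 < real M" using M(2) pos by linarith
  then have "(t / 2)\<^sup>2 < (real M)\<^sup>2" using pos by (intro power_strict_mono) auto
  then have "\<eta>0\<^sup>2 / (64 * r\<^sup>2) < (real M)\<^sup>2" by (simp add: t_def power_divide power_mult_distrib)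
  moreover have "3 * real (card C) < \<eta>0\<^sup>2 / (64 * r\<^sup>2)"
    using C(2,5) by (simp add: pos_less_divide_eq powr_numeral)
  ultimately have "real (3 * card C) < real (M ^ 2)" by simp
  then have M3: "3 * card C < M ^ 2" by (simp only: of_nat_less_iff)
  have "1 \<le> real M" using M(2) pos by linarith
  \<comment> \<open>The index of a multiple of 4 * r nearest to the coordinate.\<close>
  define q where "q p i = \<lfloor>p $ i / (4 * r) + 1/2\<rfloor>" for p :: "real ^ 3" and i
  obtain a where a: "\<And>p l. p \<in> C \<Longrightarrow> \<exists>i. i \<noteq> l \<and> q p i mod int M \<noteq> a i" "\<And>i. a i mod int M = a i"
    using residues_avoiding_two_coordinates[OF C(1) M3] by metis
  define c :: "real ^ 3" where "c = (\<chi> i. 4 * r * of_int (a i))"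
  define \<eta> where "\<eta> = 4 * r * real M"
  \<comment> \<open>Were \<open>x\<close> within \<open>r\<close> of such a plane, the centre
    \<open>p\<close> would be within 2 * r of the multiple of 4 * r with index a i + k * M. This
    would be its nearest multiple, and the residues would agree.\<close>
  have good: "r \<le> \<bar>x $ i - (c $ i + of_int k * \<eta>)\<bar>" if x: "x \<in> ball p r" and i: "q p i mod int M \<noteq> a i" for x p i k
  proof (rule ccontr)
    assume "\<not> ?thesis"
    moreover have "\<bar>x $ i - p $ i\<bar> < r"
      using component_le_norm_cart[of "x - p" i] x by (simp add: dist_norm norm_minus_commute)
    moreover have "c $ i + of_int k * \<eta> = 4 * r * of_int (a i + k * int M)" by (simp add: c_def \<eta>_def algebra_simps)
    ultimately have "\<bar>p $ i - 4 * r * of_int (a i + k * int M)\<bar> < 2 * r" by linarith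
    then have "p $ i < (of_int (a i + k * int M) + 1/2) * (4 * r)" "(of_int (a i + k * int M) - 1/2) * (4 * r) < p $ i"
      by (auto simp: algebra_simps abs_less_iff)
    then have "p $ i / (4 * r) < of_int (a i + k * int M) + 1/2" "of_int (a i + k * int M) - 1/2 < p $ i / (4 * r)"
      using C(2) by (simp_all only: pos_divide_less_eq pos_less_divide_eq mult_pos_pos zero_less_numeral)
    then have "q p i = a i + k * int M" unfolding q_def by linarith
    then show False using i a(2) by simp
  qed
  show ?thesis
  proof (rule that[of r \<eta> c])
    show "4 * r \<le> \<eta>" using \<open>1 \<le> real M\<close> C(2) by (simp add: \<eta>_def)
    show "\<eta> \<le> \<eta>0" using M(1) C(2) by (simp add: \<eta>_def t_def pos_le_divide_eq mult.commute)
    fix x assume "x \<in> X"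
    then obtain p where p: "p \<in> C" "x \<in> ball p r" using C(4) by blast
    obtain i where i: "q p i mod int M \<noteq> a i" using a(1)[OF p(1)] by blast
    obtain j where j: "j \<noteq> i" "q p j mod int M \<noteq> a j" using a(1)[OF p(1), of i] by blast
    obtain l where l: "\<And>m. m = i \<or> m = j \<or> m = l" using third_index_3[of i j] j(1) by metis
    have "\<forall>k::int. r \<le> \<bar>x $ m - (c $ m + of_int k * \<eta>)\<bar>" if "m \<noteq> l" for m
      using l[of m] that good[OF p(2) i] good[OF p(2) j(2)] by auto
    then show "\<exists>l. \<forall>i. i \<noteq> l \<longrightarrow> (\<forall>k::int. r \<le> \<bar>x $ i - (c $ i + of_int k * \<eta>)\<bar>)" by blast
  qed (rule C(2))
qed

text \<open>
  Off the \<open>1\<close>-skeleton of a grid every point lies in at most two of the closed cubes, and this persists for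
  slightly thickened cubes.
\<close>

lemma covering_dim_le_1:
  fixes X :: "(real ^ 3) set"
  assumes X: "compact X" and sc: "\<And>n::nat. small_content (1 + 1 / Suc n) (1 / Suc n) X"
  shows "covering_dim (top_of_set X) \<le> 1"
proof -
  have "covering_dim_le (top_of_set X) 1"
    unfolding covering_dim_le_def
  proof (intro allI impI)
    fix \<U> assume \<U>: "finite \<U> \<and> (\<forall>A\<in>\<U>. openin (top_of_set X) A) \<and> \<Union>\<U> = topspace (top_of_set X)"
    define \<G> where "\<G> = {T. open T \<and> X \<inter> T \<in> \<U>}"
    have "X \<subseteq> \<Union>\<G>"
    proof
      fix x assume "x \<in> X"
      then obtain A where A: "A \<in> \<U>" "x \<in> A" using \<U> by auto
      then obtain T where "open T" "A = X \<inter> T" using \<U> by (auto simp: openin_open)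
      then show "x \<in> \<Union>\<G>" using A unfolding \<G>_def by blast
    qed
    then obtain e where e: "0 < e" "\<And>x. x \<in> X \<Longrightarrow> \<exists>G\<in>\<G>. ball x e \<subseteq> G"
      using Heine_Borel_lemma[OF X, of \<G>] unfolding \<G>_def by blast
    \<comment> \<open>\<open>e\<close> is a Lebesgue number of the cover. A thickened cube has side
      \<eta> + 2 * r \<le> 2 * \<eta>0, so two of its points are at distance at most 6 * \<eta>0 <
      e.\<close>
    define \<eta>0 where "\<eta>0 = e / 8"
    have \<eta>0: "0 < \<eta>0" using e by (simp add: \<eta>0_def)
    define \<epsilon> where "\<epsilon> = min (\<eta>0 / 8) (\<eta>0\<^sup>2 / 192)"
    have "0 < \<epsilon>" using \<eta>0 by (simp add: \<epsilon>_def)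
    then obtain n where n: "1 / Suc n < \<epsilon>" using nat_approx_posE by blast
    have "small_content 2 \<epsilon> X" by (rule small_content_mono[OF sc[of n]]) (use n in auto)
    then obtain c :: "real ^ 3" and r \<eta> where r: "0 < r" "4 * r \<le> \<eta>" "\<eta> \<le> \<eta>0"
      and gap: "\<And>x. x \<in> X \<Longrightarrow> \<exists>l. \<forall>i. i \<noteq> l \<longrightarrow> (\<forall>k::int. r \<le> \<bar>x $ i - (c $ i + of_int k * \<eta>)\<bar>)"
      using exists_translated_grid[OF \<eta>0] unfolding \<epsilon>_def by metis
    have \<eta>: "0 < \<eta>" using r by linarith
    define V where "V k = X \<inter> box (\<chi> i. c $ i + of_int (k i) * \<eta> - r) (\<chi> i. c $ i + (of_int (k i) + 1) * \<eta> + r)" for k :: "3 \<Rightarrow> int"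
    have V_iff: "x \<in> V k \<longleftrightarrow> x \<in> X \<and> (\<forall>i. c $ i + of_int (k i) * \<eta> - r < x $ i \<and> x $ i < c $ i + (of_int (k i) + 1) * \<eta> + r)" for x k
      by (simp add: V_def mem_box_cart)
    obtain R0 where R0: "\<And>x. x \<in> X \<Longrightarrow> norm x \<le> R0"
      using compact_imp_bounded[OF X] unfolding bounded_iff by blast
    define R where "R = R0 + norm c"
    have R: "norm (x - c) \<le> R" if "x \<in> X" for x
      using norm_triangle_ineq4[of x c] R0[OF that] by (simp add: R_def)
    define B where "B = \<lceil>R / \<eta>\<rceil> + 1"
    define k0 where "k0 x i = \<lfloor>(x $ i - c $ i) / \<eta>\<rfloor>" for x i
    have k0: "of_int (k0 x i) * \<eta> \<le> x $ i - c $ i" "x $ i - c $ i < (of_int (k0 x i) + 1) * \<eta>" for x i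
    proof -
      have 1: "of_int (k0 x i) \<le> (x $ i - c $ i) / \<eta>" and 2: "(x $ i - c $ i) / \<eta> < of_int (k0 x i) + 1"
        unfolding k0_def by linarith+
      show "of_int (k0 x i) * \<eta> \<le> x $ i - c $ i" using 1 unfolding pos_le_divide_eq[OF \<eta>] .
      show "x $ i - c $ i < (of_int (k0 x i) + 1) * \<eta>" using 2 unfolding pos_divide_less_eq[OF \<eta>] .
    qed
    have V_k0: "x \<in> V (k0 x)" if "x \<in> X" for x
      unfolding V_iff
    proof (intro conjI allI that)
      fix i
      show "c $ i + of_int (k0 x i) * \<eta> - r < x $ i" using k0(1)[where x = x and i = i] r(1) by linarith
      show "x $ i < c $ i + (of_int (k0 x i) + 1) * \<eta> + r" using k0(2)[where x = x and i = i] r(1) by linarith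
    qed
    have k0_B: "k0 x i \<in> {-B..B}" if "x \<in> X" for x i
    proof -
      have "\<bar>x $ i - c $ i\<bar> \<le> R" using component_le_norm_cart[of "x - c" i] R[OF that] by simp
      then have "(x $ i - c $ i) / \<eta> \<le> R / \<eta>" "(- R) / \<eta> \<le> (x $ i - c $ i) / \<eta>"
        using \<eta> by (intro divide_right_mono; linarith)+
      then show ?thesis unfolding k0_def B_def atLeastAtMost_iff minus_divide_left[symmetric] by linarith
    qed
    define \<K> where "\<K> = ((UNIV :: 3 set) \<rightarrow>\<^sub>E {-B..B})"
    have fin\<K>: "finite \<K>" unfolding \<K>_def by (intro finite_PiE) auto
    \<comment> \<open>Empty pieces are dropped because a point of each piece is used to place it in
      a member of the cover.\<close>
    define \<V> where "\<V> = {W \<in> V ` \<K>. W \<noteq> {}}"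
    have "finite \<V>" unfolding \<V>_def using fin\<K> by simp
    moreover have "openin (top_of_set X) W" if "W \<in> \<V>" for W
      using that by (auto simp: \<V>_def V_def intro: openin_open_Int)
    moreover have "\<Union>\<V> = X"
    proof
      show "\<Union>\<V> \<subseteq> X" by (auto simp: \<V>_def V_iff)
      show "X \<subseteq> \<Union>\<V>"
      proof
        fix x assume x: "x \<in> X"
        have "k0 x \<in> \<K>" unfolding \<K>_def using k0_B[OF x] by (simp add: PiE_iff)
        then show "x \<in> \<Union>\<V>" using V_k0[OF x] unfolding \<V>_def by blast
      qed
    qed
    moreover have "\<exists>A\<in>\<U>. W \<subseteq> A" if "W \<in> \<V>" for W
    proof -
      have "W \<in> V ` \<K>" "W \<noteq> {}" using that by (simp_all add: \<V>_def)
      then obtain k x where k: "W = V k" "x \<in> W" by auto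
      have xX: "x \<in> X" using k V_iff by blast
      obtain G where G: "G \<in> \<G>" "ball x e \<subseteq> G" using e(2)[OF xX] by blast
      have "W \<subseteq> X \<inter> G"
      proof
        fix y assume y: "y \<in> W"
        have "\<bar>(x - y) $ i\<bar> \<le> 2 * \<eta>0" for i
        proof -
          have "c $ i + of_int (k i) * \<eta> - r < x $ i" "x $ i < c $ i + (of_int (k i) + 1) * \<eta> + r"
            "c $ i + of_int (k i) * \<eta> - r < y $ i" "y $ i < c $ i + (of_int (k i) + 1) * \<eta> + r"
            using y k V_iff by blast+
          then have "\<bar>x $ i - y $ i\<bar> \<le> \<eta> + 2 * r" unfolding distrib_right by linarith
          then show ?thesis using r by simp
        qed
        then have "(\<Sum>i\<in>UNIV. \<bar>(x - y) $ i\<bar>) \<le> (\<Sum>i\<in>(UNIV::3 set). 2 * \<eta>0)" by (intro sum_mono)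
        then have "norm (x - y) \<le> 6 * \<eta>0" using norm_le_l1_cart[of "x - y"] by simp
        then have "y \<in> ball x e" using e(1) by (simp add: dist_norm \<eta>0_def)
        then show "y \<in> X \<inter> G" using G(2) y k V_iff by blast
      qed
      then show ?thesis using G(1) unfolding \<G>_def by blast
    qed
    moreover have "int (card {W \<in> \<V>. x \<in> W}) \<le> 1 + 1" if x: "x \<in> X" for x
    proof -
      \<comment> \<open>In the coordinates other than \<open>l\<close> the point keeps distance
        \<open>r\<close> from all grid planes, so thickening by \<open>r\<close> adds no cube. In
        coordinate \<open>l\<close>, r \<le> \<eta> / 4 leaves the integers strictly between w - 5/4
        and w + 1/4, at most two.\<close>
      obtain l where l: "\<And>i k. i \<noteq> l \<Longrightarrow> r \<le> \<bar>x $ i - (c $ i + of_int k * \<eta>)\<bar>" using gap[OF x] by blast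
      define w where "w = (x $ l - c $ l) / \<eta>"
      define k1 where "k1 m i = (if i = l then m else k0 x i)" for m i
      have "k \<in> {k1 \<lfloor>w + 1/4\<rfloor>, k1 \<lfloor>w - 1/4\<rfloor>}" if k: "x \<in> V k" for k
      proof -
        have ki: "k i = k0 x i" if "i \<noteq> l" for i
        proof -
          have "c $ i + of_int (k i) * \<eta> - r < x $ i" "x $ i < c $ i + (of_int (k i) + 1) * \<eta> + r"
            using k V_iff by blast+
          moreover have "r \<le> \<bar>x $ i - (c $ i + of_int (k i) * \<eta>)\<bar>" "r \<le> \<bar>x $ i - (c $ i + of_int (k i + 1) * \<eta>)\<bar>"
            using l[OF that] by blast+
          ultimately have "of_int (k i) * \<eta> \<le> x $ i - c $ i" "x $ i - c $ i < (of_int (k i) + 1) * \<eta>"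
            using r(1) by (auto simp: abs_if split: if_splits)
          then have "of_int (k i) \<le> (x $ i - c $ i) / \<eta>" "(x $ i - c $ i) / \<eta> < of_int (k i) + 1"
            by (simp_all only: pos_le_divide_eq[OF \<eta>] pos_divide_less_eq[OF \<eta>])
          then show ?thesis unfolding k0_def by linarith
        qed
        have "c $ l + of_int (k l) * \<eta> - r < x $ l" "x $ l < c $ l + (of_int (k l) + 1) * \<eta> + r"
          using k V_iff by blast+
        then have "(of_int (k l) - 1/4) * \<eta> < x $ l - c $ l" "x $ l - c $ l < (of_int (k l) + 5/4) * \<eta>"
          using r(2) by (simp_all add: algebra_simps)
        then have "of_int (k l) - 1/4 < w" "w < of_int (k l) + 5/4"
          unfolding w_def by (simp_all only: pos_less_divide_eq[OF \<eta>] pos_divide_less_eq[OF \<eta>])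
        then have "k l = \<lfloor>w + 1/4\<rfloor> \<or> k l = \<lfloor>w - 1/4\<rfloor>" by linarith
        then show ?thesis using ki unfolding k1_def by auto
      qed
      then have "{W \<in> \<V>. x \<in> W} \<subseteq> V ` {k1 \<lfloor>w + 1/4\<rfloor>, k1 \<lfloor>w - 1/4\<rfloor>}" unfolding \<V>_def by auto
      then have "card {W \<in> \<V>. x \<in> W} \<le> card (V ` {k1 \<lfloor>w + 1/4\<rfloor>, k1 \<lfloor>w - 1/4\<rfloor>})" by (intro card_mono) auto
      also have "\<dots> \<le> card {k1 \<lfloor>w + 1/4\<rfloor>, k1 \<lfloor>w - 1/4\<rfloor>}" by (rule card_image_le) simp
      also have "\<dots> \<le> 2" by (simp add: card_insert_if)
      finally show ?thesis by simp
    qed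
    ultimately show "\<exists>\<V>. finite \<V> \<and> (\<forall>B\<in>\<V>. openin (top_of_set X) B) \<and> \<Union>\<V> = topspace (top_of_set X) \<and>
             (\<forall>B\<in>\<V>. \<exists>A\<in>\<U>. B \<subseteq> A) \<and> (\<forall>x\<in>topspace (top_of_set X). int (card {B\<in>\<V>. x \<in> B}) \<le> 1 + 1)"
      by (intro exI[of _ \<V>]) simp
  qed
  then show ?thesis unfolding covering_dim_def by (intro Inf_lower) (auto simp: one_ereal_def intro!: exI[of _ "1::int"])
qed

section \<open>Stable and pushable properties\<close>

text \<open>A uniform version of not lying in a hyperplane: one lower bound on the width serves all
  directions, which makes stability evident.\<close>

definition spread :: "'a::euclidean_space set \<Rightarrow> bool" where
  "spread A \<longleftrightarrow> (\<exists>\<delta>>0. \<forall>v. norm v = 1 \<longrightarrow> (\<exists>x\<in>A. \<exists>y\<in>A. \<delta> < \<bar>v \<bullet> (x - y)\<bar>))"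

text \<open>Directions in which the width tends to 0 accumulate, by compactness of the sphere, at a
  direction orthogonal to all differences; the set would then lie in a hyperplane.\<close>

lemma spread_if_aff_dim:
  fixes A :: "'a::euclidean_space set"
  assumes "aff_dim A = DIM('a)"
  shows "spread A"
proof (rule ccontr)
  assume ns: "\<not> spread A"
  have "\<exists>v. norm v = 1 \<and> (\<forall>x\<in>A. \<forall>y\<in>A. \<bar>v \<bullet> (x - y)\<bar> \<le> 1 / Suc n)" for n
  proof -
    have "0 < 1 / real (Suc n)" by simp
    with ns show ?thesis unfolding spread_def by (meson not_le)
  qed
  then obtain v where v: "\<And>n. norm (v n) = 1" "\<And>n x y. x \<in> A \<Longrightarrow> y \<in> A \<Longrightarrow> \<bar>v n \<bullet> (x - y)\<bar> \<le> 1 / Suc n" by metis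
  have "\<forall>n. v n \<in> sphere 0 1" using v(1) by simp
  then obtain w r where w: "w \<in> sphere 0 1" "strict_mono r" "(v \<circ> r) \<longlonglongrightarrow> w"
    using compact_sphere[of "0::'a" 1] unfolding compact_def by metis
  have orth: "w \<bullet> (x - y) = 0" if xy: "x \<in> A" "y \<in> A" for x y
  proof -
    have "(\<lambda>n. v (r n) \<bullet> (x - y)) \<longlonglongrightarrow> w \<bullet> (x - y)"
      using w(3) by (intro tendsto_intros) (simp add: comp_def)
    moreover have "(\<lambda>n. v (r n) \<bullet> (x - y)) \<longlonglongrightarrow> 0"
    proof (rule Lim_null_comparison)
      show "\<forall>\<^sub>F n in sequentially. norm (v (r n) \<bullet> (x - y)) \<le> 1 / Suc n"
      proof (rule always_eventually, rule allI)
        fix n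
        have "n \<le> r n" using w(2) by (rule seq_suble)
        then have "1 / real (Suc (r n)) \<le> 1 / Suc n" by (intro divide_left_mono) auto
        then show "norm (v (r n) \<bullet> (x - y)) \<le> 1 / Suc n" using v(2)[OF xy, of "r n"] by simp
      qed
      show "(\<lambda>n. 1 / real (Suc n)) \<longlonglongrightarrow> 0" by (rule LIMSEQ_Suc[OF lim_1_over_n])
    qed
    ultimately show ?thesis using LIMSEQ_unique by blast
  qed
  have "w \<noteq> 0" using w(1) by auto
  obtain a where a: "a \<in> A" using assms aff_dim_empty[of A] by force
  have "A \<subseteq> {x. w \<bullet> x = w \<bullet> a}"
  proof
    fix x assume "x \<in> A"
    from orth[OF this a] show "x \<in> {x. w \<bullet> x = w \<bullet> a}" by (simp add: inner_diff_right)
  qed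
  then have "aff_dim A \<le> int (DIM('a) - 1)" using aff_dim_subset aff_dim_hyperplane[OF \<open>w \<noteq> 0\<close>] by metis
  then show False using assms DIM_positive[where 'a = 'a] by simp
qed

text \<open>An affine basis chosen in the set is finite and is kept fixed, while another point of
  the infinite set is moved out of the affine hull by a shear supported near that point.\<close>

lemma push_increase_aff_dim:
  fixes A :: "'a::euclidean_space set"
  assumes A: "infinite A" "A \<subseteq> U" and U: "open U" and lt: "aff_dim A < DIM('a)" and \<eta>: "0 < \<eta>"
  obtains h where "push U \<eta> h" "aff_dim A < aff_dim (h ` A)"
proof -
  obtain B where B: "\<not> affine_dependent B" "B \<subseteq> A" "affine hull B = affine hull A"
    using affine_basis_exists[of A] by blast
  have finB: "finite B" using aff_independent_finite[OF B(1)] .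
  have dimB: "aff_dim B = aff_dim A" using B(3) by (metis aff_dim_affine_hull)
  obtain a where a: "a \<in> A" "a \<notin> B" using A(1) finB by (meson finite_subset subsetI)
  define T where "T = affine hull A"
  have "T \<noteq> UNIV"
  proof
    assume "T = UNIV"
    then have "aff_dim A = DIM('a)" unfolding T_def by (metis aff_dim_affine_hull aff_dim_UNIV)
    then show False using lt by simp
  qed
  then obtain w where w: "w \<notin> T" by blast
  have aT: "a \<in> T" unfolding T_def using a(1) by (rule hull_inc)
  then have "w - a \<noteq> 0" using w by auto
  define e where "e = (w - a) /\<^sub>R norm (w - a)"
  have ne: "norm e = 1" using \<open>w - a \<noteq> 0\<close> by (simp add: e_def)
  have off: "a + s *\<^sub>R e \<notin> T" if "s \<noteq> 0" for s
  proof
    assume s: "a + s *\<^sub>R e \<in> T"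
    define t where "t = norm (w - a) / s"
    have "t * s = norm (w - a)" using that by (simp add: t_def)
    have "(1 - t) *\<^sub>R a + t *\<^sub>R (a + s *\<^sub>R e) = a + (t * s) *\<^sub>R e" by (simp add: algebra_simps)
    also have "\<dots> = w" unfolding \<open>t * s = norm (w - a)\<close> using \<open>w - a \<noteq> 0\<close> by (simp add: e_def)
    finally have "w \<in> T" using mem_affine[of T a "a + s *\<^sub>R e" "1 - t" t] aT s
      unfolding T_def by (simp add: affine_affine_hull)
    with w show False ..
  qed
  have "open (U - B)" using U finB by (simp add: open_Diff finite_imp_closed)
  then obtain \<rho> where \<rho>: "0 < \<rho>" "ball a \<rho> \<subseteq> U - B" using a A(2) by (meson DiffI openE subsetD)
  \<comment> \<open>2 * R < \<rho> keeps the basis \<open>B\<close> outside the support, and v \<le>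
    R / 2 is the slope condition for the shear.\<close>
  define R where "R = \<rho> / 3"
  define v where "v = min (R / 2) \<eta>"
  have R: "0 < R" "2 * R < \<rho>" using \<rho> by (auto simp: R_def)
  have v: "0 < v" "v \<le> R / 2" "v \<le> \<eta>" using R \<eta> by (auto simp: v_def)
  define h where "h x = x + (cutoff R {a} x * v) *\<^sub>R e" for x
  have zero: "cutoff R {a} x * v = 0" if "x \<notin> ball a \<rho>" for x
    using that R cutoff_eq_0[of R x "{a}"] by (simp add: dist_commute)
  have "push U \<eta> h"
    unfolding h_def
  proof (rule push_shear_lipschitz[OF ne])
    show "continuous_on UNIV (\<lambda>x. cutoff R {a} x * v)"
      by (intro continuous_on_mult continuous_on_cutoff continuous_on_const)
    show "\<bar>cutoff R {a} x * v\<bar> \<le> \<eta>" for x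
    proof -
      have "\<bar>cutoff R {a} x * v\<bar> \<le> 1 * v" unfolding abs_mult
        using v(1) cutoff_bounds(3) by (intro mult_mono) auto
      then show ?thesis using v(3) by linarith
    qed
    show "cutoff R {a} x * v = 0" if "x \<notin> U" for x using zero \<rho>(2) that by blast
    show "\<bar>cutoff R {a} (x + t *\<^sub>R e) * v - cutoff R {a} x * v\<bar> \<le> t / 2" if "t > 0" for x t
      using cutoff_mult_lipschitz[of R v "{a}" "x + t *\<^sub>R e" x] that R v ne by (simp add: dist_norm)
  qed
  moreover have "aff_dim A < aff_dim (h ` A)"
  proof -
    have "h b = b" if "b \<in> B" for b using zero[of b] \<rho>(2) that unfolding h_def by force
    then have "B \<subseteq> h ` A" using B(2) by (metis image_eqI subset_iff)
    moreover have "h a = a + v *\<^sub>R e" unfolding h_def using R by (simp add: cutoff_eq_1)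
    ultimately have "insert (a + v *\<^sub>R e) B \<subseteq> h ` A" using a(1) by (metis image_eqI insert_subset)
    then have "aff_dim (insert (a + v *\<^sub>R e) B) \<le> aff_dim (h ` A)" by (rule aff_dim_subset)
    moreover have "a + v *\<^sub>R e \<notin> affine hull B" using off[of v] v(1) unfolding T_def B(3) by simp
    ultimately show ?thesis by (simp add: aff_dim_insert dimB)
  qed
  ultimately show ?thesis by (rule that)
qed

lemma push_to_full_aff_dim:
  fixes A :: "'a::euclidean_space set"
  assumes "infinite A" "A \<subseteq> U" "open U" "0 < \<eta>"
  shows "\<exists>h. push U \<eta> h \<and> aff_dim (h ` A) = DIM('a)"
  using assms
proof (induction "nat (DIM('a) - aff_dim A)" arbitrary: A \<eta> rule: less_induct)
  case less
  show ?case
  proof (cases "aff_dim A = DIM('a)")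
    case True
    then show ?thesis using push_id[of \<eta> U] less.prems(4) by (intro exI[of _ "\<lambda>x. x"]) auto
  next
    case False
    then have lt: "aff_dim A < DIM('a)" using aff_dim_le_DIM[of A] by linarith
    obtain h where h: "push U (\<eta> / 2) h" "aff_dim A < aff_dim (h ` A)"
      using push_increase_aff_dim[OF less.prems(1-3) lt, of "\<eta> / 2"] less.prems(4) by auto
    have "infinite (h ` A)"
      using less.prems(1) push_bij[OF h(1)] by (meson bij_is_inj finite_imageD inj_on_subset subset_UNIV)
    moreover have "nat (DIM('a) - aff_dim (h ` A)) < nat (DIM('a) - aff_dim A)" using h(2) lt by linarith
    ultimately obtain k where k: "push U (\<eta> / 2) k" "aff_dim (k ` h ` A) = DIM('a)"
      using less.hyps[of "h ` A" "\<eta> / 2"] push_image_subset[OF h(1) less.prems(2)] less.prems(3,4) by auto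
    have "push U (\<eta> / 2 + \<eta> / 2) (k \<circ> h)" by (rule push_compose[OF h(1) k(1)])
    then have "push U \<eta> (k \<circ> h)" by simp
    moreover have "aff_dim ((k \<circ> h) ` A) = DIM('a)" using k(2) by (simp add: image_comp)
    ultimately show ?thesis by blast
  qed
qed

text \<open>Openness at compact sets for the Hausdorff distance. Uniformly close maps have images of
  \<open>K\<close> close in this sense, so the property is open in the map.\<close>

definition stable :: "('a::metric_space set \<Rightarrow> bool) \<Rightarrow> bool" where
  "stable P \<longleftrightarrow> (\<forall>A. compact A \<and> P A \<longrightarrow>
     (\<exists>\<delta>>0. \<forall>B. (\<forall>a\<in>A. \<exists>b\<in>B. dist a b < \<delta>) \<and> (\<forall>b\<in>B. \<exists>a\<in>A. dist a b < \<delta>) \<longrightarrow> P B))"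

text \<open>The source of density: following \<open>f\<close> by a push applied to f(K) gives a
  nearby map with the property.\<close>

definition pushable :: "'a::euclidean_space set \<Rightarrow> ('a set \<Rightarrow> bool) \<Rightarrow> bool" where
  "pushable U P \<longleftrightarrow> (\<forall>A \<eta>. thin A \<and> infinite A \<and> A \<subseteq> U \<and> 0 < \<eta> \<longrightarrow> (\<exists>h. push U \<eta> h \<and> P (h ` A)))"

lemma stable_spread: "stable (spread :: 'a::euclidean_space set \<Rightarrow> bool)"
  unfolding stable_def
proof (intro allI impI)
  fix A :: "'a set" assume "compact A \<and> spread A"
  then obtain \<delta> where \<delta>: "0 < \<delta>" "\<And>v. norm v = 1 \<Longrightarrow> \<exists>x\<in>A. \<exists>y\<in>A. \<delta> < \<bar>v \<bullet> (x - y)\<bar>"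
    unfolding spread_def by blast
  show "\<exists>\<delta>>0. \<forall>B. (\<forall>a\<in>A. \<exists>b\<in>B. dist a b < \<delta>) \<and> (\<forall>b\<in>B. \<exists>a\<in>A. dist a b < \<delta>) \<longrightarrow> spread B"
  \<comment> \<open>Moving both points by less than \<delta> / 4 changes the width they realise by
    less than \<delta> / 2.\<close>
  proof (intro exI[of _ "\<delta> / 4"] conjI allI impI)
    fix B assume B: "(\<forall>a\<in>A. \<exists>b\<in>B. dist a b < \<delta> / 4) \<and> (\<forall>b\<in>B. \<exists>a\<in>A. dist a b < \<delta> / 4)"
    have "\<exists>x\<in>B. \<exists>y\<in>B. \<delta> / 2 < \<bar>v \<bullet> (x - y)\<bar>" if v: "norm v = 1" for v
    proof -
      obtain x y where xy: "x \<in> A" "y \<in> A" "\<delta> < \<bar>v \<bullet> (x - y)\<bar>" using \<delta>(2)[OF v] by blast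
      obtain x' y' where xy': "x' \<in> B" "dist x x' < \<delta> / 4" "y' \<in> B" "dist y y' < \<delta> / 4"
        using B xy by blast
      have le: "\<bar>v \<bullet> (p - q)\<bar> \<le> dist p q" for p q
        using Cauchy_Schwarz_ineq2[of v "p - q"] v by (simp add: dist_norm)
      have "v \<bullet> (x - y) = v \<bullet> (x - x') + v \<bullet> (x' - y') - v \<bullet> (y - y')" by (simp add: inner_diff_right)
      then have "\<delta> / 2 < \<bar>v \<bullet> (x' - y')\<bar>" using le[of x x'] le[of y y'] xy(3) xy' by linarith
      then show ?thesis using xy' by blast
    qed
    then show "spread B" unfolding spread_def using \<delta>(1) by (intro exI[of _ "\<delta> / 2"]) auto
  qed (use \<delta> in simp)
qed

lemma stable_small_content: "stable (small_content s \<epsilon> :: 'a::heine_borel set \<Rightarrow> bool)"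
  unfolding stable_def
proof (intro allI impI)
  fix A :: "'a set" assume A: "compact A \<and> small_content s \<epsilon> A"
  then obtain C r where C: "finite C" "0 < r" "r < \<epsilon>" "A \<subseteq> (\<Union>c\<in>C. ball c r)" "real (card C) * r powr s < \<epsilon>"
    unfolding small_content_def by blast
  have "open (\<Union>c\<in>C. ball c r)" by blast
  then obtain \<delta> where \<delta>: "\<delta> > 0" "(\<Union>x\<in>A. cball x \<delta>) \<subseteq> (\<Union>c\<in>C. ball c r)"
    using compact_subset_open_imp_cball_epsilon_subset[of A] A C(4) by blast
  show "\<exists>\<delta>>0. \<forall>B. (\<forall>a\<in>A. \<exists>b\<in>B. dist a b < \<delta>) \<and> (\<forall>b\<in>B. \<exists>a\<in>A. dist a b < \<delta>) \<longrightarrow> small_content s \<epsilon> B"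
  proof (intro exI[of _ \<delta>] conjI allI impI)
    fix B assume B: "(\<forall>a\<in>A. \<exists>b\<in>B. dist a b < \<delta>) \<and> (\<forall>b\<in>B. \<exists>a\<in>A. dist a b < \<delta>)"
    have "B \<subseteq> (\<Union>x\<in>A. cball x \<delta>)"
    proof
      fix b assume "b \<in> B"
      then obtain a where "a \<in> A" "dist a b < \<delta>" using B by blast
      then show "b \<in> (\<Union>x\<in>A. cball x \<delta>)" by (intro UN_I[of a]) auto
    qed
    then have "B \<subseteq> (\<Union>c\<in>C. ball c r)" using \<delta>(2) by (rule order_trans)
    then show "small_content s \<epsilon> B" unfolding small_content_def using C by blast
  qed (rule \<delta>(1))
qed

lemma pushable_spread: "open U \<Longrightarrow> pushable U spread"
  unfolding pushable_def by (meson push_to_full_aff_dim spread_if_aff_dim)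

lemma pushable_small_content:
  fixes U :: "(real ^ 3) set"
  assumes U: "open U" "bounded U" and s: "1 < s" and \<epsilon>: "0 < \<epsilon>"
  shows "pushable U (small_content s \<epsilon>)"
  unfolding pushable_def
proof (intro allI impI)
  fix A :: "(real ^ 3) set" and \<eta> :: real assume A: "thin A \<and> infinite A \<and> A \<subseteq> U \<and> 0 < \<eta>"
  then have "A \<noteq> {}" by auto
  then show "\<exists>h. push U \<eta> h \<and> small_content s \<epsilon> (h ` A)"
    using push_to_small_content[of A U s \<epsilon> \<eta>] A U s \<epsilon> by metis
qed

section \<open>Dimensions of orthogonal projections\<close>

lemma dist_orth_proj_le:
  fixes L :: "'a::euclidean_space set"
  assumes L: "subspace L" shows "dist (orth_proj L x) (orth_proj L y) \<le> dist x y"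
proof -
  define p where "p = orth_proj L x - orth_proj L y"
  have p: "p \<in> L" unfolding p_def using L orth_proj(1)[OF L] by (simp add: subspace_diff)
  have "(x - orth_proj L x) \<bullet> p = 0" "(y - orth_proj L y) \<bullet> p = 0"
    using orth_proj(2)[OF L p] by (auto simp: orthogonal_def)
  then have "p \<bullet> p = (x - y) \<bullet> p" by (simp add: p_def inner_diff_left)
  also have "\<dots> \<le> norm (x - y) * norm p" by (rule norm_cauchy_schwarz)
  finally have "norm p * norm p \<le> norm (x - y) * norm p" by (simp flip: power2_norm_eq_inner add: power2_eq_square)
  then have "norm p \<le> norm (x - y)" by (cases "norm p = 0") auto
  then show ?thesis by (simp add: p_def dist_norm)
qed

lemma small_content_nonexpansive_image:
  assumes A: "small_content s \<epsilon> A" and f: "\<And>x y. dist (f x) (f y) \<le> dist x y"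
  shows "small_content s \<epsilon> (f ` A)"
proof -
  obtain C r where C: "finite C" "0 < r" "r < \<epsilon>" "A \<subseteq> (\<Union>c\<in>C. ball c r)" "real (card C) * r powr s < \<epsilon>"
    using A unfolding small_content_def by blast
  have "f ` A \<subseteq> (\<Union>c\<in>f ` C. ball c r)"
  proof
    fix y assume "y \<in> f ` A"
    then obtain x c where "y = f x" "c \<in> C" "dist c x < r" using C(4) by fastforce
    then show "y \<in> (\<Union>c\<in>f ` C. ball c r)" using f[of c x] by (intro UN_I[of "f c"]) auto
  qed
  moreover have "real (card (f ` C)) * r powr s < \<epsilon>"
  proof -
    have "real (card (f ` C)) * r powr s \<le> real (card C) * r powr s"
      using card_image_le[OF C(1), of f] by (intro mult_right_mono) auto
    then show ?thesis using C(5) by (rule le_less_trans)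
  qed
  ultimately show ?thesis unfolding small_content_def using C(1-3) by blast
qed

lemma dim_orth_proj_eq_1:
  fixes A L :: "(real ^ 3) set"
  assumes A: "compact A" "connected A" "spread A"
    and sc: "\<And>n::nat. small_content (1 + 1 / Suc n) (1 / Suc n) A"
    and L: "subspace L" "L \<noteq> {0}"
  shows "covering_dim (top_of_set (orth_proj L ` A)) = 1 \<and> hausdorff_dim (orth_proj L ` A) = 1"
proof -
  let ?X = "orth_proj L ` A"
  have cont: "continuous_on A (orth_proj L)"
    unfolding continuous_on_iff using dist_orth_proj_le[OF L(1)] by (meson le_less_trans)
  have X: "compact ?X" "connected ?X"
    using A cont by (auto intro: compact_continuous_image connected_continuous_image)
  have scX: "small_content (1 + 1 / Suc n) (1 / Suc n) ?X" for n
    by (rule small_content_nonexpansive_image[OF sc dist_orth_proj_le[OF L(1)]])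
  obtain w where w: "w \<in> L" "w \<noteq> 0" using L subspace_0 by blast
  define v where "v = w /\<^sub>R norm w"
  have v: "v \<in> L" "norm v = 1" using w L(1) by (auto simp: v_def subspace_scale)
  then obtain x y where xy: "x \<in> A" "y \<in> A" "v \<bullet> (x - y) \<noteq> 0" using A(3) unfolding spread_def by force
  \<comment> \<open>Inner products with a vector of \<open>L\<close> are unchanged by the
    projection, so the width in direction \<open>v\<close> survives and separates two projected
    points.\<close>
  have vz: "v \<bullet> z = v \<bullet> orth_proj L z" for z
    using orth_proj(2)[OF L(1) v(1), of z] by (simp add: orthogonal_def inner_commute inner_diff_right)
  have "orth_proj L x \<noteq> orth_proj L y" using xy(3) vz[of x] vz[of y] by (auto simp: inner_diff_right)
  then show ?thesis
    using covering_dim_le_1[OF X(1) scX] covering_dim_ge_1[OF X(2)] hausdorff_dim_le_1[OF scX] hausdorff_dim_ge_1[OF X(2)] xy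
    by (meson antisym imageI)
qed

section \<open>Typical homeomorphisms and isotopies\<close>

lemma typical_in_countable_Int:
  fixes G :: "nat \<Rightarrow> 'a set"
  assumes op: "\<And>n. openin X (G n)" and dense: "\<And>n. X closure_of (G n) = topspace X"
    and P: "\<And>x. x \<in> topspace X \<Longrightarrow> (\<And>n. x \<in> G n) \<Longrightarrow> P x"
  shows "typical_in X P"
proof -
  \<comment> \<open>The complement of \<open>G n\<close> is cut down to exceptional points, since
    first category asks for the exceptional set itself as the union.\<close>
  define N where "N n = {x \<in> topspace X. \<not> P x} - G n" for n
  have "nowhere_dense_in X (N n)" for n
  proof -
    have "closedin X (topspace X - G n)" using op by blast
    then have "X closure_of N n \<subseteq> topspace X - G n" by (intro closure_of_minimal) (auto simp: N_def)
    then have "X interior_of (X closure_of N n) \<subseteq> X interior_of (topspace X - G n)" by (rule interior_of_mono)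
    also have "\<dots> = {}" by (simp add: interior_of_complement dense)
    finally show ?thesis unfolding nowhere_dense_in_def N_def by auto
  qed
  moreover have "{x \<in> topspace X. \<not> P x} = \<Union>(range N)"
  proof
    show "{x \<in> topspace X. \<not> P x} \<subseteq> \<Union>(range N)"
    proof
      fix x assume x: "x \<in> {x \<in> topspace X. \<not> P x}"
      then obtain n where "x \<notin> G n" using P by blast
      then have "x \<in> N n" using x by (simp add: N_def)
      then show "x \<in> \<Union>(range N)" by blast
    qed
  qed (auto simp: N_def)
  ultimately show ?thesis
    unfolding typical_in_def first_category_in_def by (intro exI[of _ "range N"]) auto
qed

lemma typical_in_mtopology:
  fixes Q :: "nat \<Rightarrow> 'a \<Rightarrow> bool"
  assumes M: "Metric_space M d"
    and op: "\<And>n f. f \<in> M \<Longrightarrow> Q n f \<Longrightarrow> \<exists>\<delta>>0. \<forall>g\<in>M. d f g < \<delta> \<longrightarrow> Q n g"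
    and dense: "\<And>n f \<eta>. f \<in> M \<Longrightarrow> 0 < \<eta> \<Longrightarrow> \<exists>g\<in>M. d f g < \<eta> \<and> Q n g"
    and P: "\<And>f. f \<in> M \<Longrightarrow> (\<And>n. Q n f) \<Longrightarrow> P f"
  shows "typical_in (Metric_space.mtopology M d) P"
proof -
  interpret Metric_space M d by (rule M)
  show ?thesis
  proof (rule typical_in_countable_Int[where G = "\<lambda>n. {f \<in> M. Q n f}"])
    fix n
    show "openin mtopology {f \<in> M. Q n f}"
      unfolding openin_mtopology
    proof (intro conjI allI impI)
      fix f assume f: "f \<in> {f \<in> M. Q n f}"
      then obtain \<delta> where "0 < \<delta>" "\<forall>g\<in>M. d f g < \<delta> \<longrightarrow> Q n g" using op by blast
      then show "\<exists>r>0. mball f r \<subseteq> {f \<in> M. Q n f}" by (intro exI[of _ \<delta>]) auto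
    qed auto
    show "mtopology closure_of {f \<in> M. Q n f} = topspace mtopology"
      unfolding metric_closure_of topspace_mtopology
    proof (intro equalityI subsetI CollectI conjI allI impI)
      fix f r assume f: "f \<in> M" and "0 < (r::real)"
      then obtain g where "g \<in> M" "d f g < r" "Q n g" using dense by blast
      then show "\<exists>y\<in>{f \<in> M. Q n f}. y \<in> mball f r" using f by (intro bexI[of _ g]) auto
    qed auto
  qed (use P in auto)
qed

section \<open>Composing homeomorphisms and isotopies with pushes\<close>

lemma push_image_eq:
  assumes "push U \<eta> h" "U \<subseteq> Y" shows "h ` Y = Y"
proof
  show "h ` Y \<subseteq> Y"
  proof
    fix y assume "y \<in> h ` Y"
    then obtain x where x: "x \<in> Y" "y = h x" by blast
    then show "y \<in> Y" using push_in[OF assms(1), of x] push_off[OF assms(1), of x] assms(2) by (cases "x \<in> U") auto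
  qed
  show "Y \<subseteq> h ` Y"
  proof
    fix y assume y: "y \<in> Y"
    obtain x where x: "y = h x" using push_bij[OF assms(1)] by (metis bij_pointE)
    have "x \<in> Y" using push_off[OF assms(1), of x] assms(2) x y by (cases "x \<in> U") auto
    then show "y \<in> h ` Y" using x by blast
  qed
qed

text \<open>With time rescaled to s * t, the stage at time t is itself the end of an isotopy, and
  everything known about pushes applies to it.\<close>

lemma ambient_isotopy_push:
  assumes H: "ambient_isotopy U \<eta> H" and t: "t \<in> {0..1}"
  shows "push U \<eta> (\<lambda>x. H (x, t))"
proof -
  note D = ambient_isotopyD[OF H]
  have "ambient_isotopy U \<eta> (\<lambda>z. H (fst z, snd z * t))"
    unfolding ambient_isotopy_def
  proof (intro conjI ballI allI impI)
    have st: "s * t \<in> {0..1}" if "s \<in> {0..1}" for s using that t by (auto simp: mult_le_one)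
    have "continuous_on (UNIV \<times> {0..1::real}) (\<lambda>z. (fst z, snd z * t))"
      by (intro continuous_on_Pair continuous_on_fst continuous_on_mult continuous_on_snd continuous_on_id continuous_on_const)
    then show "continuous_on (UNIV \<times> {0..1}) (\<lambda>z. H (fst z, snd z * t))"
      by (rule continuous_on_compose2[OF D(1)]) (use st in auto)
    fix s :: real assume s: "s \<in> {0..1}"
    show "bij (\<lambda>x. H (fst (x, s), snd (x, s) * t))" using D(2)[OF st[OF s]] by simp
    show "H (fst (x, s), snd (x, s) * t) = x" if "x \<notin> U" for x using D(4)[OF st[OF s] that] by simp
    show "dist (H (fst (x, s), snd (x, s) * t)) x \<le> \<eta>" for x using D(5)[OF st[OF s], of x] by simp
  next
    show "H (fst (x, 0), snd (x, 0) * t) = x" for x using D(3)[of x] by simp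
  qed
  then show ?thesis unfolding push_def by (intro exI) (auto simp: t)
qed

lemma stable_image:
  fixes f :: "'b \<Rightarrow> 'a::metric_space"
  assumes "stable P" "compact (f ` K)" "P (f ` K)"
  obtains \<delta> where "0 < \<delta>" "\<And>g. (\<And>x. x \<in> K \<Longrightarrow> dist (f x) (g x) < \<delta>) \<Longrightarrow> P (g ` K)"
proof -
  from assms(1)[unfolded stable_def, THEN spec, THEN mp, OF conjI[OF assms(2,3)]]
  obtain \<delta> where \<delta>: "0 < \<delta>"
    "\<forall>B. (\<forall>a\<in>f ` K. \<exists>b\<in>B. dist a b < \<delta>) \<and> (\<forall>b\<in>B. \<exists>a\<in>f ` K. dist a b < \<delta>) \<longrightarrow> P B"
    by (elim exE conjE)
  show ?thesis
  proof (rule that[OF \<delta>(1)])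
    fix g :: "'b \<Rightarrow> 'a" assume g: "\<And>x. x \<in> K \<Longrightarrow> dist (f x) (g x) < \<delta>"
    show "P (g ` K)"
    proof (rule \<delta>(2)[THEN spec, THEN mp], intro conjI ballI)
      show "\<exists>b\<in>g ` K. dist a b < \<delta>" if "a \<in> f ` K" for a using that g by auto
      show "\<exists>a\<in>f ` K. dist a b < \<delta>" if "b \<in> g ` K" for b using that g by auto
    qed
  qed
qed

text \<open>If a point of \<open>U\<close> had its image on the frontier, this image would be a
  fixed point and injectivity would identify it with the original point. Thus f(K) stays in
  \<open>U\<close>, where it can be pushed.\<close>

lemma image_frontier_fixed:
  assumes "inj_on f (closure U)" "f ` closure U \<subseteq> closure U" "\<And>x. x \<in> frontier U \<Longrightarrow> f x = x" "open U" "K \<subseteq> U"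
  shows "f ` K \<subseteq> U"
proof
  fix y assume "y \<in> f ` K"
  then obtain x where x: "x \<in> K" "y = f x" by blast
  show "y \<in> U"
  proof (rule ccontr)
    assume "y \<notin> U"
    have xU: "x \<in> U" using x(1) assms(5) by blast
    then have xc: "x \<in> closure U" using closure_subset by blast
    then have "y \<in> closure U" using assms(2) x by blast
    then have fr: "y \<in> frontier U" using \<open>y \<notin> U\<close> assms(4) by (simp add: frontier_def interior_open)
    then have "f y = f x" using assms(3) x(2) by simp
    then have "y = x" using assms(1) \<open>y \<in> closure U\<close> xc by (meson inj_onD)
    then show False using xU \<open>y \<notin> U\<close> by simp
  qed
qed

lemma bdd_above_dist_SUP:
  assumes "bounded Y" "\<And>z. z \<in> Z \<Longrightarrow> f z \<in> Y" "\<And>z. z \<in> Z \<Longrightarrow> g z \<in> Y"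
  shows "bdd_above ((\<lambda>z. dist (f z) (g z)) ` Z)"
  using assms diameter_bounded_bound by (intro bdd_aboveI2[of _ _ "diameter Y"]) blast

lemma typical_homeomorphism:
  fixes K U :: "'a::euclidean_space set" and \<P> :: "nat \<Rightarrow> 'a set \<Rightarrow> bool"
  assumes K: "thin K" "infinite K" "K \<subseteq> U" and U: "open U" "bounded U"
    and stable: "\<And>n. stable (\<P> n)" and pushable: "\<And>n. pushable U (\<P> n)"
    and P: "\<And>f. continuous_on K f \<Longrightarrow> (\<And>n. \<P> n (f ` K)) \<Longrightarrow> P f"
  shows "typical_in (Homeo_topology \<epsilon> (closure U) (frontier U)) P"
proof -
  let ?Y = "closure U"
  let ?M = "Homeo_eps \<epsilon> ?Y (frontier U)"
  let ?d = "Homeo_dist \<epsilon> ?Y (frontier U)"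
  have "K \<noteq> {}" using K(2) by auto
  then have Y: "?Y \<noteq> {}" "bounded ?Y" "compact ?Y" "K \<subseteq> ?Y" "U \<subseteq> ?Y"
    using K(3) U closure_subset[of U] by (auto simp: bounded_closure compact_closure)
  have cK: "compact K" using K(1) by (simp add: thin_def)
  have M: "continuous_on ?Y f" "inj_on f ?Y" "f ` ?Y = ?Y" "\<And>x. x \<in> frontier U \<Longrightarrow> f x = x"
    "(SUP x\<in>?Y. dist (f x) x) < \<epsilon>" if "f \<in> ?M" for f
    using that by (auto simp: Homeo_eps_def homeomorphism_def intro: inj_on_inverseI)
  have d: "?d f g = (SUP x\<in>?Y. dist (f x) (g x))" if "f \<in> ?M" "g \<in> ?M" for f g
    using that by (simp add: Homeo_dist_def dist_on_def)
  have d_le: "dist (f x) (g x) \<le> ?d f g" if "f \<in> ?M" "g \<in> ?M" "x \<in> ?Y" for f g x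
    unfolding d[OF that(1,2)] using M(3)[OF that(1)] M(3)[OF that(2)] that(3) Y(2)
    by (intro cSUP_upper bdd_above_dist_SUP) auto
  have fK: "continuous_on K f" "thin (f ` K)" "infinite (f ` K)" "f ` K \<subseteq> U" if "f \<in> ?M" for f
  proof -
    have c: "continuous_on K f" "inj_on f K" using M(1,2)[OF that] Y(4) by (auto intro: continuous_on_subset inj_on_subset)
    show "continuous_on K f" by (rule c)
    show "thin (f ` K)" using thin_image[OF K(1) c] .
    show "infinite (f ` K)" using K(2) c(2) by (simp add: finite_image_iff)
    show "f ` K \<subseteq> U" using image_frontier_fixed[OF M(2)[OF that] _ M(4)[OF that] U(1) K(3)] M(3)[OF that] by blast
  qed
  show ?thesis
    unfolding Homeo_topology_def
  proof (rule typical_in_mtopology[OF Metric_space_Homeo[OF Y(1,2)], where Q = "\<lambda>n f. \<P> n (f ` K)"])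
    fix n f assume f: "f \<in> ?M" "\<P> n (f ` K)"
    have "compact (f ` K)" using fK(1)[OF f(1)] cK by (rule compact_continuous_image)
    then obtain \<delta> where \<delta>: "0 < \<delta>" "\<And>g. (\<And>x. x \<in> K \<Longrightarrow> dist (f x) (g x) < \<delta>) \<Longrightarrow> \<P> n (g ` K)"
      using stable_image[OF stable _ f(2)] by blast
    show "\<exists>\<delta>>0. \<forall>g\<in>?M. ?d f g < \<delta> \<longrightarrow> \<P> n (g ` K)"
    proof (intro exI[of _ \<delta>] conjI ballI impI \<delta>)
      fix g x assume "g \<in> ?M" "?d f g < \<delta>" "x \<in> K"
      then show "dist (f x) (g x) < \<delta>" using d_le[OF f(1), of g x] Y(4) by force
    qed
  next
    fix n f and \<eta> :: real assume f: "f \<in> ?M" and "0 < \<eta>"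
    define S where "S = (SUP x\<in>?Y. dist (f x) x)"
    \<comment> \<open>Half of what is allowed: below \<eta> for the approximation, and below the gap
      between the displacement \<open>S\<close> of \<open>f\<close> and \<epsilon>, so that the
      composition stays in the space.\<close>
    define \<eta>' where "\<eta>' = min \<eta> (\<epsilon> - S) / 2"
    have \<eta>': "0 < \<eta>'" "\<eta>' < \<eta>" "S + \<eta>' < \<epsilon>"
      using M(5)[OF f] \<open>0 < \<eta>\<close> by (auto simp: \<eta>'_def S_def min_def field_simps)
    obtain h where h: "push U \<eta>' h" "\<P> n (h ` f ` K)"
      using pushable \<eta>'(1) fK[OF f] unfolding pushable_def by blast
    define g where "g = restrict (h \<circ> f) ?Y"
    have g: "g x = h (f x)" if "x \<in> ?Y" for x using that by (simp add: g_def)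
    have "continuous_on ?Y (h \<circ> f)" by (intro continuous_on_compose M(1)[OF f] push_continuous[OF h(1)])
    then have cont: "continuous_on ?Y g" using g by (subst continuous_on_cong[OF refl]) auto
    have inj: "inj_on g ?Y"
    proof (rule inj_onI)
      fix x y assume xy: "x \<in> ?Y" "y \<in> ?Y" "g x = g y"
      then have "f x = f y" using g push_bij[OF h(1)] by (simp add: bij_def inj_eq)
      then show "x = y" using M(2)[OF f] xy by (meson inj_onD)
    qed
    have "g ` ?Y = h ` f ` ?Y" using g by (simp add: image_image)
    then have img: "g ` ?Y = ?Y" using M(3)[OF f] push_image_eq[OF h(1) Y(5)] by simp
    obtain g' where "homeomorphism ?Y ?Y g g'" using homeomorphism_compact[OF Y(3) cont img inj] by blast
    moreover have "g x = x" if "x \<in> frontier U" for x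
    proof -
      have "x \<in> ?Y" "x \<notin> U" using that U(1) by (auto simp: frontier_def interior_open)
      then show ?thesis using g M(4)[OF f that] push_off[OF h(1)] by simp
    qed
    moreover have "(SUP x\<in>?Y. dist (g x) x) < \<epsilon>"
    proof -
      have "(SUP x\<in>?Y. dist (g x) x) \<le> S + \<eta>'"
      proof (rule cSUP_least[OF Y(1)])
        fix x assume x: "x \<in> ?Y"
        have "dist (f x) x \<le> S" unfolding S_def using M(3)[OF f] x Y(2)
          by (intro cSUP_upper bdd_above_dist_SUP) auto
        then show "dist (g x) x \<le> S + \<eta>'"
          using push_dist[OF h(1), of "f x"] dist_triangle[of "g x" x "f x"] g[OF x] by simp
      qed
      then show ?thesis using \<eta>'(3) by linarith
    qed
    moreover have "g \<in> extensional ?Y" by (simp add: g_def)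
    ultimately have gM: "g \<in> ?M" unfolding Homeo_eps_def by blast
    have "?d f g \<le> \<eta>'"
      unfolding d[OF f gM]
    proof (rule cSUP_least[OF Y(1)])
      fix x assume x: "x \<in> ?Y"
      then show "dist (f x) (g x) \<le> \<eta>'" using g[OF x] push_dist[OF h(1), of "f x"] by (simp add: dist_commute)
    qed
    moreover have "g ` K = h ` f ` K" unfolding image_image using g Y(4) by (intro image_cong) auto
    ultimately show "\<exists>g\<in>?M. ?d f g < \<eta> \<and> \<P> n (g ` K)" using gM h(2) \<eta>'(2) by (intro bexI[of _ g]) auto
  next
    fix f assume f: "f \<in> ?M" "\<And>n. \<P> n (f ` K)"
    show "P f" using fK(1)[OF f(1)] f(2) by (rule P)
  qed
qed

lemma typical_isotopy:
  fixes K U :: "'a::euclidean_space set" and \<P> :: "nat \<Rightarrow> 'a set \<Rightarrow> bool"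
  assumes K: "thin K" "infinite K" "K \<subseteq> U" and U: "open U" "bounded U"
    and stable: "\<And>n. stable (\<P> n)" and pushable: "\<And>n. pushable U (\<P> n)"
    and P: "\<And>F. continuous_on K (\<lambda>x. F (x, 1)) \<Longrightarrow> (\<And>n. \<P> n ((\<lambda>x. F (x, 1)) ` K)) \<Longrightarrow> P F"
  shows "typical_in (Isot_topology \<epsilon> (closure U) (frontier U)) P"
proof -
  let ?Y = "closure U" and ?I = "{0..1::real}"
  let ?M = "Isot_eps \<epsilon> ?Y (frontier U)"
  let ?d = "Isot_dist \<epsilon> ?Y (frontier U)"
  have "K \<noteq> {}" using K(2) by auto
  then have Y: "?Y \<noteq> {}" "bounded ?Y" "compact ?Y" "K \<subseteq> ?Y" "U \<subseteq> ?Y"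
    using K(3) U closure_subset[of U] by (auto simp: bounded_closure compact_closure)
  have Z: "?Y \<times> ?I \<noteq> {}" using Y(1) by auto
  have cK: "compact K" using K(1) by (simp add: thin_def)
  have M: "continuous_on (?Y \<times> ?I) F" "\<And>z. z \<in> ?Y \<times> ?I \<Longrightarrow> F z \<in> ?Y"
    "\<And>t. t \<in> ?I \<Longrightarrow> \<exists>g. homeomorphism ?Y ?Y (\<lambda>x. F (x, t)) g" "\<And>x. x \<in> ?Y \<Longrightarrow> F (x, 0) = x"
    "\<And>x t. t \<in> ?I \<Longrightarrow> x \<in> frontier U \<Longrightarrow> F (x, t) = x"
    "(SUP z\<in>?Y \<times> ?I. dist (F z) (fst z)) < \<epsilon>" if "F \<in> ?M" for F
    using that unfolding Isot_eps_def isotopy_on_def case_prod_unfold by auto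
  have slice: "continuous_on ?Y (\<lambda>x. F (x, t))" "inj_on (\<lambda>x. F (x, t)) ?Y" "(\<lambda>x. F (x, t)) ` ?Y = ?Y"
    if "F \<in> ?M" "t \<in> ?I" for F t
    using M(3)[OF that] by (auto simp: homeomorphism_def intro: inj_on_inverseI)
  have d: "?d F G = (SUP z\<in>?Y \<times> ?I. dist (F z) (G z))" if "F \<in> ?M" "G \<in> ?M" for F G
    using that by (simp add: Isot_dist_def dist_on_def case_prod_unfold)
  have d_le: "dist (F z) (G z) \<le> ?d F G" if "F \<in> ?M" "G \<in> ?M" "z \<in> ?Y \<times> ?I" for F G z
    unfolding d[OF that(1,2)] by (intro cSUP_upper[OF that(3)] bdd_above_dist_SUP[OF Y(2)] M(2) that)
  have FK: "continuous_on K (\<lambda>x. F (x, 1))" "thin ((\<lambda>x. F (x, 1)) ` K)" "infinite ((\<lambda>x. F (x, 1)) ` K)"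
    "(\<lambda>x. F (x, 1)) ` K \<subseteq> U" if "F \<in> ?M" for F
  proof -
    have 1: "(1::real) \<in> ?I" by simp
    note s = slice[OF that 1]
    have c: "continuous_on K (\<lambda>x. F (x, 1))" "inj_on (\<lambda>x. F (x, 1)) K"
      using s(1,2) Y(4) by (auto intro: continuous_on_subset inj_on_subset)
    show "continuous_on K (\<lambda>x. F (x, 1))" by (rule c)
    show "thin ((\<lambda>x. F (x, 1)) ` K)" using thin_image[OF K(1) c] .
    show "infinite ((\<lambda>x. F (x, 1)) ` K)" using K(2) c(2) by (simp add: finite_image_iff)
    show "(\<lambda>x. F (x, 1)) ` K \<subseteq> U"
      by (rule image_frontier_fixed[OF s(2) equalityD1[OF s(3)] M(5)[OF that 1] U(1) K(3)])
  qed
  show ?thesis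
    unfolding Isot_topology_def
  proof (rule typical_in_mtopology[OF Metric_space_Isot[OF Y(1,2)], where Q = "\<lambda>n F. \<P> n ((\<lambda>x. F (x, 1)) ` K)"])
    fix n F assume F: "F \<in> ?M" "\<P> n ((\<lambda>x. F (x, 1)) ` K)"
    have "compact ((\<lambda>x. F (x, 1)) ` K)" using FK(1)[OF F(1)] cK by (rule compact_continuous_image)
    then obtain \<delta> where \<delta>: "0 < \<delta>" "\<And>g. (\<And>x. x \<in> K \<Longrightarrow> dist (F (x, 1)) (g x) < \<delta>) \<Longrightarrow> \<P> n (g ` K)"
      using stable_image[OF stable _ F(2)] by blast
    show "\<exists>\<delta>>0. \<forall>G\<in>?M. ?d F G < \<delta> \<longrightarrow> \<P> n ((\<lambda>x. G (x, 1)) ` K)"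
    proof (intro exI[of _ \<delta>] conjI ballI impI \<delta>)
      fix G x assume G: "G \<in> ?M" "?d F G < \<delta>" "x \<in> K"
      have "(x, 1) \<in> ?Y \<times> ?I" using G(3) Y(4) by auto
      from d_le[OF F(1) G(1) this] G(2) show "dist (F (x, 1)) (G (x, 1)) < \<delta>" by (rule le_less_trans)
    qed
  next
    fix n F and \<eta> :: real assume F: "F \<in> ?M" and "0 < \<eta>"
    define S where "S = (SUP z\<in>?Y \<times> ?I. dist (F z) (fst z))"
    define \<eta>' where "\<eta>' = min \<eta> (\<epsilon> - S) / 2"
    have \<eta>': "0 < \<eta>'" "\<eta>' < \<eta>" "S + \<eta>' < \<epsilon>"
      using M(6)[OF F] \<open>0 < \<eta>\<close> by (auto simp: \<eta>'_def S_def min_def field_simps)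
    obtain h where h: "push U \<eta>' h" "\<P> n (h ` (\<lambda>x. F (x, 1)) ` K)"
      using pushable \<eta>'(1) FK[OF F] unfolding pushable_def by blast
    obtain H where H: "ambient_isotopy U \<eta>' H" "h = (\<lambda>x. H (x, 1))" using h(1) by (auto simp: push_def)
    note HD = ambient_isotopyD[OF H(1)]
    \<comment> \<open>Composition at equal times: \<open>G\<close> still starts at the identity, and
      its end map is \<open>h\<close> after the end map of \<open>F\<close>.\<close>
    define G where "G = restrict (\<lambda>z. H (F z, snd z)) (?Y \<times> ?I)"
    have G: "G z = H (F z, snd z)" if "z \<in> ?Y \<times> ?I" for z using that by (simp add: G_def)
    have close: "dist (G z) (F z) \<le> \<eta>'" if "z \<in> ?Y \<times> ?I" for z
      unfolding G[OF that] using that by (intro HD(5)) auto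
    have Gt: "(\<lambda>x. G (x, t)) ` ?Y = ?Y \<and> (\<exists>g. homeomorphism ?Y ?Y (\<lambda>x. G (x, t)) g)" if t: "t \<in> ?I" for t
    proof -
      note s = slice[OF F t]
      have p: "push U \<eta>' (\<lambda>x. H (x, t))" by (rule ambient_isotopy_push[OF H(1) t])
      have g: "G (x, t) = H (F (x, t), t)" if "x \<in> ?Y" for x using G[of "(x, t)"] that t by simp
      have "continuous_on ?Y ((\<lambda>x. H (x, t)) \<circ> (\<lambda>x. F (x, t)))" by (intro continuous_on_compose s(1) push_continuous[OF p])
      then have cont: "continuous_on ?Y (\<lambda>x. G (x, t))" using g by (subst continuous_on_cong[OF refl]) auto
      have inj: "inj_on (\<lambda>x. G (x, t)) ?Y"
      proof (rule inj_onI)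
        fix x y assume xy: "x \<in> ?Y" "y \<in> ?Y" "G (x, t) = G (y, t)"
        then have "(\<lambda>x. H (x, t)) (F (x, t)) = (\<lambda>x. H (x, t)) (F (y, t))" using g by simp
        then have "F (x, t) = F (y, t)" using push_bij[OF p] unfolding bij_def inj_def by blast
        then show "x = y" using inj_onD[OF s(2)] xy by blast
      qed
      have "(\<lambda>x. G (x, t)) ` ?Y = (\<lambda>x. H (x, t)) ` (\<lambda>x. F (x, t)) ` ?Y" using g by (simp add: image_image)
      then have img: "(\<lambda>x. G (x, t)) ` ?Y = ?Y" unfolding s(3) push_image_eq[OF p Y(5)] .
      show ?thesis using homeomorphism_compact[OF Y(3) cont img inj] img by blast
    qed
    have "continuous_on (?Y \<times> ?I) (\<lambda>z. (F z, snd z))"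
      by (intro continuous_on_Pair M(1)[OF F] continuous_on_snd continuous_on_id)
    then have "continuous_on (?Y \<times> ?I) (\<lambda>z. H (F z, snd z))"
      by (rule continuous_on_compose2[OF HD(1)]) auto
    then have Gc: "continuous_on (?Y \<times> ?I) G" using G by (subst continuous_on_cong[OF refl]) auto
    have "G ` (?Y \<times> ?I) \<subseteq> ?Y" using Gt by blast
    moreover have "G (x, 0) = x" if "x \<in> ?Y" for x using G[of "(x, 0)"] that M(4)[OF F that] HD(3) by simp
    ultimately have iso: "isotopy_on ?Y G" unfolding isotopy_on_def using Gc Gt by blast
    have fixed: "G (x, t) = x" if "t \<in> ?I" "x \<in> frontier U" for x t
    proof -
      have "x \<in> ?Y" "x \<notin> U" using that U(1) by (auto simp: frontier_def interior_open)
      then show ?thesis using G[of "(x, t)"] M(5)[OF F that] HD(4)[OF that(1)] that(1) by simp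
    qed
    have "(SUP z\<in>?Y \<times> ?I. dist (G z) (fst z)) < \<epsilon>"
    proof -
      have "(SUP z\<in>?Y \<times> ?I. dist (G z) (fst z)) \<le> S + \<eta>'"
      proof (rule cSUP_least[OF Z])
        fix z assume z: "z \<in> ?Y \<times> ?I"
        have "dist (F z) (fst z) \<le> S" unfolding S_def
          by (intro cSUP_upper[OF z] bdd_above_dist_SUP[OF Y(2)] M(2)[OF F]) auto
        then show "dist (G z) (fst z) \<le> S + \<eta>'"
          using close[OF z] dist_triangle[of "G z" "fst z" "F z"] by linarith
      qed
      then show ?thesis using \<eta>'(3) by linarith
    qed
    then have GM: "G \<in> ?M" unfolding Isot_eps_def case_prod_unfold using iso fixed by (auto simp: G_def)
    have "?d F G \<le> \<eta>'"
      unfolding d[OF F GM] using close by (intro cSUP_least[OF Z]) (simp add: dist_commute)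
    moreover have "(\<lambda>x. G (x, 1)) ` K = h ` (\<lambda>x. F (x, 1)) ` K"
      unfolding image_image H(2) using G Y(4) by (intro image_cong) auto
    ultimately show "\<exists>G\<in>?M. ?d F G < \<eta> \<and> \<P> n ((\<lambda>x. G (x, 1)) ` K)" using GM h(2) \<eta>'(2) by (intro bexI[of _ G]) auto
  next
    fix F assume F: "F \<in> ?M" "\<And>n. \<P> n ((\<lambda>x. F (x, 1)) ` K)"
    show "P F" using FK(1)[OF F(1)] F(2) by (rule P)
  qed
qed

lemma homeomorphic_infinite:
  assumes "S homeomorphic T" "infinite T" shows "infinite S"
  using assms unfolding homeomorphic_def homeomorphism_def by (metis finite_imageI)

theorem corollary3p3:
  fixes K U :: "(real ^ 3) set" and \<epsilon> :: real
  assumes "K homeomorphic sphere (0 :: real ^ 2) 1 \<or> K homeomorphic {0..1::real}"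
    and "open U" and "bounded U" and "K \<subseteq> U"
    and "\<epsilon> > 0"
  shows "typical_in (Homeo_topology \<epsilon> (closure U) (frontier U))
           (\<lambda>f. \<forall>L. subspace L \<and> L \<noteq> {0} \<longrightarrow>
              covering_dim (top_of_set (orth_proj L ` f ` K)) = 1 \<and>
              hausdorff_dim (orth_proj L ` f ` K) = 1)
       \<and> typical_in (Isot_topology \<epsilon> (closure U) (frontier U))
           (\<lambda>F. \<forall>L. subspace L \<and> L \<noteq> {0} \<longrightarrow>
              covering_dim (top_of_set (orth_proj L ` (\<lambda>x. F (x, 1)) ` K)) = 1 \<and>
              hausdorff_dim (orth_proj L ` (\<lambda>x. F (x, 1)) ` K) = 1)"
proof -
  have thin: "thin K" using assms(1) thin_homeomorphic[OF thin_circle] thin_homeomorphic[OF thin_interval] by blast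
  have conn: "connected K"
    using assms(1)
  proof
    assume "K homeomorphic sphere (0 :: real ^ 2) 1"
    from homeomorphic_connectedness[OF this] show ?thesis by (simp add: connected_sphere)
  next
    assume "K homeomorphic {0..1::real}"
    from homeomorphic_connectedness[OF this] show ?thesis by simp
  qed
  have "infinite (sphere (0 :: real ^ 2) 1)"
  proof
    assume "finite (sphere (0 :: real ^ 2) 1)"
    moreover have "connected (sphere (0 :: real ^ 2) 1)" by (simp add: connected_sphere)
    ultimately have "sphere (0 :: real ^ 2) 1 = {} \<or> (\<exists>a. sphere (0 :: real ^ 2) 1 = {a})"
      using connected_finite_iff_sing by blast
    moreover have "axis 1 1 \<in> sphere (0 :: real ^ 2) 1" "axis 2 1 \<in> sphere (0 :: real ^ 2) 1" by simp_all
    ultimately have "axis 1 1 = (axis 2 1 :: real ^ 2)" by (metis empty_iff singletonD)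
    then show False by (simp add: axis_eq_axis)
  qed
  then have inf: "infinite K"
    using assms(1) homeomorphic_infinite[of K "sphere (0 :: real ^ 2) 1"] homeomorphic_infinite[of K "{0..1::real}"]
    by (auto simp: infinite_Icc)
  \<comment> \<open>Index 0 supplies the lower bounds. In the other conditions the exponent tends to
    1 and the bound to 0 together, so that one countable family serves all exponents above
    1.\<close>
  define \<P> :: "nat \<Rightarrow> (real ^ 3) set \<Rightarrow> bool"
    where "\<P> n = (case n of 0 \<Rightarrow> spread | Suc m \<Rightarrow> small_content (1 + 1 / Suc m) (1 / Suc m))" for n
  have st: "stable (\<P> n)" for n
    by (cases n) (auto simp: \<P>_def stable_spread stable_small_content)
  have pu: "pushable U (\<P> n)" for n
    by (cases n) (auto simp: \<P>_def pushable_spread assms intro!: pushable_small_content)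
  have dims: "\<forall>L. subspace L \<and> L \<noteq> {0} \<longrightarrow>
      covering_dim (top_of_set (orth_proj L ` f ` K)) = 1 \<and> hausdorff_dim (orth_proj L ` f ` K) = 1"
    if f: "continuous_on K f" "\<And>n. \<P> n (f ` K)" for f
  proof (intro allI impI)
    fix L :: "(real ^ 3) set" assume L: "subspace L \<and> L \<noteq> {0}"
    have "compact K" using thin by (simp add: thin_def)
    then have "compact (f ` K)" "connected (f ` K)"
      using f(1) conn by (auto intro: compact_continuous_image connected_continuous_image)
    moreover have "spread (f ` K)" using f(2)[of 0] by (simp add: \<P>_def)
    moreover have "small_content (1 + 1 / Suc n) (1 / Suc n) (f ` K)" for n using f(2)[of "Suc n"] by (simp add: \<P>_def)
    ultimately show "covering_dim (top_of_set (orth_proj L ` f ` K)) = 1 \<and> hausdorff_dim (orth_proj L ` f ` K) = 1"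
      using L by (intro dim_orth_proj_eq_1) auto
  qed
  show ?thesis
  proof
    show "typical_in (Homeo_topology \<epsilon> (closure U) (frontier U))
           (\<lambda>f. \<forall>L. subspace L \<and> L \<noteq> {0} \<longrightarrow>
              covering_dim (top_of_set (orth_proj L ` f ` K)) = 1 \<and>
              hausdorff_dim (orth_proj L ` f ` K) = 1)"
      by (rule typical_homeomorphism[OF thin inf assms(4,2,3) st pu dims])
    show "typical_in (Isot_topology \<epsilon> (closure U) (frontier U))
           (\<lambda>F. \<forall>L. subspace L \<and> L \<noteq> {0} \<longrightarrow>
              covering_dim (top_of_set (orth_proj L ` (\<lambda>x. F (x, 1)) ` K)) = 1 \<and>
              hausdorff_dim (orth_proj L ` (\<lambda>x. F (x, 1)) ` K) = 1)"
      by (rule typical_isotopy[OF thin inf assms(4,2,3) st pu dims])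
  qed
qed

end
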